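(* Let $n>5$ be an integer and let $N$ be the homogeneous norm on the anisotropic Heisenberg group $\mathbb{R}^{2n+1}$ associated with the fundamental solution $N^{-2n}$ of the sub-Laplacian. Let $k\ge3$ and let $d\mu=\frac{\exp(-N^{k}\log(N+1))}{Z}\,d\lambda$, where $\lambda$ is Lebesgue measure on $\mathbb{R}^{2n+1}$ and $Z$ is the normalization constant making $\mu$ a probability measure. Then for every $q\ge2$ the $q$-Poincaré inequality holds for $\mu$: there is a constant $c\in(0,\infty)$, independent of $f$, such that $$\int\Big|f-\int f\,d\mu\Big|^{q}\,d\mu\ \le\ c\int|\nabla f|^{q}\,d\mu$$ for all functions $f$ for which the right-hand side is well defined.
   Context: The anisotropic Heisenberg group is $\mathbb{R}^{2n+1}$, with points $(x,t)=(x_1,\dots,x_{2n},t)$ and group law $$(x,t)\circ(\eta,\tau)=\Big(x+\eta,\ t+\tau+\tfrac{x_1\eta_{n+1}}{2}-\tfrac{x_{n+1}\eta_1}{2}+\sum_{j=2}^n (x_j\eta_{j+n}-\eta_j x_{j+n})\Big).$$ The sub-gradient is $\nabla=(X_1,\dots,X_{2n})$, where $X_1=\partial_{x_1}-\frac{x_{n+1}}{2}\partial_t$, $X_{n+1}=\partial_{x_{n+1}}+\frac{x_1}{2}\partial_t$, $X_j=\partial_{x_j}-x_{j+n}\partial_t$ for $j=2,\dots,n$, and $X_j=\partial_{x_j}+x_{j-n}\partial_t$ for $j=n+2,\dots,2n$; $|\nabla f|^2=\sum_j (X_jf)^2$; the sub-Laplacian is $\sum_{j=1}^{2n}X_j^2$.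 The norm $N$ is given explicitly by $$N(x,t)=\frac{\left(B^{2}+t^{2}\right)^{\frac{1}{4n}}\left(AB+t^{2}+A\sqrt{B^{2}+t^{2}}\right)^{\frac{1}{2}-\frac{1}{4n}}}{\left(B+\sqrt{B^{2}+t^{2}}\right)^{\frac{1}{2}}}\quad((x,t)\ne0),\qquad N(0,0)=0,$$ with $A=\frac{x_1^2+x_{n+1}^2}{2}+\frac12\sum_{2\le j\le 2n,\,j\ne n+1}x_j^2$ and $B=\frac{x_1^2+x_{n+1}^2}{4}+\frac12\sum_{2\le j\le 2n,\,j\ne n+1}x_j^2$. The inequality is understood for real-valued $\mu$-integrable functions $f$ with (weak) sub-gradient. *)

theory Defs
  imports "HOL-Analysis.Analysis"
begin

text \<open>
  The group is modelled on \<open>real ^ ('n + 'n) \<times> real\<close> with \<open>n = CARD('n)\<close>. For the \<open>j\<close>-th element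
  \<open>i\<close> of \<open>'n\<close>, \<open>x $ Inl i\<close> is the coordinate \<open>x\<^sub>j\<close> and \<open>x $ Inr i\<close> is the coordinate with index \<open>n + j\<close>.
  The parameter \<open>e :: 'n\<close> plays the role of the distinguished index 1; its choice is immaterial,
  so it is left arbitrary.
\<close>

type_synonym 'n heis = "(real ^ ('n + 'n)) \<times> real"

definition coef :: "'n::finite \<Rightarrow> 'n \<Rightarrow> real" where
  "coef e i = (if i = e then 1/2 else 1)"

definition heis_mult :: "'n::finite \<Rightarrow> 'n heis \<Rightarrow> 'n heis \<Rightarrow> 'n heis" where
  "heis_mult e p p' = (case (p, p') of ((x, t), (y, s)) \<Rightarrow>
     (x + y, t + s + (\<Sum>i\<in>UNIV. coef e i * (x $ Inl i * y $ Inr i - y $ Inl i * x $ Inr i))))"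

text \<open>The horizontal fields, given as tangent vectors: \<open>X\<^sub>j f\<close> at \<open>p\<close> is the derivative of \<open>f\<close> at \<open>p\<close>
  in the direction \<open>horiz e j p\<close>.\<close>

fun horiz :: "'n::finite \<Rightarrow> 'n + 'n \<Rightarrow> 'n heis \<Rightarrow> 'n heis" where
  "horiz e (Inl i) (x, t) = (axis (Inl i) 1, - coef e i * x $ Inr i)"
| "horiz e (Inr i) (x, t) = (axis (Inr i) 1, coef e i * x $ Inl i)"

lemma heis_mult_axis:
  fixes e :: "'n::finite" and p :: "'n heis"
  shows "heis_mult e p (s *\<^sub>R axis j 1, 0) = p + s *\<^sub>R horiz e j p"
proof (cases p; cases j)
  fix x :: "real ^ ('n + 'n)" and t :: real and i :: 'n assume p: "p = (x, t)" and j: "j = Inl i"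
  have "(\<Sum>k\<in>UNIV. coef e k * (x $ Inl k * (s *\<^sub>R axis (Inl i) 1 :: real ^ ('n + 'n)) $ Inr k
          - (s *\<^sub>R axis (Inl i) 1 :: real ^ ('n + 'n)) $ Inl k * x $ Inr k))
      = (\<Sum>k\<in>UNIV. if i = k then - (s * (coef e k * x $ Inr k)) else 0)"
    by (rule sum.cong) (auto simp: axis_def)
  then show ?thesis by (simp add: heis_mult_def p j)
next
  fix x :: "real ^ ('n + 'n)" and t :: real and i :: 'n assume p: "p = (x, t)" and j: "j = Inr i"
  have "(\<Sum>k\<in>UNIV. coef e k * (x $ Inl k * (s *\<^sub>R axis (Inr i) 1 :: real ^ ('n + 'n)) $ Inr k
          - (s *\<^sub>R axis (Inr i) 1 :: real ^ ('n + 'n)) $ Inl k * x $ Inr k))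
      = (\<Sum>k\<in>UNIV. if i = k then s * (coef e k * x $ Inl k) else 0)"
    by (rule sum.cong) (auto simp: axis_def)
  then show ?thesis by (simp add: heis_mult_def p j)
qed

definition formA :: "'n::finite \<Rightarrow> real ^ ('n + 'n) \<Rightarrow> real" where
  "formA e x = ((x $ Inl e)\<^sup>2 + (x $ Inr e)\<^sup>2) / 2 + 1/2 * (\<Sum>j\<in>UNIV - {Inl e, Inr e}. (x $ j)\<^sup>2)"

definition formB :: "'n::finite \<Rightarrow> real ^ ('n + 'n) \<Rightarrow> real" where
  "formB e x = ((x $ Inl e)\<^sup>2 + (x $ Inr e)\<^sup>2) / 4 + 1/2 * (\<Sum>j\<in>UNIV - {Inl e, Inr e}. (x $ j)\<^sup>2)"

definition hnorm :: "'n::finite \<Rightarrow> 'n heis \<Rightarrow> real" where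
  "hnorm e p = (case p of (x, t) \<Rightarrow>
     let A = formA e x; B = formB e x; n = real CARD('n) in
     if p = 0 then 0
     else (B\<^sup>2 + t\<^sup>2) powr (1 / (4 * n))
            * (A * B + t\<^sup>2 + A * sqrt (B\<^sup>2 + t\<^sup>2)) powr (1/2 - 1 / (4 * n))
          / (B + sqrt (B\<^sup>2 + t\<^sup>2)) powr (1/2))"

definition weight :: "'n::finite \<Rightarrow> real \<Rightarrow> 'n heis \<Rightarrow> real" where
  "weight e k p = exp (- (hnorm e p powr k * ln (hnorm e p + 1)))"

definition norm_const :: "'n::finite \<Rightarrow> real \<Rightarrow> real" where
  "norm_const e k = (\<integral>p. weight e k p \<partial>lebesgue)"

definition heis_measure :: "'n::finite \<Rightarrow> real \<Rightarrow> 'n heis measure" where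
  "heis_measure e k = density lebesgue (\<lambda>p. ennreal (weight e k p / norm_const e k))"

primrec C_k :: "nat \<Rightarrow> ('a::euclidean_space \<Rightarrow> real) \<Rightarrow> bool" where
  "C_k 0 f \<longleftrightarrow> continuous_on UNIV f"
| "C_k (Suc m) f \<longleftrightarrow> (\<forall>x. f differentiable at x) \<and>
      (\<forall>v. C_k m (\<lambda>x. frechet_derivative f (at x) v))"

definition test_function :: "('a::euclidean_space \<Rightarrow> real) \<Rightarrow> bool" where
  "test_function \<phi> \<longleftrightarrow> (\<forall>m. C_k m \<phi>) \<and> compact (closure {x. \<phi> x \<noteq> 0})"

definition locally_integrable :: "('a::euclidean_space \<Rightarrow> real) \<Rightarrow> bool" where
  "locally_integrable f \<longleftrightarrow> (\<forall>K. compact K \<longrightarrow> set_integrable lebesgue K f)"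

text \<open>Each horizontal field is divergence free, so its formal adjoint is minus itself.\<close>

definition weak_subgradient ::
  "'n::finite \<Rightarrow> ('n heis \<Rightarrow> real) \<Rightarrow> ('n heis \<Rightarrow> real ^ ('n + 'n)) \<Rightarrow> bool" where
  "weak_subgradient e f g \<longleftrightarrow> locally_integrable f \<and>
     (\<forall>j. locally_integrable (\<lambda>p. g p $ j) \<and>
       (\<forall>\<phi>. test_function \<phi> \<longrightarrow>
          (\<integral>p. f p * frechet_derivative \<phi> (at p) (horiz e j p) \<partial>lebesgue)
            = - (\<integral>p. g p $ j * \<phi> p \<partial>lebesgue)))"

text \<open>The integrals are taken in \<open>[0, \<infinity>]\<close>: when the right-hand side is finite, the inequality
  includes the integrability of the left-hand side. \<open>norm (g p)\<close> is the Euclidean norm.\<close>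

definition q_poincare :: "'n::finite \<Rightarrow> real \<Rightarrow> 'n heis measure \<Rightarrow> bool" where
  "q_poincare e q M \<longleftrightarrow> (\<exists>c>0. \<forall>f g. integrable M f \<longrightarrow> weak_subgradient e f g \<longrightarrow>
     (\<integral>\<^sup>+p. ennreal (\<bar>f p - (\<integral>p'. f p' \<partial>M)\<bar> powr q) \<partial>M)
       \<le> ennreal c * (\<integral>\<^sup>+p. ennreal (norm (g p) powr q) \<partial>M))"

end

theory Submission
  imports Defs
begin

text \<open>
  The inequality is reduced to finite differences of \<open>f\<close> along straight horizontal lines
  \<open>s \<mapsto> p \<circ> (s v, 0)\<close>, \<open>v \<in> \<real>\<^sup>2\<^sup>n\<close>; the norm \<open>N\<close> enters only through a comparison of the weight
  \<open>w = exp (- N\<^sup>k log (N + 1))\<close> at the points of such a line.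

  \<^bold>\<open>Differences.\<close> Testing the weak gradient \<open>g\<close> against translates of a test function gives
  \<open>f (p \<circ> (v, 0)) - f p = \<integral>\<^sub>0\<^sup>1 g (p \<circ> (s v, 0)) \<bullet> v ds\<close> for each fixed \<open>v\<close> and almost every \<open>p\<close>
  (\<open>AE_difference_formula\<close>). Right translations preserve Lebesgue measure, so Jensen's inequality
  turns this into \<open>\<integral> a |f (p \<circ> (v, 0)) - f p|\<^sup>q \<le> |v|\<^sup>q \<integral> b |g|\<^sup>q\<close> as soon as \<open>a\<close> at \<open>p\<close> is at most \<open>b\<close>
  along the line (\<open>nn_integral_difference_le\<close>).

  \<^bold>\<open>Balls.\<close> Every group element is a product of five horizontal ones, because commutators reach the
  centre. Hence \<open>f (p \<circ> h) - f p\<close> is controlled by \<open>g\<close>, uniformly for bounded \<open>h\<close>, and integrating over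
  \<open>h\<close> gives a Poincare inequality on balls, with the gradient integrated over a larger set
  (\<open>local_poincare\<close>).

  \<^bold>\<open>Tail.\<close> There is a finite set \<open>V\<close> of directions such that from every far point \<open>p\<close> the line in one
  of them never enters a region of smaller weight and ends at a point whose weight is larger by any
  prescribed factor (\<open>weight_descent\<close>). Writing \<open>f p\<close> as the value at the end point minus a difference,
  the mass of \<open>|f - c|\<^sup>q\<close> far away is at most half its total mass plus a multiple of \<open>\<integral> w |g|\<^sup>q\<close>, and
  the first term can be absorbed once \<open>f - c\<close> is truncated (\<open>nn_integral_tail_sub_const_le\<close>).
  Together with the inequality on balls this proves the theorem.

  \<^bold>\<open>Why the directions exist.\<close> With \<open>D = \<surd>(B\<^sup>2 + t\<^sup>2)\<close> and \<open>S = A - B\<close> the norm is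
  \<open>N\<^sup>4\<^sup>n = D\<^sup>2 (S + D)\<^sup>2\<^sup>n\<^sup>-\<^sup>1 / (B + D)\<close>. Off the centre \<open>x = 0\<close> its horizontal gradient does not vanish:
  rotating all coordinate planes moves \<open>t\<close> towards \<open>0\<close> with \<open>B\<close> and \<open>S\<close> stationary, and for \<open>t = 0\<close> one
  contracts. Compactness and dilations make this uniform where \<open>B \<ge> b D\<close> (\<open>inner_descent\<close>). On the
  centre the gradient vanishes, but \<open>N\<close> decreases to second order when one moves outwards in a plane
  on which \<open>S\<close> vanishes, since \<open>B\<close> grows in the denominator (\<open>outward_move\<close>). In both cases a move of
  unit time lowers \<open>N\<close> at least by a factor \<open>exp (- c / N\<^sup>2)\<close>, hence \<open>N\<^sup>k log (N + 1)\<close> by a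
  multiple of \<open>N\<^bsup>k - 2\<^esup> log (N + 1)\<close>, which is unbounded (\<open>potential_drop\<close>).
\<close>

section \<open>Horizontal translations and Lebesgue measure\<close>

text \<open>
  The symplectic form of the group law, weighted by the anisotropy.
\<close>
definition omega :: "'n::finite \<Rightarrow> real ^ ('n + 'n) \<Rightarrow> real ^ ('n + 'n) \<Rightarrow> real" where
  "omega e x y = (\<Sum>i\<in>UNIV. coef e i * (x $ Inl i * y $ Inr i - y $ Inl i * x $ Inr i))"

lemma heis_mult_Pair: "heis_mult e (x, t) (y, s) = (x + y, t + s + omega e x y)"
  by (simp add: heis_mult_def omega_def)

lemma bilinear_omega: "bilinear (omega e)"
  unfolding bilinear_def omega_def
  by (auto intro!: linearI simp: algebra_simps sum.distrib sum_subtractf sum_distrib_left)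

lemmas omega_simps =
  bilinear_ladd[OF bilinear_omega] bilinear_radd[OF bilinear_omega]
  bilinear_lmul[OF bilinear_omega] bilinear_rmul[OF bilinear_omega]
  bilinear_lneg[OF bilinear_omega] bilinear_rneg[OF bilinear_omega]
  bilinear_lzero[OF bilinear_omega] bilinear_rzero[OF bilinear_omega]
  bilinear_lsub[OF bilinear_omega] bilinear_rsub[OF bilinear_omega]

lemma omega_self [simp]: "omega e x x = 0"
  by (simp add: omega_def)

lemma omega_commute: "omega e y x = - omega e x y"
  by (simp add: omega_def flip: sum_negf) (simp add: algebra_simps)

lemma bounded_bilinear_omega: "bounded_bilinear (omega e)"
  using bilinear_conv_bounded_bilinear bilinear_omega by blast

lemma continuous_on_omega [continuous_intros]:
  "continuous_on S f \<Longrightarrow> continuous_on S g \<Longrightarrow> continuous_on S (\<lambda>x. omega e (f x) (g x))"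
  by (rule bounded_bilinear.continuous_on[OF bounded_bilinear_omega])

lemma heis_mult_assoc: "heis_mult e (heis_mult e p q) r = heis_mult e p (heis_mult e q r)"
  by (cases p; cases q; cases r) (simp add: heis_mult_Pair omega_simps algebra_simps)

lemma continuous_on_heis_mult [continuous_intros]:
  assumes "continuous_on S f" "continuous_on S g"
  shows "continuous_on S (\<lambda>x. heis_mult e (f x) (g x))"
proof -
  have "heis_mult e (f x) (g x)
      = (fst (f x) + fst (g x), snd (f x) + snd (g x) + omega e (fst (f x)) (fst (g x)))" for x
    by (cases "f x"; cases "g x") (simp add: heis_mult_Pair)
  then show ?thesis
    by (simp add: assms continuous_intros)
qed

text \<open>
  Following the flow of the left-invariant field with constant horizontal coefficients \<open>v\<close> for unit
  time is right translation by \<open>(v, 0)\<close>; this is the only kind of move used below.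
\<close>
definition hmove :: "'n::finite \<Rightarrow> real ^ ('n + 'n) \<Rightarrow> 'n heis \<Rightarrow> 'n heis" where
  "hmove e v p = heis_mult e p (v, 0)"

abbreviation hline :: "'n::finite \<Rightarrow> real ^ ('n + 'n) \<Rightarrow> real \<Rightarrow> 'n heis \<Rightarrow> 'n heis" where
  "hline e v s p \<equiv> hmove e (s *\<^sub>R v) p"

lemma hmove_Pair: "hmove e v (x, t) = (x + v, t + omega e x v)"
  by (simp add: hmove_def heis_mult_Pair)

lemma continuous_on_hmove [continuous_intros]:
  "continuous_on S f \<Longrightarrow> continuous_on S g \<Longrightarrow> continuous_on S (\<lambda>x. hmove e (f x) (g x))"
  unfolding hmove_def by (intro continuous_intros)

lemma borel_measurable_heis_mult [measurable]:
  assumes [measurable]: "f \<in> borel_measurable M" "g \<in> borel_measurable M"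
  shows "(\<lambda>x. heis_mult e (f x) (g x)) \<in> borel_measurable M"
proof -
  have "continuous_on UNIV (\<lambda>z. heis_mult e (fst z) (snd z))"
    by (intro continuous_intros)
  from borel_measurable_continuous_onI[OF this]
  have "(\<lambda>x. (\<lambda>z. heis_mult e (fst z) (snd z)) (f x, g x)) \<in> borel_measurable M"
    by (rule measurable_compose_rev) simp
  then show ?thesis by simp
qed

lemma borel_measurable_hmove [measurable]:
  "f \<in> borel_measurable M \<Longrightarrow> g \<in> borel_measurable M \<Longrightarrow> (\<lambda>x. hmove e (f x) (g x)) \<in> borel_measurable M"
  unfolding hmove_def by (intro borel_measurable_heis_mult borel_measurable_Pair) simp_all

lemma hmove_hmove_scaled: "hmove e (r *\<^sub>R v) (hline e v s p) = hmove e ((s + r) *\<^sub>R v) p"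
  by (cases p) (simp add: hmove_Pair omega_simps algebra_simps)

lemma hmove_zero [simp]: "hmove e 0 p = p"
  by (cases p) (simp add: hmove_Pair omega_simps)

text \<open>A shear along the last coordinate, followed by a translation, preserves Lebesgue measure:
  integrate over the last coordinate first.\<close>
lemma nn_integral_lborel_shear:
  fixes F :: "'a::euclidean_space \<times> real \<Rightarrow> ennreal"
  assumes [measurable]: "F \<in> borel_measurable borel" "a \<in> borel_measurable borel"
  shows "(\<integral>\<^sup>+z. F (fst z + y, snd z + a (fst z)) \<partial>lborel) = (\<integral>\<^sup>+z. F z \<partial>lborel)"
proof -
  have [measurable]: "F \<in> borel_measurable (borel \<Otimes>\<^sub>M borel)"
    by (simp add: borel_prod)
  have shift: "(\<integral>\<^sup>+x. G (x + c) \<partial>lborel) = (\<integral>\<^sup>+x. G x \<partial>lborel)"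
    if [measurable]: "G \<in> borel_measurable borel" for G :: "'b::euclidean_space \<Rightarrow> ennreal" and c
  proof -
    have "(\<integral>\<^sup>+x. G x \<partial>lborel) = (\<integral>\<^sup>+x. G x \<partial>(distr lborel borel ((+) c)))"
      by (simp only: lborel_distr_plus)
    also have "\<dots> = (\<integral>\<^sup>+x. G (x + c) \<partial>lborel)"
      by (subst nn_integral_distr) (simp_all add: add.commute)
    finally show ?thesis by simp
  qed
  have "(\<integral>\<^sup>+z. F (fst z + y, snd z + a (fst z)) \<partial>lborel)
      = (\<integral>\<^sup>+z. F (fst z + y, snd z + a (fst z)) \<partial>(lborel \<Otimes>\<^sub>M lborel))"
    by (simp add: lborel_prod)
  also have "\<dots> = (\<integral>\<^sup>+x. \<integral>\<^sup>+t. F (x + y, t + a x) \<partial>lborel \<partial>lborel)"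
    by (subst lborel.nn_integral_fst[symmetric]) simp_all
  also have "\<dots> = (\<integral>\<^sup>+x. \<integral>\<^sup>+t. F (x + y, t) \<partial>lborel \<partial>lborel)"
    by (intro nn_integral_cong shift) simp
  also have "\<dots> = (\<integral>\<^sup>+x. \<integral>\<^sup>+t. F (x, t) \<partial>lborel \<partial>lborel)"
    by (rule shift) simp
  also have "\<dots> = (\<integral>\<^sup>+z. F z \<partial>(lborel \<Otimes>\<^sub>M lborel))"
    by (subst lborel.nn_integral_fst[symmetric]) simp_all
  finally show ?thesis by (simp add: lborel_prod)
qed

lemma nn_integral_right_translate:
  fixes F :: "'n::finite heis \<Rightarrow> ennreal"
  assumes [measurable]: "F \<in> borel_measurable borel"
  shows "(\<integral>\<^sup>+p. F (heis_mult e p h) \<partial>lborel) = (\<integral>\<^sup>+p. F p \<partial>lborel)"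
proof -
  have "F (heis_mult e p h) = F (fst p + fst h, snd p + (snd h + omega e (fst p) (fst h)))" for p
    by (cases p; cases h) (simp add: heis_mult_Pair algebra_simps)
  moreover have [measurable]: "(\<lambda>x. snd h + omega e x (fst h)) \<in> borel_measurable borel"
    by (intro borel_measurable_continuous_onI continuous_intros)
  ultimately show ?thesis
    by (simp add: nn_integral_lborel_shear[of F "\<lambda>x. snd h + omega e x (fst h)"])
qed

lemma nn_integral_left_translate:
  fixes F :: "'n::finite heis \<Rightarrow> ennreal"
  assumes [measurable]: "F \<in> borel_measurable borel"
  shows "(\<integral>\<^sup>+p. F (heis_mult e h p) \<partial>lborel) = (\<integral>\<^sup>+p. F p \<partial>lborel)"
proof -
  have "F (heis_mult e h p) = F (fst p + fst h, snd p + (snd h + omega e (fst h) (fst p)))" for p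
    by (cases p; cases h) (simp add: heis_mult_Pair algebra_simps)
  moreover have [measurable]: "(\<lambda>x. snd h + omega e (fst h) x) \<in> borel_measurable borel"
    by (intro borel_measurable_continuous_onI continuous_intros)
  ultimately show ?thesis
    by (simp add: nn_integral_lborel_shear[of F "\<lambda>x. snd h + omega e (fst h) x"])
qed

lemma distr_hmove: "distr lborel borel (hmove e v) = (lborel :: 'n::finite heis measure)"
proof (rule measure_eqI)
  fix S :: "'n heis set" assume "S \<in> sets (distr lborel borel (hmove e v))"
  then have [measurable]: "S \<in> sets borel" by simp
  have "emeasure (distr lborel borel (hmove e v)) S = (\<integral>\<^sup>+p. indicator S (hmove e v p) \<partial>lborel)"
    by (subst nn_integral_indicator[symmetric], simp, subst nn_integral_distr) simp_all
  also have "\<dots> = (\<integral>\<^sup>+p. indicator S p \<partial>lborel)"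
    unfolding hmove_def by (rule nn_integral_right_translate) simp
  finally show "emeasure (distr lborel borel (hmove e v)) S = emeasure lborel S" by simp
qed simp

section \<open>Smooth bumps on boxes\<close>

lemma C_k_Suc_iff:
  assumes "\<And>x. (f has_derivative f' x) (at x)"
  shows "C_k (Suc m) f \<longleftrightarrow> (\<forall>v. C_k m (\<lambda>x. f' x v))"
proof -
  have "f differentiable at x" for x
    using assms unfolding differentiable_def by blast
  moreover have "frechet_derivative f (at x) = f' x" for x
    using frechet_derivative_at[OF assms] by simp
  ultimately show ?thesis by simp
qed

lemma C_k_SucE:
  assumes "C_k (Suc m) f"
  obtains f' where "\<And>x. (f has_derivative f' x) (at x)" "\<And>v. C_k m (\<lambda>x. f' x v)"
  using assms by (intro that[of "\<lambda>x. frechet_derivative f (at x)"])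
    (auto simp: frechet_derivative_works)

lemma C_k_SucD: "C_k (Suc m) f \<Longrightarrow> C_k m f"
proof (induction m arbitrary: f)
  case 0
  then show ?case
    by (auto intro!: differentiable_imp_continuous_on simp: differentiable_on_def
        intro: differentiable_at_withinI)
qed (simp del: One_nat_def; blast)

lemma C_k_const: "C_k m (\<lambda>_::'a::euclidean_space. c)"
proof (induction m arbitrary: c)
  case (Suc m)
  have "((\<lambda>_::'a. c) has_derivative (\<lambda>_. 0)) (at x)" for x by simp
  from C_k_Suc_iff[OF this] Suc show ?case by blast
qed simp

lemma C_k_add:
  assumes "C_k m f" "C_k m g" shows "C_k m (\<lambda>x::'a::euclidean_space. f x + g x)"
  using assms
proof (induction m arbitrary: f g)
  case (Suc m)
  from Suc.prems obtain f' g' where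
    f: "\<And>x. (f has_derivative f' x) (at x)" "\<And>v. C_k m (\<lambda>x. f' x v)" and
    g: "\<And>x. (g has_derivative g' x) (at x)" "\<And>v. C_k m (\<lambda>x. g' x v)"
    by (metis C_k_SucE)
  have "((\<lambda>x. f x + g x) has_derivative (\<lambda>v. f' x v + g' x v)) (at x)" for x
    by (intro derivative_intros f g)
  from C_k_Suc_iff[OF this] Suc.IH f(2) g(2) show ?case by blast
qed (auto intro: continuous_intros)

lemma C_k_mult:
  assumes "C_k m f" "C_k m g" shows "C_k m (\<lambda>x::'a::euclidean_space. f x * g x)"
  using assms
proof (induction m arbitrary: f g)
  case (Suc m)
  from Suc.prems obtain f' g' where
    f: "\<And>x. (f has_derivative f' x) (at x)" "\<And>v. C_k m (\<lambda>x. f' x v)" and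
    g: "\<And>x. (g has_derivative g' x) (at x)" "\<And>v. C_k m (\<lambda>x. g' x v)"
    by (metis C_k_SucE)
  have "((\<lambda>x. f x * g x) has_derivative (\<lambda>v. f x * g' x v + f' x v * g x)) (at x)" for x
    by (intro has_derivative_mult f g)
  moreover have "C_k m (\<lambda>x. f x * g' x v + f' x v * g x)" for v
    by (intro C_k_add Suc.IH f g C_k_SucD[OF Suc.prems(1)] C_k_SucD[OF Suc.prems(2)])
  ultimately show ?case
    using C_k_Suc_iff[of "\<lambda>x. f x * g x" "\<lambda>x v. f x * g' x v + f' x v * g x"] by blast
qed (auto intro: continuous_intros)

lemma C_k_prod:
  assumes "\<And>i. i \<in> I \<Longrightarrow> C_k m (f i)"
  shows "C_k m (\<lambda>x::'a::euclidean_space. \<Prod>i\<in>I. f i x)"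
  using assms
  by (induction I rule: infinite_finite_induct) (auto intro: C_k_const C_k_mult)

lemma C_k_compose_affine:
  fixes L :: "'a::euclidean_space \<Rightarrow> 'b::euclidean_space"
  assumes "C_k m f" "bounded_linear L" shows "C_k m (\<lambda>x. f (a + L x))"
  using assms(1)
proof (induction m arbitrary: f)
  case 0
  have "continuous_on UNIV (\<lambda>x. a + L x)"
    by (intro continuous_intros linear_continuous_on assms(2))
  with 0 show ?case
    by (auto intro: continuous_on_compose2[of UNIV f])
next
  case (Suc m)
  from Suc.prems obtain f' where
    f: "\<And>x. (f has_derivative f' x) (at x)" "\<And>v. C_k m (\<lambda>x. f' x v)"
    by (metis C_k_SucE)
  have "((\<lambda>x. a + L x) has_derivative L) (at x)" for x
    by (auto intro!: derivative_eq_intros bounded_linear_imp_has_derivative assms(2))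
  then have "((\<lambda>x. f (a + L x)) has_derivative (\<lambda>v. f' (a + L x) (L v))) (at x)" for x
    using diff_chain_at[of "\<lambda>x. a + L x" L x f "f' (a + L x)"] f(1) by (simp add: o_def)
  from C_k_Suc_iff[OF this] Suc.IH f(2) show ?case by blast
qed

text \<open>
  The classical flat function \<open>exp (- c / t)\<close>, together with the powers of \<open>1 / t\<close> that
  differentiation produces: the family is closed under derivatives, so smoothness becomes an
  induction over the order with \<open>a\<close> arbitrary.
\<close>
definition flat :: "real \<Rightarrow> nat \<Rightarrow> real \<Rightarrow> real" where
  "flat c a t = (if t > 0 then exp (- c * inverse t) * inverse t ^ a else 0)"

lemma flat_le_square:
  assumes "c > 0"
  obtains K where "\<And>t. \<bar>flat c a t\<bar> \<le> K * t\<^sup>2"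
proof -
  define m where "m = a + 2"
  define K where "K = fact m / c ^ m"
  have "\<bar>flat c a t\<bar> \<le> K * t\<^sup>2" for t
  proof (cases "t > 0")
    case True
    have "(c * inverse t) ^ m / fact m \<le> exp (c * inverse t)"
      using sum_le_suminf[OF summable_exp_generic[of "c * inverse t"], of "{m}"] assms True
      by (simp add: exp_def field_simps)
    then have "exp (- c * inverse t) \<le> fact m / (c * inverse t) ^ m"
      using assms True by (simp add: exp_minus field_simps)
    then have "flat c a t \<le> fact m / (c * inverse t) ^ m * inverse t ^ a"
      using True by (auto simp only: flat_def if_True intro!: mult_right_mono) simp
    also have "\<dots> = K * t\<^sup>2"
      using assms True by (simp add: K_def m_def power_mult_distrib power_add power2_eq_square field_simps)
    finally show ?thesis
      using True by (simp add: flat_def)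
  qed (use assms in \<open>simp add: flat_def K_def\<close>)
  then show ?thesis by (rule that)
qed

lemma flat_has_derivative:
  assumes "c > 0"
  shows "(flat c a has_field_derivative c * flat c (a + 2) t - a * flat c (a + 1) t) (at t)"
proof -
  consider "t > 0" | "t < 0" | "t = 0" by linarith
  then show ?thesis
  proof cases
    case 1
    have "((\<lambda>t. exp (- c * inverse t) * inverse t ^ a) has_field_derivative
        c * flat c (a + 2) t - a * flat c (a + 1) t) (at t)"
    proof -
      have "((\<lambda>t. exp (- c * inverse t) * inverse t ^ a) has_field_derivative
          exp (- c * inverse t) * (a * (inverse t ^ (a - 1) * - (inverse t * inverse t)))
          + exp (- c * inverse t) * (c * (inverse t * inverse t)) * inverse t ^ a) (at t)"
        using 1 by (auto intro!: derivative_eq_intros simp: algebra_simps)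
      moreover have "exp (- c * r) * (a * (r ^ (a - 1) * - (r * r))) + exp (- c * r) * (c * (r * r)) * r ^ a
          = c * (exp (- c * r) * r ^ (a + 2)) - a * (exp (- c * r) * r ^ (a + 1))" for r  :: real
        by (cases a) (simp_all add: algebra_simps)
      ultimately show ?thesis
        using 1 by (simp only: flat_def if_True)
    qed
    moreover have ev: "eventually (\<lambda>s. flat c a s = exp (- c * inverse s) * inverse s ^ a) (nhds t)"
      using eventually_nhds_in_open[of "{0<..}" t] 1
      by (auto elim!: eventually_mono simp: flat_def)
    ultimately show ?thesis
      by (subst DERIV_cong_ev[OF refl ev refl])
  next
    case 2
    have "((\<lambda>_. 0::real) has_field_derivative
        c * flat c (a + 2) t - a * flat c (a + 1) t) (at t)"
      using 2 by (simp add: flat_def)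
    moreover have ev: "eventually (\<lambda>s. flat c a s = 0) (nhds t)"
      using eventually_nhds_in_open[of "{..<0}" t] 2
      by (auto elim!: eventually_mono simp: flat_def)
    ultimately show ?thesis
      by (subst DERIV_cong_ev[OF refl ev refl])
  next
    case 3
    obtain K where K: "\<And>t. \<bar>flat c a t\<bar> \<le> K * t\<^sup>2"
      using flat_le_square[OF assms] by blast
    have "((\<lambda>h. flat c a h / h) \<longlongrightarrow> 0) (at 0)"
    proof (rule Lim_null_comparison)
      show "eventually (\<lambda>h. norm (flat c a h / h) \<le> K * \<bar>h\<bar>) (at 0)"
        using K by (intro always_eventually) (auto simp: divide_simps power2_eq_square abs_mult mult.assoc)
      show "((\<lambda>h. K * \<bar>h\<bar>) \<longlongrightarrow> 0) (at 0)"
        by (auto intro!: tendsto_eq_intros)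
    qed
    then show ?thesis
      using 3 by (simp add: DERIV_def flat_def)
  qed
qed

lemma C_k_flat:
  assumes "c > 0" shows "C_k m (flat c a)"
proof (induction m arbitrary: a)
  case 0
  show ?case
    using DERIV_isCont[OF flat_has_derivative[OF assms]] by (simp add: continuous_at_imp_continuous_on)
next
  case (Suc m)
  have "(flat c a has_derivative (\<lambda>v. v * (c * flat c (a + 2) t + (- real a) * flat c (a + 1) t))) (at t)" for t
    using flat_has_derivative[OF assms, of a t]
    unfolding has_field_derivative_def by (simp add: mult.commute[of _ "c * _ - _"])
  moreover have "C_k m (\<lambda>t. v * (c * flat c (a + 2) t + (- real a) * flat c (a + 1) t))" for v :: real
    by (intro C_k_mult C_k_add C_k_const Suc.IH)
  ultimately show ?case
    using C_k_Suc_iff[of "flat c a" "\<lambda>t v. v * (c * flat c (a + 2) t + (- real a) * flat c (a + 1) t)"]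
    by blast
qed

text \<open>
  As \<open>c\<close> tends to \<open>0\<close> these bumps increase to the indicator of the open box; no mollifier
  is needed to separate locally integrable functions.
\<close>
definition box_bump :: "'a::euclidean_space \<Rightarrow> 'a \<Rightarrow> real \<Rightarrow> 'a \<Rightarrow> real" where
  "box_bump a b c x = (\<Prod>i\<in>Basis. flat c 0 (- (a \<bullet> i) + x \<bullet> i) * flat c 0 (b \<bullet> i + - (x \<bullet> i)))"

lemma test_function_box_bump:
  assumes "c > 0" shows "test_function (box_bump a b c)"
  unfolding test_function_def
proof
  show "\<forall>m. C_k m (box_bump a b c)"
    unfolding box_bump_def
    by (intro allI C_k_prod C_k_mult C_k_compose_affine C_k_flat assms
        bounded_linear_inner_left bounded_linear_minus)
  have "{x. box_bump a b c x \<noteq> 0} \<subseteq> cbox a b"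
    by (auto simp: box_bump_def flat_def mem_box less_imp_le split: if_splits)
  then show "compact (closure {x. box_bump a b c x \<noteq> 0})"
    using bounded_subset[OF bounded_cbox] compact_closure by blast
qed

lemma box_bump_bounds: "c > 0 \<Longrightarrow> 0 \<le> box_bump a b c x \<and> box_bump a b c x \<le> indicator (box a b) x"
proof -
  assume c: "c > 0"
  have 1: "0 \<le> flat c 0 t" "flat c 0 t \<le> 1" for t using c by (auto simp: flat_def)
  show ?thesis
  proof (cases "x \<in> box a b")
    case True
    then show ?thesis
      unfolding box_bump_def using 1 by (auto intro!: prod_nonneg prod_le_1 mult_le_one)
  next
    case False
    then obtain i where "i \<in> Basis" "\<not> (a \<bullet> i < x \<bullet> i \<and> x \<bullet> i < b \<bullet> i)"
      by (auto simp: mem_box)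
    then have "box_bump a b c x = 0"
      unfolding box_bump_def by (intro prod_zero) (auto simp: flat_def intro!: bexI[of _ i])
    then show ?thesis by simp
  qed
qed

lemma box_bump_tendsto:
  "(\<lambda>m. box_bump a b (1 / real (Suc m)) x) \<longlonglongrightarrow> indicator (box a b) x"
proof (cases "x \<in> box a b")
  case True
  have "(\<lambda>m. flat (1 / real (Suc m)) 0 t) \<longlonglongrightarrow> 1" if "t > 0" for t
  proof -
    have "(\<lambda>m. exp (- (1 / real (Suc m)) * inverse t)) \<longlonglongrightarrow> exp (- 0 * inverse t)"
      using that by (intro tendsto_intros LIMSEQ_Suc[OF lim_1_over_n]) auto
    then show ?thesis using that by (simp add: flat_def)
  qed
  then have "(\<lambda>m. box_bump a b (1 / real (Suc m)) x) \<longlonglongrightarrow> (\<Prod>i\<in>(Basis::'a set). 1 * 1)"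
    unfolding box_bump_def using True by (intro tendsto_prod tendsto_mult) (auto simp: mem_box)
  then show ?thesis using True by simp
next
  case False
  have "box_bump a b (1 / real (Suc m)) x = 0" for m
    using box_bump_bounds[of "1 / real (Suc m)" a b x] False by simp
  then show ?thesis using False by simp
qed

section \<open>The fundamental lemma of the calculus of variations\<close>

text \<open>
  The positive and the negative part are densities of measures that agree on boxes, which
  generate the Borel sets and are stable under intersection.
\<close>
lemma AE_zero_if_box_integrals_zero:
  fixes F :: "'a::euclidean_space \<Rightarrow> real"
  assumes F [measurable]: "F \<in> borel_measurable borel"
    and int: "\<And>a b. integrable lborel (\<lambda>x. F x * indicator (box a b) x)"
    and zero: "\<And>a b. (\<integral>x. F x * indicator (box a b) x \<partial>lborel) = 0"
  shows "AE x in lborel. F x = 0"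
proof -
  let ?E = "range (\<lambda>(a, b). box a b::'a set)"
  let ?A = "\<lambda>n::nat. box (- (real n *\<^sub>R One)) (real n *\<^sub>R One) :: 'a set"
  have emeas: "emeasure (density lborel (\<lambda>x. ennreal (G x))) (box a b)
      = (\<integral>\<^sup>+x. ennreal (G x * indicator (box a b) x) \<partial>lborel)"
    if [measurable]: "G \<in> borel_measurable borel" for G a b
    by (subst emeasure_density) (auto intro!: nn_integral_cong split: split_indicator)
  have fin: "(\<integral>\<^sup>+x. ennreal (F x * indicator (box a b) x) \<partial>lborel) \<noteq> \<infinity>"
    "(\<integral>\<^sup>+x. ennreal (- (F x * indicator (box a b) x)) \<partial>lborel) \<noteq> \<infinity>" for a b
    using int[of a b] by (auto simp: real_integrable_def)
  have eq: "(\<integral>\<^sup>+x. ennreal (F x * indicator (box a b) x) \<partial>lborel)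
      = (\<integral>\<^sup>+x. ennreal (- (F x * indicator (box a b) x)) \<partial>lborel)"
    (is "?p = ?n") for a b
  proof -
    have "enn2real ?p = enn2real ?n"
      using zero[of a b] unfolding real_lebesgue_integral_def[OF int] by simp
    moreover have "?p < top" "?n < top"
      using fin[of a b] by (simp_all add: less_top)
    ultimately show ?thesis
      by (metis ennreal_enn2real)
  qed
  have "density lborel (\<lambda>x. ennreal (F x)) = density lborel (\<lambda>x. ennreal (- F x))"
  proof (rule measure_eqI_generator_eq)
    show "Int_stable ?E"
      by (auto simp: Int_stable_def box_Int_box)
    show "?E \<subseteq> Pow UNIV" "sets (density lborel (\<lambda>x. ennreal (F x))) = sigma_sets UNIV ?E"
      "sets (density lborel (\<lambda>x. ennreal (- F x))) = sigma_sets UNIV ?E"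
      by (simp_all add: borel_eq_box)
    show "range ?A \<subseteq> ?E" "(\<Union>i. ?A i) = UNIV"
      unfolding UN_box_eq_UNIV by auto
    show "emeasure (density lborel (\<lambda>x. ennreal (F x))) (?A i) \<noteq> \<infinity>" for i
      using fin(1) by (simp add: emeas)
    show "emeasure (density lborel (\<lambda>x. ennreal (F x))) X = emeasure (density lborel (\<lambda>x. ennreal (- F x))) X"
      if "X \<in> ?E" for X
      using that eq by (auto simp: emeas)
  qed
  then have "AE x in lborel. ennreal (F x) = ennreal (- F x)"
    by (subst (asm) sigma_finite_measure.density_unique_iff[OF sigma_finite_lborel]) auto
  then show ?thesis
    proof eventually_elim
    case (elim x)
    then show ?case
      by (cases "F x \<ge> 0") (simp_all add: ennreal_neg ennreal_eq_0_iff)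
  qed
qed

lemma AE_zero_if_test_integrals_zero:
  fixes F :: "'a::euclidean_space \<Rightarrow> real"
  assumes F [measurable]: "F \<in> borel_measurable borel"
    and int: "\<And>a b. integrable lborel (\<lambda>x. F x * indicator (box a b) x)"
    and zero: "\<And>\<phi>. test_function \<phi> \<Longrightarrow> (\<integral>x. F x * \<phi> x \<partial>lborel) = 0"
  shows "AE x in lborel. F x = 0"
proof (rule AE_zero_if_box_integrals_zero[OF F int])
  fix a b :: 'a
  define \<phi> where "\<phi> m = box_bump a b (1 / real (Suc m))" for m
  have [measurable]: "\<phi> m \<in> borel_measurable borel" for m
    using test_function_box_bump[of "1 / real (Suc m)" a b]
    by (intro borel_measurable_continuous_onI) (auto simp: \<phi>_def test_function_def dest: spec[of _ 0])
  have "(\<lambda>m. \<integral>x. F x * \<phi> m x \<partial>lborel) \<longlonglongrightarrow> (\<integral>x. F x * indicator (box a b) x \<partial>lborel)"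
  proof (rule integral_dominated_convergence)
    show "integrable lborel (\<lambda>x. norm (F x * indicator (box a b) x))"
      using int by (rule integrable_norm)
    show "AE x in lborel. (\<lambda>m. F x * \<phi> m x) \<longlonglongrightarrow> F x * indicator (box a b) x"
      unfolding \<phi>_def by (intro AE_I2 tendsto_mult tendsto_const box_bump_tendsto)
    show "AE x in lborel. norm (F x * \<phi> m x) \<le> norm (F x * indicator (box a b) x)" for m
    proof (rule AE_I2)
      fix x
      show "norm (F x * \<phi> m x) \<le> norm (F x * indicator (box a b) x)"
        using box_bump_bounds[of "1 / real (Suc m)" a b x]
        by (auto simp: \<phi>_def abs_mult intro!: mult_left_mono)
    qed
  qed simp_all
  moreover have "(\<integral>x. F x * \<phi> m x \<partial>lborel) = 0" for m
    unfolding \<phi>_def by (intro zero test_function_box_bump) simp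
  ultimately show "(\<integral>x. F x * indicator (box a b) x \<partial>lborel) = 0"
    using LIMSEQ_unique[OF _ tendsto_const] by simp
qed

section \<open>Horizontal lines and test functions\<close>

text \<open>
  The velocity of \<open>s \<mapsto> p \<circ> (s v, 0)\<close>, linear in \<open>v\<close>; the fields \<open>horiz e j\<close> are the case of unit vectors.
\<close>
definition hfield :: "'n::finite \<Rightarrow> real ^ ('n + 'n) \<Rightarrow> 'n heis \<Rightarrow> 'n heis" where
  "hfield e v p = (v, omega e (fst p) v)"

lemma hmove_eq_add_hfield: "hmove e v p = p + hfield e v p"
  by (cases p) (simp add: hmove_Pair hfield_def)

lemma hfield_scaleR: "hfield e (s *\<^sub>R v) p = s *\<^sub>R hfield e v p"
  by (simp add: hfield_def omega_simps)

text \<open>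
  A horizontal line has constant velocity, because \<open>omega e v v = 0\<close>.
\<close>
lemma hfield_hmove_scaled: "hfield e v (hline e v s p) = hfield e v p"
  by (cases p) (simp add: hfield_def hmove_Pair omega_simps)

lemma horiz_eq_hfield: "horiz e j p = hfield e (axis j 1) p"
proof -
  have "hmove e (axis j 1) p = p + horiz e j p"
    using heis_mult_axis[of e p 1 j] by (simp add: hmove_def)
  then show ?thesis by (simp add: hmove_eq_add_hfield)
qed

lemma hfield_expand: "hfield e v p = (\<Sum>j\<in>UNIV. v $ j *\<^sub>R horiz e j p)"
proof -
  have "v = (\<Sum>j\<in>UNIV. v $ j *\<^sub>R axis j 1)"
    by (simp add: basis_expansion scalar_mult_eq_scaleR[symmetric])
  moreover have "linear (\<lambda>v. hfield e v p)"
    by (auto intro!: linearI simp: hfield_def omega_simps)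
  ultimately have "hfield e v p = (\<Sum>j\<in>UNIV. hfield e (v $ j *\<^sub>R axis j 1) p)"
    using linear_sum[of "\<lambda>v. hfield e v p" "\<lambda>j. v $ j *\<^sub>R axis j 1" UNIV] by simp
  then show ?thesis
    by (simp add: hfield_scaleR horiz_eq_hfield)
qed

lemma continuous_on_hfield [continuous_intros]:
  "continuous_on S f \<Longrightarrow> continuous_on S (\<lambda>x. hfield e v (f x))"
  unfolding hfield_def by (intro continuous_intros)

lemma norm_hmove_le:
  fixes e :: "'n::finite"
  obtains K where "K \<ge> 0" "\<And>v p. norm (hmove e v p) \<le> norm p + norm v + K * (norm p * norm v)"
proof -
  obtain K where K: "K \<ge> 0" "\<And>x y. norm (omega e x y) \<le> norm x * norm y * K"
    using bounded_bilinear.nonneg_bounded[OF bounded_bilinear_omega] by blast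
  have "norm (hmove e v p) \<le> norm p + norm v + K * (norm p * norm v)" for v p
  proof -
    have "norm (hfield e v p) \<le> norm v + norm (omega e (fst p) v)"
      using norm_triangle_ineq[of "(v, 0)" "(0, omega e (fst p) v)"]
      by (simp add: hfield_def norm_Pair)
    also have "\<dots> \<le> norm v + norm (fst p) * norm v * K"
      using K(2) by simp
    also have "\<dots> \<le> norm v + norm p * norm v * K"
      using K(1) norm_fst_le[of "fst p" "snd p"] by (intro add_left_mono mult_right_mono) auto
    finally show ?thesis
      using norm_triangle_ineq[of p "hfield e v p"] by (simp add: hmove_eq_add_hfield mult_ac)
  qed
  with K(1) show ?thesis by (rule that)
qed

lemma hmove_into_cball:
  fixes e :: "'n::finite"
  obtains R' where "R' \<ge> R" "\<And>p v. norm p \<le> R \<Longrightarrow> norm v \<le> \<rho> \<Longrightarrow> norm (hmove e v p) \<le> R'"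
proof -
  obtain K where K: "K \<ge> 0" "\<And>v p. norm (hmove e v p) \<le> norm p + norm v + K * (norm p * norm v)"
    using norm_hmove_le[of e] by blast
  have "norm (hmove e v p) \<le> \<bar>R\<bar> + \<bar>\<rho>\<bar> + K * (\<bar>R\<bar> * \<bar>\<rho>\<bar>)"
    if "norm p \<le> R" "norm v \<le> \<rho>" for p v
  proof -
    have "K * (norm p * norm v) \<le> K * (\<bar>R\<bar> * \<bar>\<rho>\<bar>)"
      using K(1) that by (intro mult_left_mono mult_mono) auto
    then show ?thesis using K(2)[of v p] that by linarith
  qed
  moreover have "0 \<le> K * (\<bar>R\<bar> * \<bar>\<rho>\<bar>)"
    using K(1) by simp
  then have "R \<le> \<bar>R\<bar> + \<bar>\<rho>\<bar> + K * (\<bar>R\<bar> * \<bar>\<rho>\<bar>)"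
    by linarith
  ultimately show ?thesis
    using that by blast
qed

lemma bounded_if_compact_support:
  fixes \<psi> :: "'a::euclidean_space \<Rightarrow> real"
  assumes "continuous_on UNIV \<psi>" "\<And>p. norm p > R \<Longrightarrow> \<psi> p = 0"
  obtains C where "C \<ge> 0" "\<And>p. \<bar>\<psi> p\<bar> \<le> C * indicator (cball 0 R) p"
proof -
  have "bounded (\<psi> ` cball 0 R)"
    by (intro compact_imp_bounded compact_continuous_image compact_cball
        continuous_on_subset[OF assms(1)]) auto
  then have "\<exists>C. \<forall>p\<in>cball 0 R. \<bar>\<psi> p\<bar> \<le> C"
    unfolding bounded_iff by auto
  then obtain C where "\<And>p. p \<in> cball 0 R \<Longrightarrow> \<bar>\<psi> p\<bar> \<le> C"
    by blast
  then show ?thesis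
    using assms(2) by (intro that[of "max C 0"]) (auto simp: indicator_def not_le le_max_iff_disj)
qed

lemma integrable_mult_cutoff:
  fixes f \<psi> :: "'a::euclidean_space \<Rightarrow> real"
  assumes f: "\<And>r. set_integrable lborel (cball 0 r) f"
    and [measurable]: "f \<in> borel_measurable borel" "\<psi> \<in> borel_measurable borel"
    and \<psi>: "\<And>p. \<bar>\<psi> p\<bar> \<le> C * indicator (cball 0 R) p"
  shows "integrable lborel (\<lambda>p. f p * \<psi> p)"
proof (rule Bochner_Integration.integrable_bound)
  show "integrable lborel (\<lambda>p. C * (indicator (cball 0 R) p *\<^sub>R f p))"
    using f[of R] by (simp add: set_integrable_def)
  show "AE p in lborel. norm (f p * \<psi> p) \<le> norm (C * (indicator (cball 0 R) p *\<^sub>R f p))"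
  proof (rule AE_I2)
    fix p
    have "\<bar>f p\<bar> * \<bar>\<psi> p\<bar> \<le> \<bar>f p\<bar> * \<bar>C * indicator (cball 0 R) p\<bar>"
      using \<psi>[of p] by (intro mult_left_mono) auto
    then show "norm (f p * \<psi> p) \<le> norm (C * (indicator (cball 0 R) p *\<^sub>R f p))"
      by (simp add: abs_mult mult_ac)
  qed
qed measurable

lemma test_function_C_k: "test_function \<phi> \<Longrightarrow> C_k m \<phi>"
  by (simp add: test_function_def)

lemma test_function_continuous: "test_function \<phi> \<Longrightarrow> continuous_on UNIV \<phi>"
  using test_function_C_k[of \<phi> 0] by simp

lemma test_function_has_derivative:
  "test_function \<phi> \<Longrightarrow> (\<phi> has_derivative frechet_derivative \<phi> (at p)) (at p)"
  using test_function_C_k[of \<phi> 1] by (simp add: frechet_derivative_works)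

lemma test_function_continuous_derivative:
  fixes \<phi> :: "'a::euclidean_space \<Rightarrow> real"
  assumes \<phi>: "test_function \<phi>" and u: "continuous_on UNIV u"
  shows "continuous_on UNIV (\<lambda>p. frechet_derivative \<phi> (at p) (u p))"
proof -
  have "continuous_on UNIV (\<lambda>p. frechet_derivative \<phi> (at p) v)" for v
    using test_function_C_k[OF \<phi>, of 1] by simp
  moreover have "frechet_derivative \<phi> (at p) (u p)
      = (\<Sum>b\<in>Basis. (u p \<bullet> b) * frechet_derivative \<phi> (at p) b)" for p
  proof -
    have "frechet_derivative \<phi> (at p) (u p) = frechet_derivative \<phi> (at p) (\<Sum>b\<in>Basis. (u p \<bullet> b) *\<^sub>R b)"
      by (simp add: euclidean_representation)
    also have "\<dots> = (\<Sum>b\<in>Basis. (u p \<bullet> b) *\<^sub>R frechet_derivative \<phi> (at p) b)"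
      using has_derivative_linear[OF test_function_has_derivative[OF \<phi>]]
      by (simp add: linear_sum linear_cmul)
    finally show ?thesis by simp
  qed
  ultimately show ?thesis
    using u by (simp add: continuous_intros)
qed

lemma test_function_supportE:
  fixes \<phi> :: "'a::euclidean_space \<Rightarrow> real"
  assumes \<phi>: "test_function \<phi>"
  obtains R where "\<And>p. norm p > R \<Longrightarrow> \<phi> p = 0"
    "\<And>p u. norm p > R \<Longrightarrow> frechet_derivative \<phi> (at p) u = 0"
proof -
  have "bounded (closure {p. \<phi> p \<noteq> 0})"
    using assms by (simp add: test_function_def compact_imp_bounded)
  then obtain R where R: "\<And>p. p \<in> closure {p. \<phi> p \<noteq> 0} \<Longrightarrow> norm p \<le> R"
    by (auto simp: bounded_iff)
  have z: "\<phi> p = 0" if "norm p > R" for p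
    using R[of p] closure_subset[of "{p. \<phi> p \<noteq> 0}"] that by force
  have "frechet_derivative \<phi> (at p) u = 0" if "norm p > R" for p u
  proof -
    have "open {q::'a. norm q > R}" by (intro open_Collect_less continuous_intros)
    then have "((\<lambda>_. 0) has_derivative frechet_derivative \<phi> (at p)) (at p)"
      using has_derivative_transform_within_open[OF test_function_has_derivative[OF \<phi>], of _ p "\<lambda>_. 0"]
        that z by blast
    then have "frechet_derivative \<phi> (at p) = (\<lambda>_. 0)"
      using has_derivative_unique has_derivative_const by blast
    then show ?thesis by simp
  qed
  with z show ?thesis by (rule that)
qed

text \<open>
  Right translations are affine maps, so they preserve smoothness; their inverses preserve bounded sets.
\<close>
lemma test_function_hmove:
  assumes "test_function \<phi>" shows "test_function (\<lambda>p. \<phi> (hmove e v p))"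
proof -
  have affine: "hmove e v p = (v, 0) + (fst p, snd p + omega e (fst p) v)" for p
    by (cases p) (simp add: hmove_Pair)
  have "linear (\<lambda>p. (fst p, snd p + omega e (fst p) v))"
    by (auto intro!: linearI simp: omega_simps algebra_simps)
  then have "bounded_linear (\<lambda>p. (fst p, snd p + omega e (fst p) v))"
    by (simp add: linear_conv_bounded_linear)
  then have C: "C_k m (\<lambda>p. \<phi> (hmove e v p))" for m
    using assms C_k_compose_affine[of m \<phi> "\<lambda>p. (fst p, snd p + omega e (fst p) v)" "(v, 0)"]
    by (simp only: affine test_function_def)
  obtain R where R: "\<And>p. norm p > R \<Longrightarrow> \<phi> p = 0"
    by (rule test_function_supportE[OF assms]) (rule that)
  obtain R' where R': "\<And>p w. norm p \<le> R \<Longrightarrow> norm w \<le> norm v \<Longrightarrow> norm (hmove e w p) \<le> R'"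
    using hmove_into_cball[of R "norm v" e] by blast
  have "norm p \<le> R'" if "\<phi> (hmove e v p) \<noteq> 0" for p
  proof -
    have "norm (hmove e v p) \<le> R" using R[of "hmove e v p"] that by linarith
    from R'[OF this, of "- v"] show ?thesis
      using hmove_hmove_scaled[of e "-1" v 1 p] by simp
  qed
  then have "bounded {p. \<phi> (hmove e v p) \<noteq> 0}" by (auto simp: bounded_iff)
  with C show ?thesis by (simp add: test_function_def compact_closure)
qed

section \<open>Weak gradients and differences along horizontal lines\<close>

lemma integrable_pair_mult:
  fixes F :: "'a::euclidean_space \<Rightarrow> real" and G :: "'b::euclidean_space \<Rightarrow> real"
  assumes F: "integrable lborel F" and G: "integrable lborel G"
  shows "integrable (lborel \<Otimes>\<^sub>M lborel) (\<lambda>(x, y). F x * G y)"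
proof (rule lborel_pair.Fubini_integrable)
  have [measurable]: "F \<in> borel_measurable borel" "G \<in> borel_measurable borel"
    using borel_measurable_integrable[OF F] borel_measurable_integrable[OF G] by simp_all
  show "(\<lambda>(x, y). F x * G y) \<in> borel_measurable (lborel \<Otimes>\<^sub>M lborel)" by measurable
  have "(\<lambda>x. \<integral>y. norm (case (x, y) of (x, y) \<Rightarrow> F x * G y) \<partial>lborel) = (\<lambda>x. \<bar>F x\<bar> * (\<integral>y. \<bar>G y\<bar> \<partial>lborel))"
    by (simp add: abs_mult)
  then show "integrable lborel (\<lambda>x. \<integral>y. norm (case (x, y) of (x, y) \<Rightarrow> F x * G y) \<partial>lborel)"
    using F by simp
  show "AE x in lborel. integrable lborel (\<lambda>y. case (x, y) of (x, y) \<Rightarrow> F x * G y)"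
    using G by simp
qed

text \<open>
  A weak sub-gradient with Borel representatives. All iterated integrals below live in the
  uncompleted product of Lebesgue--Borel measures, where Tonelli and Fubini apply without further care.
\<close>
locale borel_weak_gradient =
  fixes e :: "'n::finite" and f :: "'n heis \<Rightarrow> real" and g :: "'n heis \<Rightarrow> real ^ ('n + 'n)"
  assumes f_borel [measurable]: "f \<in> borel_measurable borel"
    and g_borel [measurable]: "g \<in> borel_measurable borel"
    and f_int: "\<And>r. set_integrable lborel (cball 0 r) f"
    and g_int: "\<And>r j. set_integrable lborel (cball 0 r) (\<lambda>p. g p $ j)"
    and weak: "\<And>\<phi> j. test_function \<phi> \<Longrightarrow>
      (\<integral>p. f p * frechet_derivative \<phi> (at p) (horiz e j p) \<partial>lborel) = - (\<integral>p. g p $ j * \<phi> p \<partial>lborel)"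
begin

abbreviation jump :: "real ^ ('n + 'n) \<Rightarrow> 'n heis \<Rightarrow> real" where
  "jump v p \<equiv> f (hmove e v p) - f p"

text \<open>The cut-off lets all integrals in \<open>s\<close> run over the whole line.\<close>
abbreviation slope :: "real ^ ('n + 'n) \<Rightarrow> 'n heis \<Rightarrow> real \<Rightarrow> real" where
  "slope v p s \<equiv> indicator {0..1} s * (g (hline e v s p) \<bullet> v)"

lemma borel_measurable_component [measurable]: "(\<lambda>p. g p $ j) \<in> borel_measurable borel"
proof -
  have "(\<lambda>p. g p \<bullet> axis j 1) \<in> borel_measurable borel" by measurable
  then show ?thesis by (simp add: inner_axis)
qed

lemma set_integrable_direction: "set_integrable lborel (cball 0 r) (\<lambda>p. g p \<bullet> v)"
proof -
  have "integrable lborel (\<lambda>p. \<Sum>j\<in>UNIV. v $ j * (indicator (cball 0 r) p *\<^sub>R g p $ j))"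
    using g_int[of r] by (intro Bochner_Integration.integrable_sum integrable_mult_right)
      (simp add: set_integrable_def)
  then show ?thesis
    unfolding set_integrable_def
    by (rule Bochner_Integration.integrable_cong[THEN iffD1, OF refl, rotated])
      (simp add: inner_vec_def sum_distrib_left mult_ac)
qed

text \<open>
  The weak formulation extends from coordinate fields to every constant horizontal direction by linearity.
\<close>
lemma weak_dir:
  assumes \<phi>: "test_function \<phi>"
  shows "(\<integral>p. f p * frechet_derivative \<phi> (at p) (hfield e v p) \<partial>lborel) = - (\<integral>p. (g p \<bullet> v) * \<phi> p \<partial>lborel)"
proof -
  define \<phi>' where "\<phi>' p = frechet_derivative \<phi> (at p)" for p
  obtain R where R: "\<And>p. norm p > R \<Longrightarrow> \<phi> p = 0"
    "\<And>p u. norm p > R \<Longrightarrow> frechet_derivative \<phi> (at p) u = 0"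
    by (rule test_function_supportE[OF \<phi>]) (rule that)
  note t = test_function_continuous[OF \<phi>] R(1) test_function_has_derivative[OF \<phi>, folded \<phi>'_def]
    \<phi>'_def[symmetric] test_function_continuous_derivative[OF \<phi>, folded \<phi>'_def] R(2)[folded \<phi>'_def]
  have [measurable]: "\<phi> \<in> borel_measurable borel"
    by (rule borel_measurable_continuous_onI[OF t(1)])
  have "continuous_on UNIV (horiz e j)" for j
    unfolding horiz_eq_hfield[abs_def] by (intro continuous_intros)
  note ch = t(5)[OF this]
  then have [measurable]: "(\<lambda>p. \<phi>' p (horiz e j p)) \<in> borel_measurable borel" for j
    by (rule borel_measurable_continuous_onI)
  have i1: "integrable lborel (\<lambda>p. f p * \<phi>' p (horiz e j p))" for j
  proof -
    obtain C where "C \<ge> 0" "\<And>p. \<bar>\<phi>' p (horiz e j p)\<bar> \<le> C * indicator (cball 0 R) p"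
      using bounded_if_compact_support[OF ch t(6)] by blast
    then show ?thesis by (intro integrable_mult_cutoff[OF f_int]) auto
  qed
  obtain C where "C \<ge> 0" "\<And>p. \<bar>\<phi> p\<bar> \<le> C * indicator (cball 0 R) p"
    using bounded_if_compact_support[OF t(1,2)] by blast
  then have i2: "integrable lborel (\<lambda>p. g p $ j * \<phi> p)" for j
    by (intro integrable_mult_cutoff[OF g_int]) auto
  have "f p * \<phi>' p (hfield e v p) = (\<Sum>j\<in>UNIV. v $ j * (f p * \<phi>' p (horiz e j p)))" for p
    using has_derivative_linear[OF t(3), of p]
    by (simp add: hfield_expand[of e v] linear_sum linear_cmul sum_distrib_left mult_ac)
  then have "(\<integral>p. f p * \<phi>' p (hfield e v p) \<partial>lborel)
      = (\<integral>p. (\<Sum>j\<in>UNIV. v $ j * (f p * \<phi>' p (horiz e j p))) \<partial>lborel)"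
    by simp
  also have "\<dots> = (\<Sum>j\<in>UNIV. v $ j * (\<integral>p. f p * \<phi>' p (horiz e j p) \<partial>lborel))"
    using i1 by (subst Bochner_Integration.integral_sum) auto
  also have "\<dots> = (\<Sum>j\<in>UNIV. v $ j * - (\<integral>p. g p $ j * \<phi> p \<partial>lborel))"
    using weak[OF \<phi>] by (simp add: t(4))
  also have "\<dots> = - (\<integral>p. (\<Sum>j\<in>UNIV. v $ j * (g p $ j * \<phi> p)) \<partial>lborel)"
    using i2 by (subst Bochner_Integration.integral_sum) (auto simp: sum_negf)
  also have "(\<lambda>p. \<Sum>j\<in>UNIV. v $ j * (g p $ j * \<phi> p)) = (\<lambda>p. (g p \<bullet> v) * \<phi> p)"
    by (simp add: inner_vec_def sum_distrib_left mult_ac)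
  finally show ?thesis by (simp add: t(4))
qed

text \<open>
  Right translation preserves the measure, so the slices in \<open>s\<close> have uniformly bounded integrals over
  a ball; this licenses the exchange of integrals for the gradient.
\<close>
lemma integrable_moved_dir:
  fixes \<psi> :: "'n heis \<Rightarrow> real"
  assumes [measurable]: "\<psi> \<in> borel_measurable borel"
    and \<psi>: "\<And>p. \<bar>\<psi> p\<bar> \<le> C * indicator (cball 0 R) p" and "C \<ge> 0"
  shows "integrable (lborel \<Otimes>\<^sub>M lborel)
    (\<lambda>(p, s). \<psi> p * slope v p s)"
proof (rule integrableI_bounded)
  show m: "(\<lambda>(p, s). \<psi> p * slope v p s)
      \<in> borel_measurable (lborel \<Otimes>\<^sub>M lborel)"
    by measurable
  obtain R' where R': "\<And>p w. norm p \<le> R \<Longrightarrow> norm w \<le> norm v \<Longrightarrow> norm (hmove e w p) \<le> R'"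
    by (rule hmove_into_cball[of R "norm v" e]) (rule that)
  have [measurable]: "cball 0 R' \<in> sets (borel :: 'n heis measure)" by simp
  define I where "I = (\<integral>\<^sup>+p. ennreal (indicator (cball 0 R') p * \<bar>g p \<bullet> v\<bar>) \<partial>lborel)"
  have fin: "I < \<infinity>"
    using set_integrable_direction[of R' v] unfolding set_integrable_def integrable_iff_bounded I_def
    by (simp add: abs_mult)
  have "(\<integral>\<^sup>+z. ennreal (norm (case z of (p, s) \<Rightarrow> \<psi> p * slope v p s))
        \<partial>(lborel \<Otimes>\<^sub>M lborel))
      = (\<integral>\<^sup>+s. \<integral>\<^sup>+p. ennreal (norm (\<psi> p * slope v p s)) \<partial>lborel \<partial>lborel)"
    using m by (subst lborel_pair.nn_integral_snd[symmetric]) auto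
  also have "\<dots> \<le> (\<integral>\<^sup>+s. ennreal C * I * indicator {0..1} (s::real) \<partial>lborel)"
  proof (intro nn_integral_mono)
    fix s :: real
    show "(\<integral>\<^sup>+p. ennreal (norm (\<psi> p * slope v p s)) \<partial>lborel)
        \<le> ennreal C * I * indicator {0..1} s"
    proof (cases "s \<in> {0..1}")
      case True
      have "(\<integral>\<^sup>+p. ennreal (norm (\<psi> p * slope v p s)) \<partial>lborel)
          \<le> (\<integral>\<^sup>+p. ennreal C * ennreal (indicator (cball 0 R') (hline e v s p) * \<bar>g (hline e v s p) \<bullet> v\<bar>) \<partial>lborel)"
      proof (intro nn_integral_mono)
        fix p :: "'n heis"
        have "norm (s *\<^sub>R v) \<le> norm v"
          using True by (simp add: mult_left_le_one_le)
        then have "\<bar>\<psi> p\<bar> \<le> C * indicator (cball 0 R') (hline e v s p)"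
          using \<psi>[of p] R'[of p "s *\<^sub>R v"] \<open>C \<ge> 0\<close> by (cases "norm p \<le> R") auto
        then have "\<bar>\<psi> p\<bar> * \<bar>g (hline e v s p) \<bullet> v\<bar>
            \<le> C * indicator (cball 0 R') (hline e v s p) * \<bar>g (hline e v s p) \<bullet> v\<bar>"
          by (intro mult_right_mono) auto
        then show "ennreal (norm (\<psi> p * slope v p s))
          \<le> ennreal C * ennreal (indicator (cball 0 R') (hline e v s p) * \<bar>g (hline e v s p) \<bullet> v\<bar>)"
          using True \<open>C \<ge> 0\<close> by (simp add: abs_mult mult_ac flip: ennreal_mult)
      qed
      also have "\<dots> = ennreal C * (\<integral>\<^sup>+p. ennreal (indicator (cball 0 R') (hline e v s p) * \<bar>g (hline e v s p) \<bullet> v\<bar>) \<partial>lborel)"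
      proof (rule nn_integral_cmult)
        have "(\<lambda>p. ennreal (indicator (cball 0 R') p * \<bar>g p \<bullet> v\<bar>)) \<in> borel_measurable borel"
          by simp
        moreover have "hmove e (s *\<^sub>R v) \<in> borel_measurable lborel"
          by simp
        ultimately show "(\<lambda>p. ennreal (indicator (cball 0 R') (hline e v s p) * \<bar>g (hline e v s p) \<bullet> v\<bar>))
            \<in> borel_measurable lborel"
          by (rule measurable_compose[rotated])
      qed
      also have "\<dots> = ennreal C * I"
        unfolding hmove_def I_def
        using nn_integral_right_translate[of "\<lambda>p. ennreal (indicator (cball 0 R') p * \<bar>g p \<bullet> v\<bar>)"] by simp
      finally show ?thesis using True by simp
    qed simp
  qed
  also have "\<dots> = ennreal C * I"
    by (subst nn_integral_cmult_indicator) auto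
  also have "\<dots> < \<infinity>"
    using fin by (simp add: ennreal_mult_less_top)
  finally show "(\<integral>\<^sup>+z. ennreal (norm (case z of (p, s) \<Rightarrow> \<psi> p * slope v p s))
        \<partial>(lborel \<Otimes>\<^sub>M lborel)) < \<infinity>" .
qed

lemma integrable_moved_cutoff:
  fixes \<psi> :: "'n heis \<Rightarrow> real"
  assumes [measurable]: "\<psi> \<in> borel_measurable borel"
    and \<psi>: "\<And>p. \<bar>\<psi> p\<bar> \<le> C * indicator (cball 0 R) p" and "C \<ge> 0"
  shows "integrable lborel (\<lambda>p. f (hmove e v p) * \<psi> p)"
proof -
  obtain R' where R': "\<And>p w. norm p \<le> R \<Longrightarrow> norm w \<le> norm v \<Longrightarrow> norm (hmove e w p) \<le> R'"
    by (rule hmove_into_cball[of R "norm v" e]) (rule that)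
  have "\<bar>\<psi> (hmove e (- v) p)\<bar> \<le> C * indicator (cball 0 R') p" for p
    using \<psi>[of "hmove e (- v) p"] R'[of "hmove e (- v) p" v] hmove_hmove_scaled[of e 1 v "-1" p] \<open>C \<ge> 0\<close>
    by (cases "norm (hmove e (- v) p) \<le> R") auto
  then have "integrable lborel (\<lambda>p. f p * \<psi> (hmove e (- v) p))"
    by (intro integrable_mult_cutoff[OF f_int]) auto
  then have "integrable (distr lborel borel (hmove e v)) (\<lambda>p. f p * \<psi> (hmove e (- v) p))"
    by (simp add: distr_hmove)
  then have "integrable lborel (\<lambda>p. f (hmove e v p) * \<psi> (hmove e (- v) (hmove e v p)))"
    by (rule integrable_distr[rotated]) simp
  then show ?thesis
    using hmove_hmove_scaled[of e "-1" v 1] by simp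
qed

lemma integral_hmove:
  fixes F :: "'n heis \<Rightarrow> real"
  assumes [measurable]: "F \<in> borel_measurable borel"
  shows "(\<integral>p. F (hmove e v p) \<partial>lborel) = (\<integral>p. F p \<partial>lborel)"
  using integral_distr[of "hmove e v" lborel borel F] by (simp add: distr_hmove)

text \<open>
  Both sides are tested against \<open>\<phi>\<close>. Moving the translation onto \<open>\<phi>\<close> gives the difference
  \<open>\<phi> (p \<circ> (- v, 0)) - \<phi> p\<close>, an integral over \<open>s\<close> of a horizontal derivative of \<open>\<phi>\<close> at \<open>p \<circ> (- s v, 0)\<close>.
  The field in direction \<open>v\<close> commutes with its own flow, so this is the derivative of the translated
  test function, to which the weak formulation applies for each \<open>s\<close>.
\<close>
lemma AE_difference_formula:
  "AE p in lborel. f (hmove e v p) - f p = (\<integral>s. slope v p s \<partial>lborel)"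
proof -
  let ?G = "\<lambda>p. \<integral>s. slope v p s \<partial>lborel"
  have [measurable]: "?G \<in> borel_measurable borel"
    by measurable
  let ?F = "\<lambda>p. f (hmove e v p) - f p - ?G p"
  have "AE p in lborel. ?F p = 0"
  proof (rule AE_zero_if_test_integrals_zero)
    show "?F \<in> borel_measurable borel" by measurable
  next
    fix a b :: "'n heis"
    obtain R where R: "\<And>p. p \<in> box a b \<Longrightarrow> norm p \<le> R"
      using bounded_box[of a b] unfolding bounded_iff by blast
    then have ind: "\<bar>indicator (box a b) p\<bar> \<le> 1 * (indicator (cball 0 R) p :: real)" for p
      by (auto simp: indicator_def)
    have "integrable lborel (\<lambda>p. \<integral>s. indicator (box a b) p * slope v p s \<partial>lborel)"
      using lborel_pair.integrable_fst[OF integrable_moved_dir[OF _ ind, of v]] by simp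
    then have "integrable lborel (\<lambda>p. f (hmove e v p) * indicator (box a b) p - f p * indicator (box a b) p
        - ?G p * indicator (box a b) p)"
      using integrable_moved_cutoff[OF _ ind, of v] integrable_mult_cutoff[OF f_int _ _ ind]
      by (intro Bochner_Integration.integrable_diff) (simp_all add: mult.commute)
    then show "integrable lborel (\<lambda>p. ?F p * indicator (box a b) p)"
      by (simp add: left_diff_distrib)
  next
    fix \<phi> :: "'n heis \<Rightarrow> real" assume \<phi>: "test_function \<phi>"
    define \<phi>' where "\<phi>' p = frechet_derivative \<phi> (at p)" for p
    obtain R where R: "\<And>p. norm p > R \<Longrightarrow> \<phi> p = 0"
      "\<And>p u. norm p > R \<Longrightarrow> frechet_derivative \<phi> (at p) u = 0"
      by (rule test_function_supportE[OF \<phi>]) (rule that)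
    note t = test_function_continuous[OF \<phi>] R(1) test_function_has_derivative[OF \<phi>, folded \<phi>'_def]
      \<phi>'_def[symmetric] test_function_continuous_derivative[OF \<phi>, folded \<phi>'_def] R(2)[folded \<phi>'_def]
    have [measurable]: "\<phi> \<in> borel_measurable borel"
      by (rule borel_measurable_continuous_onI[OF t(1)])
    obtain C where C: "C \<ge> 0" "\<And>p. \<bar>\<phi> p\<bar> \<le> C * indicator (cball 0 R) p"
      using bounded_if_compact_support[OF t(1,2)] by blast
    define \<Phi> where "\<Phi> p = \<phi>' p (hfield e v p)" for p
    have c\<Phi>: "continuous_on UNIV \<Phi>"
      unfolding \<Phi>_def by (intro t(5) continuous_intros)
    then have [measurable]: "\<Phi> \<in> borel_measurable borel"
      by (rule borel_measurable_continuous_onI)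
    obtain D where D: "D \<ge> 0" "\<And>p. \<bar>\<Phi> p\<bar> \<le> D * indicator (cball 0 R) p"
      using bounded_if_compact_support[OF c\<Phi>, of R] t(6) unfolding \<Phi>_def by blast
    have line: "((\<lambda>s. \<phi> (hline e v s p)) has_vector_derivative \<Phi> (hline e v s p)) (at s within S)"
      for p s S
    proof -
      have "((\<lambda>s. hline e v s p) has_derivative (\<lambda>h. h *\<^sub>R hfield e v p)) (at s within S)"
        unfolding hmove_eq_add_hfield hfield_scaleR
        by (auto intro!: derivative_eq_intros)
      then have "((\<lambda>s. \<phi> (hline e v s p)) has_derivative
          (\<lambda>h. \<phi>' (hline e v s p) (h *\<^sub>R hfield e v p))) (at s within S)"
        by (rule has_derivative_compose[OF _ t(3)])
      then show ?thesis
        using has_derivative_linear[OF t(3), of "hline e v s p"]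
        by (simp add: has_vector_derivative_def \<Phi>_def hfield_hmove_scaled linear_cmul)
    qed
    have ftc: "(\<integral>s. indicator {0..1} s * \<Phi> (hmove e (- s *\<^sub>R v) p) \<partial>lborel) = \<phi> p - \<phi> (hmove e (- v) p)" for p
    proof -
      have "((\<lambda>s. - \<phi> (hmove e (s *\<^sub>R (- v)) p)) has_vector_derivative \<Phi> (hmove e (- s *\<^sub>R v) p)) (at s within {0..1})" for s
      proof -
        have "((\<lambda>s. \<phi> (hmove e ((- s) *\<^sub>R v) p)) has_vector_derivative
            (- 1) *\<^sub>R \<Phi> (hmove e ((- s) *\<^sub>R v) p)) (at s within {0..1})"
          by (rule vector_diff_chain_within[OF _ line, of "\<lambda>s. - s" "- 1" s "{0..1}" p, unfolded o_def])
            (auto intro!: derivative_eq_intros)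
        from has_vector_derivative_minus[OF this] show ?thesis by simp
      qed
      then have "(\<integral>s. indicator {0..1} s *\<^sub>R \<Phi> (hmove e (- s *\<^sub>R v) p) \<partial>lborel)
          = - \<phi> (hmove e (1 *\<^sub>R (- v)) p) - - \<phi> (hmove e (0 *\<^sub>R (- v)) p)"
        by (intro integral_FTC_Icc) (auto intro!: continuous_on_compose2[OF c\<Phi>] continuous_intros)
      then show ?thesis by simp
    qed
    obtain R' where R': "\<And>p w. norm p \<le> R \<Longrightarrow> norm w \<le> norm v \<Longrightarrow> norm (hmove e w p) \<le> R'"
      by (rule hmove_into_cball[of R "norm v" e]) (rule that)
    have [measurable]: "cball 0 R' \<in> sets (borel :: 'n heis measure)" by simp
    have i1: "integrable (lborel \<Otimes>\<^sub>M lborel) (\<lambda>(p, s). f p * (indicator {0..1} s * \<Phi> (hmove e (- s *\<^sub>R v) p)))"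
    proof (rule Bochner_Integration.integrable_bound)
      have "integrable lborel (\<lambda>p. f p * (D * indicator (cball 0 R') p))"
        by (rule integrable_mult_cutoff[OF f_int, where C = D]) (auto simp: D)
      moreover have "integrable lborel (\<lambda>s. indicator {0..1::real} s :: real)" by simp
      ultimately show "integrable (lborel \<Otimes>\<^sub>M lborel) (\<lambda>(p, s). (f p * (D * indicator (cball 0 R') p)) * indicator {0..1} (s::real))"
        by (rule integrable_pair_mult)
      have "\<bar>indicator {0..1} s * \<Phi> (hmove e (- s *\<^sub>R v) p)\<bar> \<le> \<bar>(D * indicator (cball 0 R') p) * indicator {0..1} s\<bar>" for p s
      proof (cases "s \<in> {0..1}")
        case True
        then have "norm (s *\<^sub>R v) \<le> norm v" by (simp add: mult_left_le_one_le)
        then show ?thesis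
          using True D(1) D(2)[of "hmove e (- s *\<^sub>R v) p"] R'[of "hmove e (- s *\<^sub>R v) p" "s *\<^sub>R v"] hmove_hmove_scaled[of e s v "-s" p]
          by (cases "norm (hmove e (- s *\<^sub>R v) p) \<le> R") auto
      qed simp
      then show "AE z in lborel \<Otimes>\<^sub>M lborel. norm (case z of (p, s) \<Rightarrow> f p * (indicator {0..1} s * \<Phi> (hmove e (- s *\<^sub>R v) p)))
          \<le> norm (case z of (p, s) \<Rightarrow> (f p * (D * indicator (cball 0 R') p)) * indicator {0..1} (s::real))"
        by (intro AE_I2) (auto simp: abs_mult mult.assoc intro!: mult_left_mono)
    qed measurable
    have i2: "integrable (lborel \<Otimes>\<^sub>M lborel) (\<lambda>(p, s). \<phi> p * slope v p s)"
      by (rule integrable_moved_dir[OF _ C(2,1)]) simp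
    have slice: "(\<integral>p. f p * (indicator {0..1} s * \<Phi> (hmove e (- s *\<^sub>R v) p)) \<partial>lborel)
        = - (\<integral>p. \<phi> p * slope v p s \<partial>lborel)" for s :: real
    proof -
      let ?\<phi>s = "\<lambda>p. \<phi> (hmove e (- s *\<^sub>R v) p)"
      have "frechet_derivative ?\<phi>s (at p) (hfield e v p) = \<Phi> (hmove e (- s *\<^sub>R v) p)" for p
      proof -
        define \<psi>' where "\<psi>' p = frechet_derivative ?\<phi>s (at p)" for p
        then have \<psi>': "(?\<phi>s has_derivative \<psi>' p) (at p)" "frechet_derivative ?\<phi>s (at p) = \<psi>' p"
          using test_function_has_derivative[OF test_function_hmove[OF \<phi>, of e "- s *\<^sub>R v"]] by simp_all
        have l: "((\<lambda>r. hmove e (r *\<^sub>R v) p) has_derivative (\<lambda>h. h *\<^sub>R hfield e v p)) (at 0)"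
          unfolding hmove_eq_add_hfield hfield_scaleR
          by (auto intro!: derivative_eq_intros)
        have "((\<lambda>r. ?\<phi>s (hmove e (r *\<^sub>R v) p)) has_derivative (\<lambda>h. \<psi>' p (h *\<^sub>R hfield e v p))) (at 0)"
          using has_derivative_compose[OF l, of ?\<phi>s "\<psi>' p"] \<psi>'(1) by simp
        then have "((\<lambda>r. \<phi> (hmove e ((r - s) *\<^sub>R v) p)) has_vector_derivative \<psi>' p (hfield e v p)) (at 0)"
          using hmove_hmove_scaled[of e "- s" v _ p] has_derivative_linear[OF \<psi>'(1)]
          by (simp add: has_vector_derivative_def linear_cmul)
        moreover have "((\<lambda>r. \<phi> (hmove e ((r - s) *\<^sub>R v) p)) has_vector_derivative
            1 *\<^sub>R \<Phi> (hmove e ((0 - s) *\<^sub>R v) p)) (at 0)"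
          by (rule vector_diff_chain_within[OF _ line, of "\<lambda>r. r - s" 1 0 UNIV p, unfolded o_def])
            (auto intro!: derivative_eq_intros)
        ultimately have "\<psi>' p (hfield e v p) = 1 *\<^sub>R \<Phi> (hmove e ((0 - s) *\<^sub>R v) p)"
          by (rule vector_derivative_unique_at)
        then show ?thesis
          unfolding \<psi>'_def by simp
      qed
      then have "(\<integral>p. f p * \<Phi> (hmove e (- s *\<^sub>R v) p) \<partial>lborel)
          = - (\<integral>p. (g p \<bullet> v) * ?\<phi>s p \<partial>lborel)"
        using weak_dir[OF test_function_hmove[OF \<phi>, of e "- s *\<^sub>R v"], of v] by simp
      also have "(\<integral>p. (g p \<bullet> v) * ?\<phi>s p \<partial>lborel)
          = (\<integral>p. (g (hline e v s p) \<bullet> v) * ?\<phi>s (hline e v s p) \<partial>lborel)"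
        by (rule integral_hmove[symmetric]) simp
      also have "\<dots> = (\<integral>p. \<phi> p * (g (hline e v s p) \<bullet> v) \<partial>lborel)"
        using hmove_hmove_scaled[of e "- s" v s] by (simp add: mult.commute)
      finally show ?thesis
        by (cases "s \<in> {0..1}") simp_all
    qed
    have "(\<integral>p. f (hmove e v p) * \<phi> p - f p * \<phi> p \<partial>lborel) = (\<integral>p. ?G p * \<phi> p \<partial>lborel)"
    proof -
      have "(\<integral>p. f (hmove e v p) * \<phi> p \<partial>lborel)
          = (\<integral>p. f (hmove e v p) * \<phi> (hmove e (- v) (hmove e v p)) \<partial>lborel)"
        using hmove_hmove_scaled[of e "- 1" v 1] by simp
      also have "\<dots> = (\<integral>p. f p * \<phi> (hmove e (- v) p) \<partial>lborel)"
        by (rule integral_hmove) simp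
      finally have "(\<integral>p. f (hmove e v p) * \<phi> p - f p * \<phi> p \<partial>lborel)
          = (\<integral>p. f p * \<phi> (hmove e (- v) p) \<partial>lborel) - (\<integral>p. f p * \<phi> p \<partial>lborel)"
        using integrable_moved_cutoff[OF _ C(2,1)] integrable_mult_cutoff[OF f_int _ _ C(2)]
        by (subst Bochner_Integration.integral_diff) auto
      also have "\<dots> = (\<integral>p. f p * \<phi> (hmove e (- v) p) - f p * \<phi> p \<partial>lborel)"
      proof (rule Bochner_Integration.integral_diff[symmetric])
        have "\<bar>\<phi> (hmove e (- v) p)\<bar> \<le> C * indicator (cball 0 R') p" for p
          using C(2)[of "hmove e (- v) p"] R'[of "hmove e (- v) p" v] hmove_hmove_scaled[of e 1 v "-1" p] C(1)
          by (cases "norm (hmove e (- v) p) \<le> R") auto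
        then show "integrable lborel (\<lambda>p. f p * \<phi> (hmove e (- v) p))"
          by (intro integrable_mult_cutoff[OF f_int]) auto
      qed (intro integrable_mult_cutoff[OF f_int _ _ C(2)]; simp)
      also have "\<dots> = - (\<integral>p. (\<integral>s. f p * (indicator {0..1} s * \<Phi> (hmove e (- s *\<^sub>R v) p)) \<partial>lborel) \<partial>lborel)"
      proof -
        have "(\<integral>s. f p * (indicator {0..1} s * \<Phi> (hmove e (- s *\<^sub>R v) p)) \<partial>lborel)
            = - (f p * \<phi> (hmove e (- v) p) - f p * \<phi> p)" for p
          by (simp only: integral_mult_right_zero ftc) (simp add: right_diff_distrib)
        then show ?thesis by (simp only: Bochner_Integration.integral_minus minus_minus)
      qed
      also have "\<dots> = - (\<integral>s. (\<integral>p. f p * (indicator {0..1} s * \<Phi> (hmove e (- s *\<^sub>R v) p)) \<partial>lborel) \<partial>lborel)"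
        using lborel_pair.Fubini_integral[OF i1] by simp
      also have "\<dots> = (\<integral>s. (\<integral>p. \<phi> p * slope v p s \<partial>lborel) \<partial>lborel)"
        by (simp only: slice Bochner_Integration.integral_minus minus_minus)
      also have "\<dots> = (\<integral>p. (\<integral>s. \<phi> p * slope v p s \<partial>lborel) \<partial>lborel)"
        using lborel_pair.Fubini_integral[OF i2] by simp
      finally show ?thesis by (simp add: mult.commute)
    qed
    moreover have "integrable lborel (\<lambda>p. ?G p * \<phi> p)"
      using lborel_pair.integrable_fst[OF i2] by (simp add: mult.commute)
    ultimately show "(\<integral>p. ?F p * \<phi> p \<partial>lborel) = 0"
      using integrable_moved_cutoff[OF _ C(2,1), of v] integrable_mult_cutoff[OF f_int _ _ C(2)]
      by (simp add: left_diff_distrib)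
  qed
  then show ?thesis by eventually_elim simp
qed

end

section \<open>Differences in weighted Lebesgue norms and the tail estimate\<close>

abbreviation energy :: "real \<Rightarrow> ('a::euclidean_space \<Rightarrow> real) \<Rightarrow> ('a \<Rightarrow> 'b::real_normed_vector) \<Rightarrow> ennreal" where
  "energy q w g \<equiv> \<integral>\<^sup>+p. ennreal (w p) * ennreal (norm (g p) powr q) \<partial>lborel"

abbreviation oscillation :: "real \<Rightarrow> 'a::euclidean_space set \<Rightarrow> ('a \<Rightarrow> real) \<Rightarrow> ennreal" where
  "oscillation q K f \<equiv> \<integral>\<^sup>+p. indicator K p *
    (\<integral>\<^sup>+p'. indicator K p' * ennreal (\<bar>f p' - f p\<bar> powr q) \<partial>lborel) \<partial>lborel"

abbreviation escapes :: "'n::finite \<Rightarrow> (real ^ ('n + 'n)) set \<Rightarrow> real \<Rightarrow> ('n heis \<Rightarrow> real) \<Rightarrow> 'n heis \<Rightarrow> bool" where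
  "escapes e V \<delta> w p \<equiv> \<exists>v\<in>V. (\<forall>s\<in>{0..1}. w p \<le> w (hline e v s p)) \<and> w p \<le> \<delta> * w (hmove e v p)"

abbreviation deviation :: "real \<Rightarrow> ('a::euclidean_space \<Rightarrow> real) \<Rightarrow> ('a \<Rightarrow> real) \<Rightarrow> real \<Rightarrow> ennreal" where
  "deviation q w f c \<equiv> \<integral>\<^sup>+p. ennreal (w p) * ennreal (\<bar>f p - c\<bar> powr q) \<partial>lborel"

lemma powr_add_le:
  fixes a b q :: real
  assumes "q \<ge> 0"
  shows "\<bar>a + b\<bar> powr q \<le> 2 powr q * (\<bar>a\<bar> powr q + \<bar>b\<bar> powr q)"
proof -
  have "\<bar>a + b\<bar> powr q \<le> (2 * max \<bar>a\<bar> \<bar>b\<bar>) powr q"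
    using assms by (intro powr_mono2) auto
  also have "\<dots> = 2 powr q * max \<bar>a\<bar> \<bar>b\<bar> powr q"
    by (simp add: powr_mult)
  also have "\<dots> \<le> 2 powr q * (\<bar>a\<bar> powr q + \<bar>b\<bar> powr q)"
    by (intro mult_left_mono) (auto simp: max_def)
  finally show ?thesis .
qed

text \<open>
  Young's inequality, read as the tangent line of \<open>x powr q\<close> at \<open>m\<close>; integrating it gives Jensen's inequality.
\<close>
lemma powr_tangent_le:
  fixes x m q :: real
  assumes "q > 1" "x \<ge> 0" "m \<ge> 0"
  shows "q * m powr (q - 1) * x - (q - 1) * m powr q \<le> x powr q"
proof -
  have "x * m powr (q - 1) \<le> x powr q / q + (m powr (q - 1)) powr (q / (q - 1)) / (q / (q - 1))"
    using assms by (intro Youngs_inequality) (auto simp: field_simps)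
  also have "(m powr (q - 1)) powr (q / (q - 1)) = m powr q"
    using assms by (simp add: powr_powr)
  finally have "q * (x * m powr (q - 1)) \<le> q * (x powr q / q + m powr q / (q / (q - 1)))"
    using assms by (intro mult_left_mono) auto
  also have "\<dots> = x powr q + (q - 1) * m powr q"
    using assms by (simp add: field_simps)
  finally show ?thesis
    by (simp add: mult_ac)
qed

lemma jensen_powr:
  fixes h :: "'a \<Rightarrow> real"
  assumes q: "q > 1" and mass: "emeasure M (space M) = 1"
    and [measurable]: "h \<in> borel_measurable M"
  shows "ennreal (\<bar>\<integral>x. h x \<partial>M\<bar> powr q) \<le> (\<integral>\<^sup>+x. ennreal (\<bar>h x\<bar> powr q) \<partial>M)"
proof (cases "integrable M h \<and> (\<integral>\<^sup>+x. ennreal (\<bar>h x\<bar> powr q) \<partial>M) < \<infinity>")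
  case True
  interpret finite_measure M
    using mass by (intro finite_measureI) simp
  have int: "integrable M (\<lambda>x. \<bar>h x\<bar> powr q)" "integrable M (\<lambda>x. \<bar>h x\<bar>)"
    using True by (auto simp: integrable_iff_bounded)
  define m where "m = (\<integral>x. \<bar>h x\<bar> \<partial>M)"
  have m: "m \<ge> 0" "measure M (space M) = 1"
    by (simp_all add: m_def measure_def mass)
  have "m powr q = q * m powr (q - 1) * m - (q - 1) * m powr q"
    using m q by (cases "m = 0") (simp_all add: powr_diff field_simps)
  also have "\<dots> = (\<integral>x. q * m powr (q - 1) * \<bar>h x\<bar> - (q - 1) * m powr q \<partial>M)"
    using int m(2) by (simp add: m_def)
  also have "\<dots> \<le> (\<integral>x. \<bar>h x\<bar> powr q \<partial>M)"
    using int q m(1) by (intro integral_mono powr_tangent_le) auto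
  finally have "m powr q \<le> (\<integral>x. \<bar>h x\<bar> powr q \<partial>M)" .
  moreover have "\<bar>\<integral>x. h x \<partial>M\<bar> powr q \<le> m powr q"
    using q unfolding m_def by (intro powr_mono2 integral_abs_bound) auto
  ultimately show ?thesis
    by (subst nn_integral_eq_integral[OF int(1)]) (auto intro!: ennreal_leI)
next
  case False
  then show ?thesis
    using q by (cases "integrable M h") (auto simp: not_integrable_integral_eq not_less top_unique)
qed

lemma ennreal_absorb_half:
  fixes X Y :: ennreal
  assumes "X \<le> ennreal a * X + Y" "X < \<infinity>" "a \<le> 1 / 2"
  shows "X \<le> 2 * Y"
proof (cases "Y = \<infinity>")
  case False
  then obtain x y where xy: "x \<ge> 0" "X = ennreal x" "y \<ge> 0" "Y = ennreal y"
    using assms(2) by (cases X; cases Y) auto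
  have "X \<le> ennreal (1 / 2) * X + Y"
    using assms(1) by (rule order_trans) (intro add_right_mono mult_right_mono ennreal_leI assms(3), simp)
  moreover have "ennreal c * ennreal x + ennreal y = ennreal (c * x + y)" if "c \<ge> 0" for c
    using that xy by (simp add: ennreal_mult ennreal_plus)
  from this[of "1 / 2"] have "ennreal (1 / 2) * ennreal x + ennreal y = ennreal (1 / 2 * x + y)" by simp
  ultimately have "ennreal x \<le> ennreal (1 / 2 * x + y)"
    unfolding xy by (simp only:)
  then have "x \<le> 2 * y"
    using xy by (subst (asm) ennreal_le_iff) auto
  then have "ennreal x \<le> ennreal (2 * y)" by (rule ennreal_leI)
  then show ?thesis using xy by (simp add: ennreal_mult')
qed (simp add: ennreal_mult_top)

context borel_weak_gradient
begin

lemma AE_difference_powr: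
  assumes q: "q > 1"
  shows "AE p in lborel. ennreal (\<bar>jump v p\<bar> powr q)
    \<le> ennreal (norm v powr q) *
      (\<integral>\<^sup>+s. indicator {0..1} s * ennreal (norm (g (hline e v s p)) powr q) \<partial>lborel)"
  using AE_difference_formula[of v]
proof eventually_elim
  case (elim p)
  define P :: "real measure" where "P = density lborel (indicator {0..1})"
  have P: "emeasure P (space P) = 1" "sets P = sets borel"
    by (simp_all add: P_def emeasure_density)
  have [measurable]: "(\<lambda>s. g (hline e v s p) \<bullet> v) \<in> borel_measurable P"
    unfolding measurable_cong_sets[OF P(2) refl] by measurable
  have "(\<integral>s. slope v p s \<partial>lborel)
      = (\<integral>s. g (hline e v s p) \<bullet> v \<partial>P)"
    unfolding P_def ennreal_indicator[symmetric]
    by (subst integral_density) auto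
  then have "ennreal (\<bar>jump v p\<bar> powr q)
      \<le> (\<integral>\<^sup>+s. ennreal (\<bar>g (hline e v s p) \<bullet> v\<bar> powr q) \<partial>P)"
    using jensen_powr[OF q P(1), of "\<lambda>s. g (hline e v s p) \<bullet> v"] by (simp add: elim)
  also have "\<dots> = (\<integral>\<^sup>+s. indicator {0..1} s * ennreal (\<bar>g (hline e v s p) \<bullet> v\<bar> powr q) \<partial>lborel)"
    unfolding P_def by (subst nn_integral_density) auto
  also have "\<dots> \<le> (\<integral>\<^sup>+s. ennreal (norm v powr q) *
      (indicator {0..1} s * ennreal (norm (g (hline e v s p)) powr q)) \<partial>lborel)"
  proof (intro nn_integral_mono)
    fix s :: real
    have "\<bar>g (hline e v s p) \<bullet> v\<bar> powr q \<le> (norm v * norm (g (hline e v s p))) powr q"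
      using q Cauchy_Schwarz_ineq2[of "g (hline e v s p)" v]
      by (intro powr_mono2) (auto simp: mult.commute)
    then show "indicator {0..1} s * ennreal (\<bar>g (hline e v s p) \<bullet> v\<bar> powr q)
        \<le> ennreal (norm v powr q) * (indicator {0..1} s * ennreal (norm (g (hline e v s p)) powr q))"
      by (auto simp: indicator_def powr_mult simp flip: ennreal_mult intro!: ennreal_leI)
  qed
  also have "\<dots> = ennreal (norm v powr q) *
      (\<integral>\<^sup>+s. indicator {0..1} s * ennreal (norm (g (hline e v s p)) powr q) \<partial>lborel)"
    by (intro nn_integral_cmult) simp
  finally show ?case .
qed

text \<open>
  The weight \<open>b\<close> is evaluated at the moving point, so after Tonelli each slice in \<open>s\<close> is the full
  integral of \<open>b |g|\<^sup>q\<close> by right invariance.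
\<close>
lemma nn_integral_difference_le:
  assumes q: "q > 1"
    and [measurable]: "a \<in> borel_measurable borel" "b \<in> borel_measurable borel"
    and le: "\<And>p s. 0 \<le> s \<Longrightarrow> s \<le> 1 \<Longrightarrow> a p \<le> b (hline e v s p)"
  shows "(\<integral>\<^sup>+p. a p * ennreal (\<bar>jump v p\<bar> powr q) \<partial>lborel)
    \<le> ennreal (norm v powr q) * (\<integral>\<^sup>+p. b p * ennreal (norm (g p) powr q) \<partial>lborel)"
proof -
  define H where "H p = b p * ennreal (norm (g p) powr q)" for p
  have [measurable]: "H \<in> borel_measurable borel"
    unfolding H_def by measurable
  have "(\<integral>\<^sup>+p. a p * ennreal (\<bar>jump v p\<bar> powr q) \<partial>lborel)
      \<le> (\<integral>\<^sup>+p. a p * (ennreal (norm v powr q) *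
      (\<integral>\<^sup>+s. indicator {0..1} s * ennreal (norm (g (hline e v s p)) powr q) \<partial>lborel)) \<partial>lborel)"
    using AE_difference_powr[OF q, of v]
    by (intro nn_integral_mono_AE) (auto elim!: eventually_mono intro!: mult_left_mono)
  also have "\<dots> = (\<integral>\<^sup>+p. ennreal (norm v powr q) *
      (\<integral>\<^sup>+s. a p * (indicator {0..1} s * ennreal (norm (g (hline e v s p)) powr q)) \<partial>lborel) \<partial>lborel)"
    by (intro nn_integral_cong) (simp add: nn_integral_cmult mult_ac)
  also have "\<dots> \<le> (\<integral>\<^sup>+p. ennreal (norm v powr q) *
      (\<integral>\<^sup>+s. indicator {0..1} s * H (hline e v s p) \<partial>lborel) \<partial>lborel)"
    unfolding H_def
    by (intro nn_integral_mono mult_left_mono)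
      (auto simp: indicator_def intro!: mult_right_mono le)
  also have "\<dots> = ennreal (norm v powr q) *
      (\<integral>\<^sup>+p. \<integral>\<^sup>+s. indicator {0..1} s * H (hline e v s p) \<partial>lborel \<partial>lborel)"
    by (intro nn_integral_cmult) measurable
  also have "(\<integral>\<^sup>+p. \<integral>\<^sup>+s. indicator {0..1} s * H (hline e v s p) \<partial>lborel \<partial>lborel)
      = (\<integral>\<^sup>+s. \<integral>\<^sup>+p. indicator {0..1} s * H (hline e v s p) \<partial>lborel \<partial>lborel)"
    by (rule lborel_pair.Fubini'[symmetric]) measurable
  also have "\<dots> = (\<integral>\<^sup>+s. indicator {0..1} s * (\<integral>\<^sup>+p. H (hline e v s p) \<partial>lborel) \<partial>lborel)"
    by (intro nn_integral_cong nn_integral_cmult) measurable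
  also have "\<dots> = (\<integral>\<^sup>+s. (\<integral>\<^sup>+p. H p \<partial>lborel) * indicator {0..1} (s::real) \<partial>lborel)"
    unfolding hmove_def by (simp add: nn_integral_right_translate mult.commute)
  also have "\<dots> = (\<integral>\<^sup>+p. H p \<partial>lborel)"
    by (subst nn_integral_cmult_indicator) auto
  finally show ?thesis by (simp add: H_def)
qed


text \<open>
  The heart of the analytic part. On the set where the move by \<open>v\<close> increases the weight by \<open>1 / \<delta>\<close>,
  \<open>w p |u p|\<^sup>q\<close> is bounded by \<open>\<delta> w |u|\<^sup>q\<close> at the end point plus a difference. Summed over \<open>V\<close>, the end point
  terms contribute at most half of the whole integral, which may be subtracted because it is finite.
  The function \<open>u\<close> stands for a truncation of \<open>f\<close> minus a constant: only its differences are compared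
  with those of \<open>f\<close>, so no chain rule for weak gradients is involved. Continuity of \<open>w\<close> makes the
  sets of good starting points closed, hence measurable.
\<close>
lemma nn_integral_tail_le:
  assumes q: "q > 1" and w: "continuous_on UNIV w" "\<And>p. w p \<ge> 0"
    and V: "finite V" and T: "T \<in> sets borel"
    and tail: "\<And>p. p \<in> T \<Longrightarrow> escapes e V \<delta> w p"
    and \<delta>: "\<delta> \<ge> 0" "2 powr q * card V * \<delta> \<le> 1 / 2"
    and u [measurable]: "u \<in> borel_measurable borel"
    and lip: "\<And>p p'. \<bar>u p - u p'\<bar> \<le> \<bar>f p - f p'\<bar>"
    and fin: "(\<integral>\<^sup>+p. ennreal (w p) * ennreal (\<bar>u p\<bar> powr q) \<partial>lborel) < \<infinity>"
  shows "(\<integral>\<^sup>+p. ennreal (w p) * ennreal (\<bar>u p\<bar> powr q) \<partial>lborel)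
    \<le> 2 * (\<integral>\<^sup>+p. indicator (- T) p * (ennreal (w p) * ennreal (\<bar>u p\<bar> powr q)) \<partial>lborel)
      + ennreal (2 * 2 powr q * (\<Sum>v\<in>V. norm v powr q)) * energy q w g"
proof -
  have [measurable]: "w \<in> borel_measurable borel"
    using w(1) by (rule borel_measurable_continuous_onI)
  have [measurable]: "T \<in> sets borel" by fact
  let ?U = "\<lambda>p. ennreal (w p) * ennreal (\<bar>u p\<bar> powr q)"
  let ?X = "\<integral>\<^sup>+p. ?U p \<partial>lborel"
  let ?Y = "\<integral>\<^sup>+p. indicator (- T) p * ?U p \<partial>lborel"
  let ?G = "energy q w g"
  define A where "A v = {p. (\<forall>s\<in>{0..1}. w p \<le> w (hline e v s p)) \<and> w p \<le> \<delta> * w (hmove e v p)}" for v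
  have "closed (A v)" for v
  proof -
    have c: "continuous_on UNIV (\<lambda>p. w (hmove e v' p))" for v'
      by (intro continuous_on_compose2[OF w(1)] continuous_intros) auto
    have "A v = (\<Inter>s\<in>{0..1}. {p. w p \<le> w (hline e v s p)}) \<inter> {p. w p \<le> \<delta> * w (hmove e v p)}"
      by (auto simp: A_def)
    also have "closed \<dots>"
      by (intro closed_Int closed_INT ballI closed_Collect_le w(1) c continuous_intros)
    finally show ?thesis .
  qed
  then have [measurable]: "A v \<in> sets borel" for v
    by (rule borel_closed)
  have step: "(\<integral>\<^sup>+p. indicator (A v) p * ?U p \<partial>lborel)
      \<le> ennreal (2 powr q) * (ennreal \<delta> * ?X + ennreal (norm v powr q) * ?G)" for v
  proof -
    have pt: "indicator (A v) p * ?U p \<le> ennreal (2 powr q) * (ennreal \<delta> * ?U (hmove e v p)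
        + indicator (A v) p * ennreal (w p) * ennreal (\<bar>jump v p\<bar> powr q))" for p
    proof (cases "p \<in> A v")
      case True
      have "\<bar>u p\<bar> powr q \<le> 2 powr q * (\<bar>u (hmove e v p)\<bar> powr q + \<bar>u p - u (hmove e v p)\<bar> powr q)"
        using powr_add_le[of q "u (hmove e v p)" "u p - u (hmove e v p)"] q by simp
      also have "\<bar>u p - u (hmove e v p)\<bar> powr q \<le> \<bar>jump v p\<bar> powr q"
        using lip[of p "hmove e v p"] q by (intro powr_mono2) (auto simp: abs_minus_commute)
      finally have "w p * \<bar>u p\<bar> powr q
          \<le> w p * (2 powr q * (\<bar>u (hmove e v p)\<bar> powr q + \<bar>jump v p\<bar> powr q))"
        using w(2) by (intro mult_left_mono) auto
      also have "\<dots> = 2 powr q * (w p * \<bar>u (hmove e v p)\<bar> powr q + w p * \<bar>jump v p\<bar> powr q)"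
        by (simp add: algebra_simps)
      also have "\<dots> \<le> 2 powr q * ((\<delta> * w (hmove e v p)) * \<bar>u (hmove e v p)\<bar> powr q + w p * \<bar>jump v p\<bar> powr q)"
        using True by (intro mult_left_mono add_right_mono mult_right_mono) (auto simp: A_def)
      finally show ?thesis
        using True w(2) \<delta>(1) by (simp add: mult.assoc flip: ennreal_mult ennreal_plus)
    qed simp
    have "(\<integral>\<^sup>+p. indicator (A v) p * ?U p \<partial>lborel)
        \<le> (\<integral>\<^sup>+p. ennreal (2 powr q) * (ennreal \<delta> * ?U (hmove e v p)
        + indicator (A v) p * ennreal (w p) * ennreal (\<bar>jump v p\<bar> powr q)) \<partial>lborel)"
      by (intro nn_integral_mono pt)
    also have "\<dots> = ennreal (2 powr q) * (ennreal \<delta> * (\<integral>\<^sup>+p. ?U (hmove e v p) \<partial>lborel)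
        + (\<integral>\<^sup>+p. indicator (A v) p * ennreal (w p) * ennreal (\<bar>jump v p\<bar> powr q) \<partial>lborel))"
      by (simp add: nn_integral_cmult nn_integral_add)
    also have "(\<integral>\<^sup>+p. ?U (hmove e v p) \<partial>lborel) = ?X"
      unfolding hmove_def by (rule nn_integral_right_translate) measurable
    also have "(\<integral>\<^sup>+p. indicator (A v) p * ennreal (w p) * ennreal (\<bar>jump v p\<bar> powr q) \<partial>lborel)
        \<le> ennreal (norm v powr q) * ?G"
    proof (rule nn_integral_difference_le[OF q])
      show "indicator (A v) p * ennreal (w p) \<le> ennreal (w (hline e v s p))"
        if "0 \<le> s" "s \<le> 1" for p s
        using that by (auto simp: A_def indicator_def intro!: ennreal_leI)
    qed measurable
    finally show ?thesis by (simp add: add_left_mono mult_left_mono)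
  qed
  have "?X \<le> (\<integral>\<^sup>+p. indicator (- T) p * ?U p + (\<Sum>v\<in>V. indicator (A v) p * ?U p) \<partial>lborel)"
  proof (intro nn_integral_mono)
    fix p :: "'n heis"
    show "?U p \<le> indicator (- T) p * ?U p + (\<Sum>v\<in>V. indicator (A v) p * ?U p)"
    proof (cases "p \<in> T")
      case True
      then obtain v where v: "v \<in> V" "p \<in> A v" using tail[OF True] by (auto simp: A_def)
      have "?U p = indicator (A v) p * ?U p" using v by simp
      also have "\<dots> \<le> (\<Sum>v\<in>V. indicator (A v) p * ?U p)"
        using v V by (intro member_le_sum) auto
      finally show ?thesis using True by simp
    qed simp
  qed
  also have "\<dots> = ?Y + (\<Sum>v\<in>V. \<integral>\<^sup>+p. indicator (A v) p * ?U p \<partial>lborel)"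
    by (simp add: nn_integral_add nn_integral_sum)
  also have "\<dots> \<le> ?Y + (\<Sum>v\<in>V. ennreal (2 powr q) * (ennreal \<delta> * ?X + ennreal (norm v powr q) * ?G))"
    by (intro add_left_mono sum_mono step)
  also have "(\<Sum>v\<in>V. ennreal (2 powr q) * (ennreal \<delta> * ?X + ennreal (norm v powr q) * ?G))
      = ennreal (2 powr q * card V * \<delta>) * ?X + ennreal (2 powr q * (\<Sum>v\<in>V. norm v powr q)) * ?G"
  proof -
    have "(\<Sum>v\<in>V. ennreal (2 powr q) * (ennreal \<delta> * ?X + ennreal (norm v powr q) * ?G))
        = of_nat (card V) * (ennreal (2 powr q) * (ennreal \<delta> * ?X))
          + ennreal (2 powr q) * ((\<Sum>v\<in>V. ennreal (norm v powr q)) * ?G)"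
      by (simp add: distrib_left sum.distrib sum_distrib_left sum_distrib_right del: sum_ennreal)
    then show ?thesis
      using \<delta>(1) by (simp add: ennreal_mult sum_nonneg ennreal_of_nat_eq_real_of_nat mult_ac)
  qed
  finally have "?X \<le> 2 * (?Y + ennreal (2 powr q * (\<Sum>v\<in>V. norm v powr q)) * ?G)"
    using fin \<delta>(2) by (intro ennreal_absorb_half[where a = "2 powr q * card V * \<delta>"]) (simp_all add: add_ac)
  then show ?thesis
    by (simp add: distrib_left ennreal_mult sum_nonneg mult.assoc)
qed

text \<open>
  Truncating \<open>f - c\<close> at height \<open>m\<close> makes the integral finite without increasing differences; Fatou's lemma
  removes the truncation.
\<close>
lemma nn_integral_tail_sub_const_le:
  assumes q: "q > 1" and w: "continuous_on UNIV w" "\<And>p. w p \<ge> 0" "(\<integral>\<^sup>+p. ennreal (w p) \<partial>lborel) < \<infinity>"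
    and V: "finite V" and T: "T \<in> sets borel"
    and tail: "\<And>p. p \<in> T \<Longrightarrow> escapes e V \<delta> w p"
    and \<delta>: "\<delta> \<ge> 0" "2 powr q * card V * \<delta> \<le> 1 / 2"
  shows "deviation q w f c
    \<le> 2 * (\<integral>\<^sup>+p. indicator (- T) p * (ennreal (w p) * ennreal (\<bar>f p - c\<bar> powr q)) \<partial>lborel)
      + ennreal (2 * 2 powr q * (\<Sum>v\<in>V. norm v powr q)) * energy q w g"
    (is "_ \<le> ?R")
proof -
  have [measurable]: "w \<in> borel_measurable borel"
    using w(1) by (rule borel_measurable_continuous_onI)
  have [measurable]: "T \<in> sets borel" by fact
  define u where "u m p = max (- real m) (min (real m) (f p - c))" for m p
  have [measurable]: "u m \<in> borel_measurable borel" for m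
    unfolding u_def by measurable
  have abs_u: "\<bar>u m p\<bar> = min (real m) \<bar>f p - c\<bar>" for m p
    by (auto simp: u_def max_def min_def)
  have bound: "(\<integral>\<^sup>+p. ennreal (w p) * ennreal (\<bar>u m p\<bar> powr q) \<partial>lborel) \<le> ?R" for m
  proof -
    have "(\<integral>\<^sup>+p. ennreal (w p) * ennreal (\<bar>u m p\<bar> powr q) \<partial>lborel)
        \<le> (\<integral>\<^sup>+p. ennreal (w p) * ennreal (real m powr q) \<partial>lborel)"
      using q by (intro nn_integral_mono mult_left_mono ennreal_leI powr_mono2) (auto simp: abs_u)
    also have "\<dots> = (\<integral>\<^sup>+p. ennreal (w p) \<partial>lborel) * ennreal (real m powr q)"
      by (rule nn_integral_multc) simp
    also have "\<dots> < \<infinity>"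
      using w(3) by (simp add: ennreal_mult_less_top)
    finally have fin: "(\<integral>\<^sup>+p. ennreal (w p) * ennreal (\<bar>u m p\<bar> powr q) \<partial>lborel) < \<infinity>" .
    have "(\<integral>\<^sup>+p. ennreal (w p) * ennreal (\<bar>u m p\<bar> powr q) \<partial>lborel)
      \<le> 2 * (\<integral>\<^sup>+p. indicator (- T) p * (ennreal (w p) * ennreal (\<bar>u m p\<bar> powr q)) \<partial>lborel)
      + ennreal (2 * 2 powr q * (\<Sum>v\<in>V. norm v powr q)) * energy q w g"
    proof (rule nn_integral_tail_le[OF q w(1,2) V T tail \<delta> _ _ fin])
      show "\<bar>u m p - u m p'\<bar> \<le> \<bar>f p - f p'\<bar>" for p p'
        by (auto simp: u_def max_def min_def)
    qed simp_all
    also have "\<dots> \<le> ?R"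
      using q by (intro add_right_mono mult_left_mono nn_integral_mono ennreal_leI powr_mono2) (auto simp: abs_u)
    finally show ?thesis .
  qed
  have "deviation q w f c
      = (\<integral>\<^sup>+p. liminf (\<lambda>m. ennreal (w p) * ennreal (\<bar>u m p\<bar> powr q)) \<partial>lborel)"
  proof (intro nn_integral_cong)
    fix p :: "'n heis"
    have "eventually (\<lambda>m. ennreal (w p) * ennreal (\<bar>u m p\<bar> powr q) = ennreal (w p) * ennreal (\<bar>f p - c\<bar> powr q)) sequentially"
      using eventually_ge_at_top[of "nat \<lceil>\<bar>f p - c\<bar>\<rceil>"]
      by eventually_elim (simp add: abs_u min_absorb2 nat_ceiling_le_eq)
    then have "(\<lambda>m. ennreal (w p) * ennreal (\<bar>u m p\<bar> powr q)) \<longlonglongrightarrow> ennreal (w p) * ennreal (\<bar>f p - c\<bar> powr q)"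
      by (rule tendsto_eventually)
    then show "ennreal (w p) * ennreal (\<bar>f p - c\<bar> powr q) = liminf (\<lambda>m. ennreal (w p) * ennreal (\<bar>u m p\<bar> powr q))"
      by (simp add: lim_imp_Liminf)
  qed
  also have "\<dots> \<le> liminf (\<lambda>m. \<integral>\<^sup>+p. ennreal (w p) * ennreal (\<bar>u m p\<bar> powr q) \<partial>lborel)"
    by (intro nn_integral_liminf) measurable
  also have "\<dots> \<le> limsup (\<lambda>m. \<integral>\<^sup>+p. ennreal (w p) * ennreal (\<bar>u m p\<bar> powr q) \<partial>lborel)"
    by (intro Liminf_le_Limsup) simp
  also have "\<dots> \<le> ?R"
    by (intro Limsup_bounded always_eventually allI bound)
  finally show ?thesis .
qed

end

section \<open>The Poincare inequality on balls\<close>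

definition moves :: "'n::finite \<Rightarrow> (real ^ ('n + 'n)) list \<Rightarrow> 'n heis \<Rightarrow> 'n heis" where
  "moves e vs p = fold (hmove e) vs p"

lemma moves_simps [simp]: "moves e [] p = p" "moves e (v # vs) p = moves e vs (hmove e v p)"
  by (simp_all add: moves_def)

lemma borel_measurable_moves [measurable]: "moves e vs \<in> borel_measurable borel"
proof -
  have "continuous_on UNIV (moves e vs)"
  proof (induction vs)
    case (Cons v vs)
    have "continuous_on UNIV (\<lambda>p. moves e vs (hmove e v p))"
      by (rule continuous_on_compose2[OF Cons]) (auto intro!: continuous_intros)
    then show ?case by simp
  qed (simp add: continuous_on_id)
  then show ?thesis by (rule borel_measurable_continuous_onI)
qed

text \<open>
  The commutator of the two directions of the distinguished plane is the central element
  \<open>(0, 2 omega)\<close>, and \<open>omega\<close> equals \<open>1 / 2\<close> on its unit vectors; scaling one of them by \<open>snd h\<close> reaches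
  the central component of \<open>h\<close>.
\<close>
lemma heis_mult_eq_moves:
  fixes e :: "'n::finite" and h :: "'n heis"
  defines "vs \<equiv> [fst h, axis (Inl e) 1, snd h *\<^sub>R axis (Inr e) 1, - axis (Inl e) 1, - (snd h *\<^sub>R axis (Inr e) 1)]"
  shows "heis_mult e p h = moves e vs p"
    and "v \<in> set vs \<Longrightarrow> norm v \<le> 1 + norm h"
proof -
  have "omega e (axis (Inl e) 1) (axis (Inr e) 1) = (\<Sum>i\<in>UNIV. if i = e then 1 / 2 else 0)"
    unfolding omega_def by (intro sum.cong) (auto simp: coef_def axis_def)
  then have o: "omega e (axis (Inl e) 1) (axis (Inr e) 1) = 1 / 2" by simp
  have "moves e vs p = heis_mult e (heis_mult e (heis_mult e (heis_mult e (heis_mult e p (fst h, 0))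
      (axis (Inl e) 1, 0)) (snd h *\<^sub>R axis (Inr e) 1, 0)) (- axis (Inl e) 1, 0)) (- (snd h *\<^sub>R axis (Inr e) 1), 0)"
    by (simp add: vs_def hmove_def)
  also have "\<dots> = heis_mult e p h"
    by (cases h) (simp add: heis_mult_assoc heis_mult_Pair omega_simps o distrib_left
        omega_commute[of e "axis (Inr e) 1" "axis (Inl e) 1"])
  finally show "heis_mult e p h = moves e vs p" ..
  have "norm (fst h) \<le> norm h" "\<bar>snd h\<bar> \<le> norm h"
    using norm_fst_le[of "fst h" "snd h"] norm_snd_le[of "snd h" "fst h"] by simp_all
  then show "norm v \<le> 1 + norm h" if "v \<in> set vs"
    using that norm_ge_zero[of h] by (auto simp: vs_def)
qed

text \<open>
  Telescoping along the list. Each move enlarges the ball on which differences are controlled, so the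
  induction is over all radii; on a ball \<open>w\<close> is bounded below, which brings in the weight. The constant
  is chosen before \<open>f\<close> and \<open>g\<close>.
\<close>
lemma nn_integral_moves_le:
  fixes w :: "'n::finite heis \<Rightarrow> real"
  assumes q: "q > 1" and w: "continuous_on UNIV w" "\<And>p. w p > 0"
  shows "\<exists>C\<ge>0. \<forall>f g vs. borel_weak_gradient e f g \<longrightarrow> length vs = m \<longrightarrow> (\<forall>v\<in>set vs. norm v \<le> \<rho>) \<longrightarrow>
    (\<integral>\<^sup>+p. indicator (cball 0 R) p * ennreal (\<bar>f (moves e vs p) - f p\<bar> powr q) \<partial>lborel)
      \<le> ennreal C * energy q w g"
proof (induction m arbitrary: R)
  case 0
  show ?case using q by (intro exI[of _ 0]) auto
next
  case (Suc m)
  obtain R' where R': "R' \<ge> R" "\<And>p v. norm p \<le> R \<Longrightarrow> norm v \<le> \<rho> \<Longrightarrow> norm (hmove e v p) \<le> R'"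
    by (rule hmove_into_cball[of R \<rho> e]) (rule that)
  obtain C where C: "C \<ge> 0" "\<And>f g vs. borel_weak_gradient e f g \<Longrightarrow> length vs = m \<Longrightarrow> (\<forall>v\<in>set vs. norm v \<le> \<rho>) \<Longrightarrow>
    (\<integral>\<^sup>+p. indicator (cball 0 R') p * ennreal (\<bar>f (moves e vs p) - f p\<bar> powr q) \<partial>lborel)
      \<le> ennreal C * energy q w g"
    using Suc[of R'] by blast
  have "\<exists>c>0. \<forall>p\<in>cball 0 R'. c \<le> w p"
  proof (cases "cball (0::'n heis) R' = {}")
    case False
    obtain p0 where "p0 \<in> cball 0 R'" "\<forall>p\<in>cball 0 R'. w p0 \<le> w p"
      using continuous_attains_inf[OF compact_cball False continuous_on_subset[OF w(1)]] by auto
    then show ?thesis using w(2) by blast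
  qed (auto intro: exI[of _ 1])
  then obtain c where c: "c > 0" "\<And>p. norm p \<le> R' \<Longrightarrow> c \<le> w p" by auto
  define D where "D = 2 powr q * (C + (\<bar>\<rho>\<bar> powr q) / c)"
  show ?case
  proof (intro exI[of _ D] conjI allI impI)
    show "D \<ge> 0" using C(1) c(1) by (simp add: D_def)
    fix f :: "'n heis \<Rightarrow> real" and g :: "'n heis \<Rightarrow> real ^ ('n + 'n)"
      and us :: "(real ^ ('n + 'n)) list"
    assume "borel_weak_gradient e f g" and len: "length us = Suc m" and \<rho>: "\<forall>v\<in>set us. norm v \<le> \<rho>"
    then interpret borel_weak_gradient e f g by simp
    obtain v vs where us: "us = v # vs" using len by (cases us) auto
    let ?G = "energy q w g"
    have [measurable]: "w \<in> borel_measurable borel"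
      using w(1) by (rule borel_measurable_continuous_onI)
    have [measurable]: "cball 0 R \<in> sets (borel :: 'n heis measure)" "cball 0 R' \<in> sets (borel :: 'n heis measure)"
      by simp_all
    have into: "norm (hline e v s p) \<le> R'" if "norm p \<le> R" "0 \<le> s" "s \<le> 1" for p s
    proof (rule R'(2)[OF that(1)])
      have "s * norm v \<le> norm v" using that by (simp add: mult_left_le_one_le)
      then show "norm (s *\<^sub>R v) \<le> \<rho>" using \<rho> that us by auto
    qed
    define X where "X p = indicator (cball 0 R') p * ennreal (\<bar>f (moves e vs p) - f p\<bar> powr q)" for p
    have [measurable]: "X \<in> borel_measurable borel"
      unfolding X_def by measurable
    have X: "(\<integral>\<^sup>+p. X (hmove e v p) \<partial>lborel) \<le> ennreal C * ?G"
    proof -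
      have "(\<integral>\<^sup>+p. X (hmove e v p) \<partial>lborel) = (\<integral>\<^sup>+p. X p \<partial>lborel)"
        unfolding hmove_def by (rule nn_integral_right_translate) measurable
      also have "\<dots> \<le> ennreal C * ?G"
        unfolding X_def using \<rho> len us by (intro C(2) borel_weak_gradient_axioms) auto
      finally show ?thesis .
    qed
    have Y: "(\<integral>\<^sup>+p. indicator (cball 0 R) p * ennreal (\<bar>jump v p\<bar> powr q) \<partial>lborel)
        \<le> ennreal (\<bar>\<rho>\<bar> powr q / c) * ?G"
    proof -
      have "(\<integral>\<^sup>+p. indicator (cball 0 R) p * ennreal (\<bar>jump v p\<bar> powr q) \<partial>lborel)
          \<le> ennreal (norm v powr q) * (\<integral>\<^sup>+p. ennreal (w p / c) * ennreal (norm (g p) powr q) \<partial>lborel)"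
      proof (rule nn_integral_difference_le[OF q])
        show "indicator (cball 0 R) p \<le> ennreal (w (hline e v s p) / c)" if "0 \<le> s" "s \<le> 1" for p s
          using c into[of p s] that by (auto simp: indicator_def)
      qed measurable
      also have "(\<integral>\<^sup>+p. ennreal (w p / c) * ennreal (norm (g p) powr q) \<partial>lborel)
          = (\<integral>\<^sup>+p. ennreal (1 / c) * (ennreal (w p) * ennreal (norm (g p) powr q)) \<partial>lborel)"
        using c(1) w(2) by (intro nn_integral_cong) (simp add: less_imp_le flip: ennreal_mult)
      also have "\<dots> = ennreal (1 / c) * ?G"
        by (intro nn_integral_cmult) measurable
      also have "ennreal (norm v powr q) * (ennreal (1 / c) * ?G) = ennreal (norm v powr q / c) * ?G"
        using c(1) by (simp add: mult.assoc[symmetric] flip: ennreal_mult)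
      also have "\<dots> \<le> ennreal (\<bar>\<rho>\<bar> powr q / c) * ?G"
        using c(1) q \<rho> us by (intro mult_right_mono ennreal_leI divide_right_mono powr_mono2) auto
      finally show ?thesis .
    qed
    have "(\<integral>\<^sup>+p. indicator (cball 0 R) p * ennreal (\<bar>f (moves e us p) - f p\<bar> powr q) \<partial>lborel)
        \<le> (\<integral>\<^sup>+p. ennreal (2 powr q) * (X (hmove e v p)
            + indicator (cball 0 R) p * ennreal (\<bar>jump v p\<bar> powr q)) \<partial>lborel)"
    proof (intro nn_integral_mono)
      fix p :: "'n heis"
      show "indicator (cball 0 R) p * ennreal (\<bar>f (moves e us p) - f p\<bar> powr q)
          \<le> ennreal (2 powr q) * (X (hmove e v p)
            + indicator (cball 0 R) p * ennreal (\<bar>jump v p\<bar> powr q))"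
      proof (cases "norm p \<le> R")
        case True
        have "\<bar>f (moves e us p) - f p\<bar> powr q \<le> 2 powr q *
            (\<bar>f (moves e vs (hmove e v p)) - f (hmove e v p)\<bar> powr q + \<bar>jump v p\<bar> powr q)"
          using powr_add_le[of q "f (moves e vs (hmove e v p)) - f (hmove e v p)" "f (hmove e v p) - f p"] q
          by (simp add: us)
        then show ?thesis
          using True into[of p 1] by (simp add: X_def ennreal_leI flip: ennreal_mult ennreal_plus)
      qed (simp add: indicator_def)
    qed
    also have "\<dots> = ennreal (2 powr q) * ((\<integral>\<^sup>+p. X (hmove e v p) \<partial>lborel)
        + (\<integral>\<^sup>+p. indicator (cball 0 R) p * ennreal (\<bar>jump v p\<bar> powr q) \<partial>lborel))"
      by (simp add: nn_integral_cmult nn_integral_add)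
    also have "\<dots> \<le> ennreal (2 powr q) * (ennreal C * ?G + ennreal (\<bar>\<rho>\<bar> powr q / c) * ?G)"
      by (intro mult_left_mono add_mono X Y) simp
    also have "\<dots> = ennreal D * ?G"
    proof -
      have "ennreal D = ennreal (2 powr q) * (ennreal C + ennreal (\<bar>\<rho>\<bar> powr q / c))"
        using C(1) c(1) by (simp add: D_def ennreal_mult ennreal_plus)
      then show ?thesis by (simp add: ring_distribs mult.assoc)
    qed
    finally show "(\<integral>\<^sup>+p. indicator (cball 0 R) p * ennreal (\<bar>f (moves e us p) - f p\<bar> powr q) \<partial>lborel)
        \<le> ennreal D * ?G" .
  qed
qed

text \<open>
  The substitution \<open>p' = p \<circ> h\<close> preserves the measure in \<open>p'\<close>, and \<open>h\<close> stays in a fixed ball when \<open>p\<close> and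
  \<open>p'\<close> do; for fixed \<open>h\<close> the difference is one along five horizontal moves.
\<close>
lemma local_poincare:
  fixes w :: "'n::finite heis \<Rightarrow> real"
  assumes q: "q > 1" and w: "continuous_on UNIV w" "\<And>p. w p > 0"
  shows "\<exists>C\<ge>0. \<forall>f g. borel_weak_gradient e f g \<longrightarrow>
    oscillation q (cball 0 R) f
      \<le> ennreal C * energy q w g"
proof -
  obtain K where K: "K \<ge> 0" "\<And>x y. norm (omega e x y) \<le> norm x * norm y * K"
    using bounded_bilinear.nonneg_bounded[OF bounded_bilinear_omega] by blast
  \<comment> \<open>a radius that bounds all quotients of two points of the ball\<close>
  define \<rho> where "\<rho> = 2 * \<bar>R\<bar> + \<bar>R\<bar> * \<bar>R\<bar> * K"
  have quot: "norm h \<le> \<rho>" if "norm p \<le> R" "norm (heis_mult e p h) \<le> R" for p h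
  proof -
    obtain x t y s where ph: "p = (x, t)" "heis_mult e p h = (y, s)" by (metis surj_pair)
    have "heis_mult e (- x, - t) (heis_mult e p h) = heis_mult e (heis_mult e (- x, - t) p) h"
      by (simp only: heis_mult_assoc)
    also have "\<dots> = h"
      by (cases h) (simp add: ph(1) heis_mult_Pair omega_simps)
    finally have "h = (- x + y, - t + s - omega e x y)"
      by (simp add: ph(2) heis_mult_Pair omega_simps)
    also have "\<dots> = - p + heis_mult e p h + (0, - omega e x y)"
      by (subst (1) ph(1), subst ph(2)) simp
    finally have "norm h \<le> norm p + norm (heis_mult e p h) + norm (omega e x y)"
      using norm_triangle_ineq[of "- p + heis_mult e p h" "(0, - omega e x y)"]
        norm_triangle_ineq[of "- p" "heis_mult e p h"] by (simp add: norm_Pair)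
    moreover have "norm x \<le> \<bar>R\<bar>" "norm y \<le> \<bar>R\<bar>"
      using that norm_fst_le[of x t] norm_fst_le[of y s] ph by auto
    then have "norm x * norm y * K \<le> \<bar>R\<bar> * \<bar>R\<bar> * K"
      using K(1) by (intro mult_mono) auto
    ultimately show ?thesis
      using K(2)[of x y] that by (simp add: \<rho>_def)
  qed
  obtain C where C: "C \<ge> 0" "\<And>f g vs. borel_weak_gradient e f g \<Longrightarrow> length vs = 5 \<Longrightarrow> (\<forall>v\<in>set vs. norm v \<le> 1 + \<rho>) \<Longrightarrow>
    (\<integral>\<^sup>+p. indicator (cball 0 R) p * ennreal (\<bar>f (moves e vs p) - f p\<bar> powr q) \<partial>lborel)
      \<le> ennreal C * energy q w g"
    using nn_integral_moves_le[OF q w, of e 5 "1 + \<rho>" R] by blast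
  define c where "c = measure lborel (cball (0::'n heis) \<rho>)"
  have c: "emeasure lborel (cball (0::'n heis) \<rho>) = ennreal c"
    unfolding c_def using emeasure_lborel_cball_finite[of "0::'n heis" \<rho>]
    by (intro emeasure_eq_ennreal_measure) auto
  show ?thesis
  proof (intro exI[of _ "C * c"] conjI allI impI)
    show "C * c \<ge> 0" using C(1) by (simp add: c_def)
    fix f :: "'n heis \<Rightarrow> real" and g :: "'n heis \<Rightarrow> real ^ ('n + 'n)"
    assume "borel_weak_gradient e f g"
    then interpret borel_weak_gradient e f g .
    let ?G = "energy q w g"
    have [measurable]: "cball 0 R \<in> sets (borel :: 'n heis measure)" "cball 0 \<rho> \<in> sets (borel :: 'n heis measure)"
      by simp_all
    let ?d = "\<lambda>p h. ennreal (\<bar>f (heis_mult e p h) - f p\<bar> powr q)"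
    have "oscillation q (cball 0 R) f
        = (\<integral>\<^sup>+p. indicator (cball 0 R) p * (\<integral>\<^sup>+h. indicator (cball 0 R) (heis_mult e p h) * ?d p h \<partial>lborel) \<partial>lborel)"
    proof -
      have "(\<integral>\<^sup>+p'. indicator (cball 0 R) p' * ennreal (\<bar>f p' - f p\<bar> powr q) \<partial>lborel)
          = (\<integral>\<^sup>+h. indicator (cball 0 R) (heis_mult e p h) * ?d p h \<partial>lborel)" for p
        by (rule nn_integral_left_translate[symmetric]) measurable
      then show ?thesis by simp
    qed
    also have "\<dots> \<le> (\<integral>\<^sup>+p. (\<integral>\<^sup>+h. indicator (cball 0 \<rho>) h * (indicator (cball 0 R) p * ?d p h) \<partial>lborel) \<partial>lborel)"
    proof (intro nn_integral_mono)
      fix p :: "'n heis"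
      have "indicator (cball 0 R) p * (\<integral>\<^sup>+h. indicator (cball 0 R) (heis_mult e p h) * ?d p h \<partial>lborel)
          = (\<integral>\<^sup>+h. indicator (cball 0 R) p * (indicator (cball 0 R) (heis_mult e p h) * ?d p h) \<partial>lborel)"
        by (intro nn_integral_cmult[symmetric]) measurable
      also have "\<dots> \<le> (\<integral>\<^sup>+h. indicator (cball 0 \<rho>) h * (indicator (cball 0 R) p * ?d p h) \<partial>lborel)"
        using quot[of p] by (intro nn_integral_mono) (auto simp: indicator_def)
      finally show "indicator (cball 0 R) p * (\<integral>\<^sup>+h. indicator (cball 0 R) (heis_mult e p h) * ?d p h \<partial>lborel)
          \<le> (\<integral>\<^sup>+h. indicator (cball 0 \<rho>) h * (indicator (cball 0 R) p * ?d p h) \<partial>lborel)" .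
    qed
    also have "\<dots> = (\<integral>\<^sup>+h. (\<integral>\<^sup>+p. indicator (cball 0 \<rho>) h * (indicator (cball 0 R) p * ?d p h) \<partial>lborel) \<partial>lborel)"
      by (rule lborel_pair.Fubini'[symmetric]) measurable
    also have "\<dots> \<le> (\<integral>\<^sup>+h. ennreal C * ?G * indicator (cball 0 \<rho>) (h::'n heis) \<partial>lborel)"
    proof (rule nn_integral_mono)
      fix h :: "'n heis"
      show "(\<integral>\<^sup>+p. indicator (cball 0 \<rho>) h * (indicator (cball 0 R) p * ?d p h) \<partial>lborel)
          \<le> ennreal C * ?G * indicator (cball 0 \<rho>) h"
      proof (cases "norm h \<le> \<rho>")
        case True
        define vs where "vs = [fst h, axis (Inl e) 1, snd h *\<^sub>R axis (Inr e) 1, - axis (Inl e) 1, - (snd h *\<^sub>R axis (Inr e) 1)]"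
        have "heis_mult e p h = moves e vs p" for p
          unfolding vs_def by (rule heis_mult_eq_moves)
        moreover have "\<forall>v\<in>set vs. norm v \<le> 1 + \<rho>"
        proof
          fix v assume "v \<in> set vs"
          then have "norm v \<le> 1 + norm h"
            unfolding vs_def by (rule heis_mult_eq_moves(2))
          then show "norm v \<le> 1 + \<rho>" using True by simp
        qed
        moreover have "length vs = 5" by (simp add: vs_def)
        ultimately show ?thesis
          using C(2)[OF borel_weak_gradient_axioms, of vs] True by (simp add: indicator_def)
      qed (simp add: indicator_def)
    qed
    also have "\<dots> = ennreal C * ?G * emeasure lborel (cball (0::'n heis) \<rho>)"
      by (rule nn_integral_cmult_indicator) simp
    also have "\<dots> = ennreal (C * c) * ?G"
      unfolding c using C(1) by (simp add: ennreal_mult' c_def mult_ac)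
    finally show "oscillation q (cball 0 R) f
      \<le> ennreal (C * c) * ?G" .
  qed
qed

section \<open>The norm in closed form\<close>

lemma sum_sum_type:
  fixes h :: "'n::finite + 'n \<Rightarrow> real"
  shows "(\<Sum>j\<in>UNIV. h j) = (\<Sum>i\<in>UNIV. h (Inl i) + h (Inr i))"
proof -
  have "(\<Sum>j\<in>(UNIV :: ('n + 'n) set). h j) = sum h (range Inl) + sum h (range Inr)"
    by (subst UNIV_sum) (auto intro!: sum.union_disjoint)
  then show ?thesis
    by (simp add: sum.reindex sum.distrib)
qed

text \<open>
  In this form the anisotropy of \<open>B\<close> is that of the group law: \<open>B\<close> is stationary under the rotation of all
  coordinate planes, and \<open>omega\<close> changes along that rotation at the rate \<open>2 B\<close>.
\<close>
lemma formB_eq: "formB e x = 1 / 2 * (\<Sum>i\<in>UNIV. coef e i * ((x $ Inl i)\<^sup>2 + (x $ Inr i)\<^sup>2))"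
proof -
  let ?q = "\<lambda>j. (x $ j)\<^sup>2"
  have "(\<Sum>j\<in>UNIV - {Inl e, Inr e}. ?q j) = (\<Sum>j\<in>UNIV. ?q j) - (?q (Inl e) + ?q (Inr e))"
    by (subst sum_diff) auto
  also have "(\<Sum>j\<in>UNIV. ?q j) = (\<Sum>i\<in>UNIV. ?q (Inl i) + ?q (Inr i))"
    by (rule sum_sum_type)
  also have "\<dots> = (\<Sum>i\<in>UNIV. coef e i * (?q (Inl i) + ?q (Inr i))
      + (if i = e then 1 / 2 * (?q (Inl e) + ?q (Inr e)) else 0))"
    by (intro sum.cong) (auto simp: coef_def)
  also have "\<dots> = (\<Sum>i\<in>UNIV. coef e i * (?q (Inl i) + ?q (Inr i))) + 1 / 2 * (?q (Inl e) + ?q (Inr e))"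
    by (subst sum.distrib) simp
  finally have rest: "(\<Sum>j\<in>UNIV - {Inl e, Inr e}. ?q j)
      = (\<Sum>i\<in>UNIV. coef e i * (?q (Inl i) + ?q (Inr i))) + 1 / 2 * (?q (Inl e) + ?q (Inr e))
        - (?q (Inl e) + ?q (Inr e))" .
  have "q / 4 + 1 / 2 * (s + 1 / 2 * q - q) = 1 / 2 * s" for q s :: real
    by (simp add: field_simps)
  then show ?thesis
    unfolding formB_def rest .
qed

text \<open>
  The difference \<open>A - B\<close>; it only sees the distinguished plane, so it is constant along moves in the
  other planes.
\<close>
definition formS :: "'n::finite \<Rightarrow> real ^ ('n + 'n) \<Rightarrow> real" where
  "formS e x = ((x $ Inl e)\<^sup>2 + (x $ Inr e)\<^sup>2) / 4"

lemma formA_eq: "formA e x = formB e x + formS e x"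
  by (simp add: formA_def formB_def formS_def)

text \<open>
  The polar forms of \<open>B\<close> and \<open>S\<close>, which are their derivatives along a line.
\<close>
definition bilB :: "'n::finite \<Rightarrow> real ^ ('n + 'n) \<Rightarrow> real ^ ('n + 'n) \<Rightarrow> real" where
  "bilB e x v = (\<Sum>i\<in>UNIV. coef e i * (x $ Inl i * v $ Inl i + x $ Inr i * v $ Inr i))"

definition bilS :: "'n::finite \<Rightarrow> real ^ ('n + 'n) \<Rightarrow> real ^ ('n + 'n) \<Rightarrow> real" where
  "bilS e x v = (x $ Inl e * v $ Inl e + x $ Inr e * v $ Inr e) / 2"

lemma formB_move: "formB e (x + s *\<^sub>R v) = formB e x + s * bilB e x v + s\<^sup>2 * formB e v"
proof -
  have "formB e (x + s *\<^sub>R v) = (\<Sum>i\<in>UNIV. 1 / 2 * (coef e i * ((x $ Inl i)\<^sup>2 + (x $ Inr i)\<^sup>2))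
      + s * (coef e i * (x $ Inl i * v $ Inl i + x $ Inr i * v $ Inr i))
      + s\<^sup>2 * (1 / 2 * (coef e i * ((v $ Inl i)\<^sup>2 + (v $ Inr i)\<^sup>2))))"
    unfolding formB_eq sum_distrib_left
    by (intro sum.cong) (auto simp: power2_eq_square algebra_simps)
  then show ?thesis
    unfolding formB_eq bilB_def by (simp only: sum.distrib sum_distrib_left)
qed

lemma formS_move: "formS e (x + s *\<^sub>R v) = formS e x + s * bilS e x v + s\<^sup>2 * formS e v"
  unfolding formS_def bilS_def by (simp add: power2_eq_square field_simps)

lemma formB_scaleR: "formB e (r *\<^sub>R x) = r\<^sup>2 * formB e x"
  unfolding formB_eq by (simp add: power_mult_distrib sum_distrib_left algebra_simps)

lemma formS_scaleR: "formS e (r *\<^sub>R x) = r\<^sup>2 * formS e x"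
  unfolding formS_def by (simp add: power_mult_distrib algebra_simps)

lemma formS_nonneg: "0 \<le> formS e x"
  by (simp add: formS_def)

lemma formS_le_formB: "formS e x \<le> formB e x"
  by (simp add: formB_def formS_def sum_nonneg)

lemma formB_nonneg: "0 \<le> formB e x"
  using formS_le_formB[of e x] formS_nonneg[of e x] by linarith

lemma norm_le_formB: "(norm x)\<^sup>2 \<le> 4 * formB e x"
proof -
  have "(norm x)\<^sup>2 = (\<Sum>i\<in>UNIV. (x $ Inl i)\<^sup>2 + (x $ Inr i)\<^sup>2)"
    by (simp add: norm_vec_def L2_set_def sum_nonneg sum_sum_type)
  also have "\<dots> \<le> (\<Sum>i\<in>UNIV. 2 * (coef e i * ((x $ Inl i)\<^sup>2 + (x $ Inr i)\<^sup>2)))"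
    by (intro sum_mono) (auto simp: coef_def)
  also have "\<dots> = 4 * formB e x"
    by (simp add: formB_eq sum_distrib_left)
  finally show ?thesis .
qed

lemma continuous_on_forms [continuous_intros]:
  assumes "continuous_on S f"
  shows "continuous_on S (\<lambda>x. formB e (f x))" "continuous_on S (\<lambda>x. formS e (f x))"
    "continuous_on S (\<lambda>x. bilB e (f x) v)" "continuous_on S (\<lambda>x. bilS e (f x) v)"
  unfolding formB_eq formS_def bilB_def bilS_def
  by (intro continuous_intros assms; simp)+

text \<open>
  The quantity \<open>D\<close>, homogeneous of degree \<open>2\<close> and comparable to \<open>N\<^sup>2\<close>; it measures the distance
  to the origin in all estimates below.
\<close>
definition hgauge :: "'n::finite \<Rightarrow> 'n heis \<Rightarrow> real" where
  "hgauge e p = sqrt ((formB e (fst p))\<^sup>2 + (snd p)\<^sup>2)"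

lemma hgauge_power2: "(hgauge e p)\<^sup>2 = (formB e (fst p))\<^sup>2 + (snd p)\<^sup>2"
  by (simp add: hgauge_def)

lemma formB_le_hgauge: "formB e (fst p) \<le> hgauge e p"
  unfolding hgauge_def by (rule real_le_rsqrt) simp

lemma hgauge_pos: "p \<noteq> 0 \<Longrightarrow> 0 < hgauge e p"
proof -
  assume "p \<noteq> 0"
  then have "fst p \<noteq> 0 \<or> snd p \<noteq> 0" by (cases p) (auto simp: zero_prod_def)
  then have "formB e (fst p) > 0 \<or> snd p \<noteq> 0"
    using norm_le_formB[of "fst p" e] by (smt (verit) zero_less_norm_iff zero_less_power2)
  then have "(formB e (fst p))\<^sup>2 + (snd p)\<^sup>2 > 0"
    by (auto intro: add_pos_nonneg add_nonneg_pos)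
  then show ?thesis by (simp add: hgauge_def)
qed

lemma hgauge_zero [simp]: "hgauge e 0 = 0"
  by (simp add: hgauge_def formB_eq)

lemma hgauge_nonneg: "0 \<le> hgauge e p"
  by (simp add: hgauge_def)

lemma continuous_on_hgauge [continuous_intros]:
  "continuous_on S f \<Longrightarrow> continuous_on S (\<lambda>x. hgauge e (f x))"
  unfolding hgauge_def by (intro continuous_intros)

lemma norm_le_hgauge: "(norm p)\<^sup>2 \<le> 4 * hgauge e p + (hgauge e p)\<^sup>2"
proof -
  have "(norm p)\<^sup>2 = (norm (fst p))\<^sup>2 + (snd p)\<^sup>2"
    by (cases p) (simp add: norm_Pair)
  moreover have "(snd p)\<^sup>2 \<le> (hgauge e p)\<^sup>2"
    by (simp add: hgauge_power2)
  ultimately show ?thesis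
    using norm_le_formB[of "fst p" e] formB_le_hgauge[of e p] by linarith
qed

text \<open>
  This is \<open>4 n log N\<close>. The closed formula for \<open>N\<close> contains the product
  \<open>(B + D) (S + D)\<close> in the guise of \<open>A B + t\<^sup>2 + A D\<close>, which simplifies against its denominator.
\<close>
definition ell :: "'n::finite \<Rightarrow> 'n heis \<Rightarrow> real" where
  "ell e p = 2 * ln (hgauge e p) + (2 * real CARD('n) - 1) * ln (formS e (fst p) + hgauge e p)
    - ln (formB e (fst p) + hgauge e p)"

lemma hnorm_eq_exp_ell:
  fixes e :: "'n::finite"
  assumes "p \<noteq> 0"
  shows "hnorm e p = exp (ell e p / (4 * real CARD('n)))"
proof -
  let ?n = "real CARD('n)"
  obtain x t where p: "p = (x, t)" by (cases p)
  define B S D where "B = formB e x" and "S = formS e x" and "D = hgauge e p"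
  have D: "D > 0" "D\<^sup>2 = B\<^sup>2 + t\<^sup>2" "sqrt (B\<^sup>2 + t\<^sup>2) = D"
    using hgauge_pos[OF assms, of e] hgauge_power2[of e p] by (simp_all add: D_def B_def p hgauge_def)
  have BS: "B \<ge> 0" "S \<ge> 0"
    by (simp_all add: B_def S_def formB_nonneg formS_nonneg)
  have n: "?n > 0" by simp
  have prod: "formA e x * B + t\<^sup>2 + formA e x * D = (B + D) * (S + D)"
  proof -
    have "t\<^sup>2 = D\<^sup>2 - B\<^sup>2" using D(2) by simp
    then show ?thesis
      unfolding formA_eq B_def[symmetric] S_def[symmetric] by (simp add: power2_eq_square algebra_simps)
  qed
  have "hnorm e p = (D\<^sup>2) powr (1 / (4 * ?n)) * ((B + D) * (S + D)) powr (1 / 2 - 1 / (4 * ?n))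
      / (B + D) powr (1 / 2)"
    using assms unfolding hnorm_def p prod[symmetric]
    by (simp add: Let_def p B_def[symmetric] D(2,3) del: powr_half_sqrt)
  also have "(D\<^sup>2) powr (1 / (4 * ?n)) = exp (1 / (4 * ?n) * (2 * ln D))"
    using D(1) by (simp add: powr_def ln_realpow)
  also have "((B + D) * (S + D)) powr (1 / 2 - 1 / (4 * ?n))
      = exp ((1 / 2 - 1 / (4 * ?n)) * (ln (B + D) + ln (S + D)))"
    using D(1) BS by (simp add: powr_def ln_mult)
  also have "(B + D) powr (1 / 2) = exp (1 / 2 * ln (B + D))"
    using D(1) BS by (simp add: powr_def)
  also have "exp (1 / (4 * ?n) * (2 * ln D)) * exp ((1 / 2 - 1 / (4 * ?n)) * (ln (B + D) + ln (S + D)))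
      / exp (1 / 2 * ln (B + D))
    = exp (1 / (4 * ?n) * (2 * ln D) + (1 / 2 - 1 / (4 * ?n)) * (ln (B + D) + ln (S + D)) - 1 / 2 * ln (B + D))"
    by (simp add: exp_add exp_diff)
  also have "1 / (4 * ?n) * (2 * ln D) + (1 / 2 - 1 / (4 * ?n)) * (ln (B + D) + ln (S + D)) - 1 / 2 * ln (B + D)
      = ell e p / (4 * ?n)"
    using n by (simp add: ell_def p B_def[symmetric] S_def[symmetric] D_def[symmetric, unfolded p] field_simps)
  finally show ?thesis .
qed

lemma one_le_real_card: "1 \<le> real CARD('a::finite)"
  using zero_less_card_finite[where 'a = 'a] by linarith

lemma ell_bounds:
  fixes e :: "'n::finite"
  assumes "p \<noteq> 0"
  shows "2 * real CARD('n) * ln (hgauge e p) - ln 2 \<le> ell e p"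
    and "ell e p \<le> 2 * real CARD('n) * ln (hgauge e p) + (2 * real CARD('n) - 1) * ln 2"
proof -
  let ?n = "real CARD('n)"
  define B S D where "B = formB e (fst p)" and "S = formS e (fst p)" and "D = hgauge e p"
  have D: "D > 0" using hgauge_pos[OF assms] by (simp add: D_def)
  have BS: "0 \<le> S" "S \<le> B" "B \<le> D"
    by (simp_all add: B_def S_def D_def formB_le_hgauge formS_nonneg formS_le_formB)
  have n: "2 * ?n - 1 \<ge> 0"
    using one_le_real_card[where 'a = 'n] by linarith
  have l: "ln D \<le> ln (S + D)" "ln (S + D) \<le> ln (2 * D)" "ln D \<le> ln (B + D)" "ln (B + D) \<le> ln (2 * D)"
    using D BS by simp_all
  have l2: "ln (2 * D) = ln 2 + ln D" using D by (simp add: ln_mult)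
  have a: "(2 * ?n - 1) * ln D \<le> (2 * ?n - 1) * ln (S + D)"
    "(2 * ?n - 1) * ln (S + D) \<le> (2 * ?n - 1) * (ln 2 + ln D)"
    using l l2 n by (auto intro: mult_left_mono)
  show "2 * ?n * ln (hgauge e p) - ln 2 \<le> ell e p"
    using a(1) l l2 unfolding ell_def B_def[symmetric] S_def[symmetric] D_def[symmetric]
    by (simp add: algebra_simps)
  show "ell e p \<le> 2 * ?n * ln (hgauge e p) + (2 * ?n - 1) * ln 2"
    using a(2) l l2 unfolding ell_def B_def[symmetric] S_def[symmetric] D_def[symmetric]
    by (simp add: algebra_simps)
qed

lemma hnorm_zero [simp]: "hnorm e 0 = 0"
  by (simp add: hnorm_def zero_prod_def)

lemma hnorm_nonneg: "0 \<le> hnorm e p"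
  by (cases "p = 0") (simp_all add: hnorm_eq_exp_ell)

lemma hnorm_power2_bounds:
  fixes e :: "'n::finite"
  shows "hgauge e p \<le> 2 * (hnorm e p)\<^sup>2" and "(hnorm e p)\<^sup>2 \<le> 2 * hgauge e p"
proof -
  let ?n = "real CARD('n)"
  have "hgauge e p \<le> 2 * (hnorm e p)\<^sup>2 \<and> (hnorm e p)\<^sup>2 \<le> 2 * hgauge e p"
  proof (cases "p = 0")
    case False
    have n: "?n \<ge> 1"
      by (rule one_le_real_card)
    have D: "hgauge e p > 0" by (rule hgauge_pos[OF False])
    have sq: "(hnorm e p)\<^sup>2 = exp (ell e p / (2 * ?n))"
      using False by (simp add: hnorm_eq_exp_ell exp_double[symmetric] flip: exp_of_nat_mult)
    have "ln 2 / (2 * ?n) \<le> ln 2 / 1"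
      using n by (intro divide_left_mono) (linarith | simp)+
    moreover have "(2 * ?n * ln (hgauge e p) - ln 2) / (2 * ?n) \<le> ell e p / (2 * ?n)"
      using ell_bounds(1)[OF False, of e] n by (intro divide_right_mono) auto
    moreover have "(2 * ?n * ln (hgauge e p) - ln 2) / (2 * ?n) = ln (hgauge e p) - ln 2 / (2 * ?n)"
      using n by (simp add: field_simps)
    ultimately have "ln (hgauge e p) \<le> ln 2 + ell e p / (2 * ?n)" by linarith
    then have "exp (ln (hgauge e p)) \<le> exp (ln 2 + ell e p / (2 * ?n))" by simp
    then have 1: "hgauge e p \<le> 2 * (hnorm e p)\<^sup>2" using D by (simp add: sq exp_add)
    have "ell e p / (2 * ?n) \<le> (2 * ?n * ln (hgauge e p) + (2 * ?n - 1) * ln 2) / (2 * ?n)"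
      using ell_bounds(2)[OF False, of e] n by (intro divide_right_mono) auto
    also have "\<dots> \<le> ln 2 + ln (hgauge e p)"
      using n by (simp add: field_simps)
    finally have "exp (ell e p / (2 * ?n)) \<le> exp (ln 2 + ln (hgauge e p))" by simp
    then show ?thesis using D 1 by (simp add: sq exp_add)
  qed simp
  then show "hgauge e p \<le> 2 * (hnorm e p)\<^sup>2" "(hnorm e p)\<^sup>2 \<le> 2 * hgauge e p" by auto
qed

lemma continuous_on_ell: "continuous_on (- {0}) (ell e)"
proof -
  have "hgauge e p > 0" "formS e (fst p) + hgauge e p > 0" "formB e (fst p) + hgauge e p > 0" if "p \<noteq> 0" for p
    using hgauge_pos[OF that, of e] formS_nonneg[of e "fst p"] formB_nonneg[of e "fst p"] by linarith+
  then show ?thesis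
    unfolding ell_def by (intro continuous_intros) (auto simp: less_imp_neq[symmetric])
qed

lemma continuous_on_hnorm: "continuous_on UNIV (hnorm (e :: 'n::finite))"
proof -
  have "isCont (hnorm e) p" for p
  proof (cases "p = 0")
    case False
    have "continuous_on (- {0}) (\<lambda>p. exp (ell e p / (4 * real CARD('n))))"
      by (intro continuous_intros continuous_on_ell) auto
    then have "continuous_on (- {0}) (hnorm e)"
      by (rule continuous_on_eq) (simp add: hnorm_eq_exp_ell)
    then show ?thesis
      using False continuous_on_eq_continuous_at[of "- {0}" "hnorm e"] by auto
  next
    case True
    have "((\<lambda>p. sqrt (2 * hgauge e p)) \<longlongrightarrow> sqrt (2 * hgauge e 0)) (at 0)"
    proof -
      have "continuous_on UNIV (\<lambda>p. sqrt (2 * hgauge e p))" by (intro continuous_intros)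
      then show ?thesis using continuous_on_def by blast
    qed
    then have "((\<lambda>p. hnorm e p) \<longlongrightarrow> 0) (at 0)"
      by (intro Lim_null_comparison[of "hnorm e" "\<lambda>p. sqrt (2 * hgauge e p)"] always_eventually)
        (auto intro!: real_le_rsqrt simp: hnorm_nonneg hnorm_power2_bounds)
    then show ?thesis using True by (simp add: isCont_def)
  qed
  then show ?thesis by (simp add: continuous_at_imp_continuous_on)
qed

section \<open>Descent near the centre\<close>

text \<open>
  When \<open>t\<close> is kept, raising \<open>B\<close> to \<open>B'\<close> raises \<open>D\<close> only by \<open>(B' - B) (B' + B) / (2 D)\<close>, which is small compared
  with \<open>B' - B\<close> because \<open>B'\<close> is small compared with \<open>D\<close>. So the denominator \<open>B + D\<close> wins over the numerator.
\<close>
lemma ell_decrease_aux: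
  fixes m B B' S D t t' :: real
  assumes m: "m \<ge> 1" and S: "S \<ge> 0" and B: "B \<ge> 0" "B' \<ge> B"
    and D: "D > 0" "D\<^sup>2 = B\<^sup>2 + t\<^sup>2" and D': "D' > 0" "D'\<^sup>2 = B'\<^sup>2 + t'\<^sup>2"
    and t: "\<bar>t'\<bar> \<le> \<bar>t\<bar>"
    and small: "8 * (2 * m + 1) * B \<le> D" "8 * (2 * m + 1) * B' \<le> 3 * D"
  shows "2 * ln D' + (2 * m - 1) * ln (S + D') - ln (B' + D')
    \<le> 2 * ln D + (2 * m - 1) * ln (S + D) - ln (B + D) - (B' - B) / (4 * D)"
proof -
  \<comment> \<open>the value of \<open>D\<close> after raising \<open>B\<close> but before lowering \<open>t\<close>\<close>
  define H where "H = sqrt (B'\<^sup>2 + t\<^sup>2)"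
  have H2: "H\<^sup>2 = B'\<^sup>2 + t\<^sup>2" by (simp add: H_def)
  have H0: "H \<ge> 0" by (simp add: H_def)
  have "t'\<^sup>2 \<le> t\<^sup>2" using t by (simp add: abs_le_square_iff)
  then have "D'\<^sup>2 \<le> H\<^sup>2" using D'(2) H2 by simp
  then have HD': "D' \<le> H" using H0 by (rule power2_le_imp_le)
  have "B\<^sup>2 \<le> B'\<^sup>2" using B by (simp add: power_mono)
  then have "D\<^sup>2 \<le> H\<^sup>2" using D(2) H2 by simp
  then have HD: "D \<le> H" using H0 by (rule power2_le_imp_le)
  have H: "H > 0" using HD D(1) by linarith
  have ln_le: "ln a - ln b \<le> (a - b) / b" if "a > 0" "b > 0" for a b :: real
  proof -
    have "ln (a / b) \<le> a / b - 1" using that by (intro ln_le_minus_one) auto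
    then show ?thesis using that by (simp add: ln_div diff_divide_distrib)
  qed
  \<comment> \<open>with the first layer fixed, decreasing the last coordinate decreases the expression\<close>
  have 1: "2 * ln D' + (2 * m - 1) * ln (S + D') - ln (B' + D')
      \<le> 2 * ln H + (2 * m - 1) * ln (S + H) - ln (B' + H)"
  proof -
    have "(B' + H) / (B' + D') \<le> H / D'"
      using HD' D'(1) B by (simp add: divide_simps) (simp add: algebra_simps mult_left_mono)
    then have "ln ((B' + H) / (B' + D')) \<le> ln (H / D')"
      using HD' D'(1) B H by (subst ln_le_cancel_iff) (auto intro!: divide_pos_pos)
    then have "ln (B' + H) - ln (B' + D') \<le> ln H - ln D'"
      using D'(1) B H by (simp add: ln_div)
    moreover have "ln D' \<le> ln H" using HD' D'(1) H by simp
    moreover have "(2 * m - 1) * ln (S + D') \<le> (2 * m - 1) * ln (S + H)"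
      using HD' D'(1) H S m by (intro mult_left_mono) auto
    ultimately show ?thesis by linarith
  qed
  have gap: "H - D \<le> (B' - B) * (B' + B) / (2 * D)"
  proof -
    have "(H - D) * (2 * D) \<le> (H - D) * (H + D)"
      using HD by (intro mult_left_mono) auto
    also have "\<dots> = H\<^sup>2 - D\<^sup>2" by (simp add: power2_eq_square algebra_simps)
    also have "\<dots> = (B' - B) * (B' + B)" using H2 D(2) by (simp add: power2_eq_square algebra_simps)
    finally show ?thesis using D(1) by (simp add: field_simps)
  qed
  define \<gamma> where "\<gamma> = (H - D) / D"
  have "\<gamma> \<ge> 0" using HD D(1) by (simp add: \<gamma>_def)
  have 2: "ln H - ln D \<le> \<gamma>"
    unfolding \<gamma>_def using H D(1) by (rule ln_le)
  have 3: "ln (S + H) - ln (S + D) \<le> \<gamma>"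
  proof -
    have "ln (S + H) - ln (S + D) \<le> ((S + H) - (S + D)) / (S + D)"
      using S H D(1) by (intro ln_le) auto
    also have "\<dots> \<le> \<gamma>"
      unfolding \<gamma>_def using S HD D(1) by (auto intro!: divide_left_mono)
    finally show ?thesis .
  qed
  have "B' \<le> D"
  proof -
    have "8 * B' \<le> 8 * (2 * m + 1) * B'" using B m by (intro mult_right_mono) auto
    then show ?thesis using small(2) B D(1) by linarith
  qed
  have 4: "ln (B + D) - ln (B' + H) \<le> - (B' - B) / (2 * D)"
  proof -
    have "ln (B + D) - ln (B' + H) \<le> ln (B + D) - ln (B' + D)"
      using HD B D(1) by simp
    also have "\<dots> \<le> ((B + D) - (B' + D)) / (B' + D)"
      using B D(1) by (intro ln_le) auto
    also have "\<dots> = - ((B' - B) / (B' + D))" by (simp add: minus_divide_left)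
    finally have "ln (B + D) - ln (B' + H) \<le> - ((B' - B) / (B' + D))" .
    moreover have "(B' - B) / (2 * D) \<le> (B' - B) / (B' + D)"
      using B D(1) \<open>B' \<le> D\<close> by (intro divide_left_mono) auto
    ultimately show ?thesis by (simp only: minus_divide_left[symmetric])
  qed
  have "(2 * m + 1) * \<gamma> \<le> (B' - B) / (4 * D)"
  proof -
    have "(2 * m + 1) * \<gamma> \<le> (2 * m + 1) * ((B' - B) * (B' + B) / (2 * D) / D)"
      unfolding \<gamma>_def using gap D(1) m by (intro mult_left_mono divide_right_mono) auto
    also have "\<dots> = (B' - B) * ((2 * m + 1) * (B' + B)) / (2 * D * D)"
      by (simp add: field_simps)
    also have "\<dots> \<le> (B' - B) * (D / 2) / (2 * D * D)"
      using small B D(1) by (intro divide_right_mono mult_left_mono) (auto simp: algebra_simps)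
    also have "\<dots> = (B' - B) / (4 * D)"
      using D(1) by (simp add: field_simps)
    finally show ?thesis .
  qed
  moreover have "(2 * m - 1) * (ln (S + H) - ln (S + D)) \<le> (2 * m - 1) * \<gamma>"
    using 3 m by (intro mult_left_mono) auto
  moreover have "- (B' - B) / (2 * D) = - (2 * ((B' - B) / (4 * D)))"
    using D(1) by (simp add: field_simps)
  moreover have "(2 * m - 1) * \<gamma> + 2 * \<gamma> = (2 * m + 1) * \<gamma>"
    by (simp add: algebra_simps)
  ultimately show ?thesis
    using 1 2 4 right_diff_distrib[of "2 * m - 1" "ln (S + H)" "ln (S + D)"] by linarith
qed

text \<open>
  Among the four unit vectors of a coordinate plane one points outwards from \<open>(a, b)\<close> and at the same
  time pushes \<open>t\<close> towards \<open>0\<close>.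
\<close>
lemma quarter_turn_choice:
  fixes t a b :: real
  obtains c d where "(c, d) \<in> {(1, 0), (-1, 0), (0, 1), (0, -1)}"
    "a * c + b * d \<ge> 0" "t * (a * d - c * b) \<le> 0"
proof (cases "t \<ge> 0")
  case t: True
  show ?thesis
  proof (cases "a \<ge> 0")
    case True
    with t that[of 1 0] that[of 0 "-1"] show ?thesis
      by (cases "b \<ge> 0") (auto simp: mult_nonneg_nonneg mult_nonneg_nonpos)
  next
    case False
    with t that[of "-1" 0] that[of 0 1] show ?thesis
      by (cases "b \<ge> 0") (auto simp: mult_nonneg_nonneg mult_nonneg_nonpos)
  qed
next
  case t: False
  show ?thesis
  proof (cases "a \<ge> 0")
    case True
    with t that[of 0 1] that[of 1 0] show ?thesis
      by (cases "b \<ge> 0") (auto simp: mult_nonpos_nonneg mult_nonpos_nonpos)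
  next
    case False
    with t that[of "-1" 0] that[of 0 "-1"] show ?thesis
      by (cases "b \<ge> 0") (auto simp: mult_nonpos_nonneg mult_nonpos_nonpos)
  qed
qed

definition pair_vec :: "'n::finite \<Rightarrow> real \<Rightarrow> real \<Rightarrow> real ^ ('n + 'n)" where
  "pair_vec i c d = c *\<^sub>R axis (Inl i) 1 + d *\<^sub>R axis (Inr i) 1"

lemma pair_vec_nth [simp]:
  "pair_vec i c d $ Inl k = (if k = i then c else 0)" "pair_vec i c d $ Inr k = (if k = i then d else 0)"
  by (auto simp: pair_vec_def axis_def)

lemma forms_pair_vec:
  assumes "i \<noteq> e"
  shows "formB e (pair_vec i c d) = (c\<^sup>2 + d\<^sup>2) / 2" "formS e (pair_vec i c d) = 0"
    "bilB e x (pair_vec i c d) = x $ Inl i * c + x $ Inr i * d" "bilS e x (pair_vec i c d) = 0"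
    "omega e x (pair_vec i c d) = x $ Inl i * d - c * x $ Inr i"
proof -
  have "formB e (pair_vec i c d) = 1 / 2 * (\<Sum>k\<in>UNIV. if k = i then coef e i * (c\<^sup>2 + d\<^sup>2) else 0)"
    unfolding formB_eq by (intro arg_cong2[where f = "(*)"] sum.cong) auto
  then show "formB e (pair_vec i c d) = (c\<^sup>2 + d\<^sup>2) / 2"
    using assms by (simp add: coef_def)
  have "bilB e x (pair_vec i c d) = (\<Sum>k\<in>UNIV. if k = i then coef e i * (x $ Inl i * c + x $ Inr i * d) else 0)"
    unfolding bilB_def by (intro sum.cong) auto
  then show "bilB e x (pair_vec i c d) = x $ Inl i * c + x $ Inr i * d"
    using assms by (simp add: coef_def)
  have "omega e x (pair_vec i c d) = (\<Sum>k\<in>UNIV. if k = i then coef e i * (x $ Inl i * d - c * x $ Inr i) else 0)"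
    unfolding omega_def by (intro sum.cong) auto
  then show "omega e x (pair_vec i c d) = x $ Inl i * d - c * x $ Inr i"
    using assms by (simp add: coef_def)
qed (use assms in \<open>simp_all add: formS_def bilS_def\<close>)

lemma component_le_formB:
  assumes "i \<noteq> e"
  shows "(x $ Inl i)\<^sup>2 + (x $ Inr i)\<^sup>2 \<le> 2 * formB e x"
proof -
  have "coef e i * ((x $ Inl i)\<^sup>2 + (x $ Inr i)\<^sup>2) \<le> (\<Sum>k\<in>UNIV. coef e k * ((x $ Inl k)\<^sup>2 + (x $ Inr k)\<^sup>2))"
    by (intro member_le_sum) (auto simp: coef_def)
  then show ?thesis using assms by (simp add: formB_eq coef_def)
qed

text \<open>
  Near the centre one moves outwards in a plane on which \<open>S\<close> is constant, choosing the direction so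
  that \<open>t\<close> shrinks as well. Then \<open>B\<close> grows at least by \<open>s\<^sup>2 / 2\<close>, whatever the starting point.
\<close>
lemma outward_move:
  fixes e i :: "'n::finite"
  assumes i: "i \<noteq> e"
    and B: "8 * (2 * real CARD('n) + 1) * formB e (fst p) \<le> hgauge e p"
    and D: "8 * (2 * real CARD('n) + 1) \<le> hgauge e p"
  shows "\<exists>v\<in>{pair_vec i 1 0, pair_vec i (-1) 0, pair_vec i 0 1, pair_vec i 0 (-1)}.
    \<forall>s\<in>{0..1}. ell e (hline e v s p) \<le> ell e p - s\<^sup>2 / (8 * hgauge e p)"
proof -
  let ?n = "real CARD('n)"
  obtain x t where p: "p = (x, t)" by (cases p)
  define a b where "a = x $ Inl i" and "b = x $ Inr i"
  obtain c d where cd: "(c, d) \<in> {(1, 0), (-1, 0), (0, 1), (0, -1)}"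
    "a * c + b * d \<ge> 0" "t * (a * d - c * b) \<le> 0"
    by (rule quarter_turn_choice[of a b t])
  have sq: "c\<^sup>2 + d\<^sup>2 = 1" using cd(1) by auto
  define v where "v = pair_vec i c d"
  define \<omega> where "\<omega> = a * d - c * b"
  define Bp Dp where "Bp = formB e x" and "Dp = hgauge e p"
  have Dp: "Dp > 0" "Dp\<^sup>2 = Bp\<^sup>2 + t\<^sup>2"
    using D hgauge_power2[of e p] one_le_real_card[where 'a = 'n] by (auto simp: Dp_def Bp_def p)
  have Bp: "Bp \<ge> 0" by (simp add: Bp_def formB_nonneg)
  have ab: "a\<^sup>2 + b\<^sup>2 \<le> 2 * Bp"
    using component_le_formB[OF i, of x] by (simp add: a_def b_def Bp_def)
  have small: "8 * (2 * ?n + 1) * Bp \<le> Dp" "8 * (2 * ?n + 1) \<le> Dp"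
    using B D by (simp_all add: Bp_def Dp_def p)
  have n: "?n \<ge> 1" by (rule one_le_real_card)
  have main: "ell e (hline e v s p) \<le> ell e p - s\<^sup>2 / (8 * hgauge e p)" if s: "s \<in> {0..1}" for s
  proof (cases "s = 0")
    case True
    then show ?thesis by simp
  next
    case False
    define B' t' where "B' = Bp + s * (a * c + b * d) + s\<^sup>2 / 2" and "t' = t + s * \<omega>"
    have hm: "hline e v s p = (x + s *\<^sub>R v, t')"
      by (simp add: p hmove_Pair omega_simps v_def forms_pair_vec[OF i] t'_def \<omega>_def a_def b_def)
    have fB: "formB e (x + s *\<^sub>R v) = B'"
      by (simp add: formB_move v_def forms_pair_vec[OF i] sq B'_def Bp_def a_def b_def)
    have fS: "formS e (x + s *\<^sub>R v) = formS e x"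
      by (simp add: formS_move v_def forms_pair_vec[OF i])
    define D' where "D' = hgauge e (hline e v s p)"
    have D'2: "D'\<^sup>2 = B'\<^sup>2 + t'\<^sup>2"
      using hgauge_power2[of e "hline e v s p"] by (simp add: D'_def hm fB)
    have scd: "0 \<le> s * (a * c + b * d)" using cd(2) s by simp
    have B'ge: "B' - Bp \<ge> s\<^sup>2 / 2" using scd by (simp add: B'_def)
    then have "B' > 0" using Bp False by (smt (verit) zero_less_power2 half_gt_zero)
    moreover have "B' \<le> D'"
      using formB_le_hgauge[of e "hline e v s p"] by (simp add: D'_def hm fB)
    ultimately have D'0: "D' > 0" by linarith
    have ac: "\<bar>a\<bar> \<le> sqrt (2 * Bp)" "\<bar>b\<bar> \<le> sqrt (2 * Bp)"
      using ab by (auto intro!: real_le_rsqrt simp: sum_power2_ge_zero)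
        (smt (verit) zero_le_power2)+
    have s2: "s\<^sup>2 \<le> 1" using s by (simp add: power_le_one)
    have "B' \<le> 2 * Bp + 1"
    proof -
      have "a * c + b * d \<le> Bp + 1 / 2"
      proof -
        have "2 * (a * c + b * d) \<le> a\<^sup>2 + b\<^sup>2 + (c\<^sup>2 + d\<^sup>2)"
          using sum_squares_ge_zero[of "a - c" "b - d"] by (simp add: power2_eq_square algebra_simps)
        then show ?thesis using ab sq by simp
      qed
      then have "s * (a * c + b * d) \<le> 1 * (Bp + 1 / 2)"
        using s cd(2) Bp by (intro mult_mono) auto
      then show ?thesis using s2 by (simp add: B'_def)
    qed
    then have B'small: "8 * (2 * ?n + 1) * B' \<le> 3 * Dp"
    proof -
      have "8 * (2 * ?n + 1) * B' \<le> 8 * (2 * ?n + 1) * (2 * Bp + 1)"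
        using \<open>B' \<le> 2 * Bp + 1\<close> n by (intro mult_left_mono) auto
      also have "\<dots> \<le> 3 * Dp" using small by (simp add: algebra_simps)
      finally show ?thesis .
    qed
    have "\<bar>t'\<bar> \<le> \<bar>t\<bar>"
    proof -
      have "24 * Bp \<le> 8 * (2 * ?n + 1) * Bp" using n Bp by (intro mult_right_mono) auto
      then have DB: "24 * Bp \<le> Dp" using small(1) by linarith
      have "24 \<le> 8 * (2 * m + 1)" if "m \<ge> 1" for m :: real using that by simp
      from this[OF n] have "24 \<le> 8 * (2 * ?n + 1)" .
      then have DB': "24 \<le> Dp" using small(2) by linarith
      have "\<bar>s * \<omega>\<bar> \<le> sqrt (2 * Bp)"
      proof -
        have "\<bar>\<omega>\<bar> \<le> sqrt (2 * Bp)" using cd(1) ac by (auto simp: \<omega>_def)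
        moreover have "\<bar>s * \<omega>\<bar> \<le> 1 * \<bar>\<omega>\<bar>" using s by (simp add: abs_mult mult_left_le_one_le)
        ultimately show ?thesis by simp
      qed
      moreover have "sqrt (2 * Bp) \<le> \<bar>t\<bar>"
      proof -
        have "2 * Bp \<le> t\<^sup>2"
        proof -
          have "24 * Bp * (24 * Bp) \<le> Dp * Dp" using DB Bp by (intro mult_mono) auto
          moreover have "24 * Dp \<le> Dp * Dp" using DB' Dp by (intro mult_right_mono) auto
          ultimately show ?thesis using Dp(2) DB Bp by (simp add: power2_eq_square)
        qed
        then show ?thesis using real_sqrt_le_mono by fastforce
      qed
      moreover have "t * (s * \<omega>) \<le> 0"
        using cd(3) s by (simp add: \<omega>_def mult.left_commute mult_nonneg_nonpos)
      moreover have "\<bar>t + a\<bar> \<le> \<bar>t\<bar>" if "\<bar>a\<bar> \<le> \<bar>t\<bar>" "t * a \<le> 0" for a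
        using that by (auto simp: mult_le_0_iff abs_if split: if_splits)
      ultimately show ?thesis
        unfolding t'_def by (meson order_trans)
    qed
    moreover have "Bp \<le> B'" using B'ge zero_le_power2[of s] by linarith
    moreover have "ell e (hline e v s p) = 2 * ln D' + (2 * ?n - 1) * ln (formS e x + D') - ln (B' + D')"
      unfolding ell_def D'_def[symmetric] by (simp add: hm fB fS)
    moreover have "ell e p = 2 * ln Dp + (2 * ?n - 1) * ln (formS e x + Dp) - ln (Bp + Dp)"
      unfolding ell_def Dp_def[symmetric] by (simp add: p Bp_def)
    ultimately have "ell e (hline e v s p) \<le> ell e p - (B' - Bp) / (4 * Dp)"
      using ell_decrease_aux[OF n formS_nonneg Bp _ Dp D'0 D'2 _ small(1) B'small, of e x] by simp
    also have "\<dots> \<le> ell e p - s\<^sup>2 / 2 / (4 * Dp)"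
      using B'ge Dp(1) by (intro diff_left_mono divide_right_mono) auto
    finally show ?thesis by (simp add: Dp_def)
  qed
  have "v \<in> {pair_vec i 1 0, pair_vec i (-1) 0, pair_vec i 0 1, pair_vec i 0 (-1)}"
    using cd(1) by (auto simp: v_def)
  then show ?thesis using main by blast
qed

section \<open>Descent away from the centre\<close>

text \<open>
  The derivative of \<open>ell\<close> in the horizontal direction \<open>v\<close>.
\<close>
definition ell' :: "'n::finite \<Rightarrow> real ^ ('n + 'n) \<Rightarrow> 'n heis \<Rightarrow> real" where
  "ell' e v p = (let B = formB e (fst p); S = formS e (fst p); D = hgauge e p;
     B' = bilB e (fst p) v; S' = bilS e (fst p) v; D' = (B * B' + snd p * omega e (fst p) v) / D
   in 2 * D' / D + (2 * real CARD('n) - 1) * (S' + D') / (S + D) - (B' + D') / (B + D))"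

lemma bilB_move: "bilB e (x + s *\<^sub>R v) v = bilB e x v + 2 * s * formB e v"
proof -
  have "bilB e (x + s *\<^sub>R v) v = (\<Sum>i\<in>UNIV. coef e i * (x $ Inl i * v $ Inl i + x $ Inr i * v $ Inr i)
      + 2 * s * (1 / 2 * (coef e i * ((v $ Inl i)\<^sup>2 + (v $ Inr i)\<^sup>2))))"
    unfolding bilB_def by (intro sum.cong) (auto simp: power2_eq_square algebra_simps)
  then show ?thesis
    unfolding formB_eq bilB_def by (simp only: sum.distrib sum_distrib_left)
qed

lemma bilS_move: "bilS e (x + s *\<^sub>R v) v = bilS e x v + 2 * s * formS e v"
  unfolding bilS_def formS_def by (simp add: power2_eq_square field_simps)

lemma bilB_self: "bilB e x x = 2 * formB e x"
  by (simp add: bilB_def formB_eq power2_eq_square)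

lemma bilS_self: "bilS e x x = 2 * formS e x"
  by (simp add: bilS_def formS_def power2_eq_square)

lemma bil_minus_right: "bilB e x (- v) = - bilB e x v" "bilS e x (- v) = - bilS e x v"
  unfolding bilB_def bilS_def sum_negf[symmetric]
  by (auto intro!: sum.cong simp: algebra_simps)

lemma ell_has_derivative:
  assumes "hline e v s p \<noteq> 0"
  shows "((\<lambda>s. ell e (hline e v s p)) has_real_derivative ell' e v (hline e v s p)) (at s)"
proof -
  obtain x t where p: "p = (x, t)" by (cases p)
  define B where "B s = formB e x + s * bilB e x v + s\<^sup>2 * formB e v" for s
  define S where "S s = formS e x + s * bilS e x v + s\<^sup>2 * formS e v" for s
  define T where "T s = t + s * omega e x v" for s
  define D where "D s = sqrt ((B s)\<^sup>2 + (T s)\<^sup>2)" for s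
  define B' where "B' = bilB e x v + 2 * s * formB e v"
  define S' where "S' = bilS e x v + 2 * s * formS e v"
  have hm: "hline e v s p = (x + s *\<^sub>R v, T s)" for s
    by (simp add: p hmove_Pair omega_simps T_def)
  have D: "hgauge e (hline e v s p) = D s" for s
    by (simp add: hgauge_def hm formB_move D_def B_def)
  have Ds: "D s > 0" using hgauge_pos[OF assms, of e] by (simp add: D)
  have BS: "B s \<ge> 0" "S s \<ge> 0"
    unfolding B_def S_def formB_move[symmetric] formS_move[symmetric] by (rule formB_nonneg formS_nonneg)+
  have sum_pos: "(B s)\<^sup>2 + (T s)\<^sup>2 > 0" using Ds by (simp add: D_def)
  have dB: "(B has_real_derivative B') (at s)"
    unfolding B_def B'_def by (auto intro!: derivative_eq_intros simp: algebra_simps)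
  have dS: "(S has_real_derivative S') (at s)"
    unfolding S_def S'_def by (auto intro!: derivative_eq_intros simp: algebra_simps)
  have dT: "(T has_real_derivative omega e x v) (at s)"
    unfolding T_def by (auto intro!: derivative_eq_intros)
  define D' where "D' = (B s * B' + T s * omega e x v) / D s"
  have dD: "(D has_real_derivative D') (at s)"
  proof -
    have "((\<lambda>s. (B s)\<^sup>2 + (T s)\<^sup>2) has_real_derivative 2 * B s * B' + 2 * T s * omega e x v) (at s)"
      by (auto intro!: derivative_eq_intros dB dT)
    from DERIV_chain2[OF DERIV_real_sqrt[OF sum_pos] this]
    have "(D has_real_derivative inverse (D s) / 2 * (2 * B s * B' + 2 * T s * omega e x v)) (at s)"
      unfolding D_def .
    moreover have "inverse q / 2 * (2 * a * a' + 2 * b * b') = (a * a' + b * b') / q" for q a a' b b' :: real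
      by (cases "q = 0") (simp_all add: field_simps)
    ultimately show ?thesis by (simp only: D'_def)
  qed
  have "((\<lambda>s. 2 * ln (D s) + (2 * real CARD('a) - 1) * ln (S s + D s) - ln (B s + D s)) has_real_derivative
      2 * D' / D s + (2 * real CARD('a) - 1) * (S' + D') / (S s + D s) - (B' + D') / (B s + D s)) (at s)"
  proof -
    have dln: "((\<lambda>s. ln (h s)) has_real_derivative h' / h s) (at s)"
      if "(h has_real_derivative h') (at s)" "h s > 0" for h h'
      using DERIV_chain2[OF DERIV_ln_divide[OF that(2)] that(1)] by simp
    have "((\<lambda>s. ln (S s + D s)) has_real_derivative (S' + D') / (S s + D s)) (at s)"
      "((\<lambda>s. ln (B s + D s)) has_real_derivative (B' + D') / (B s + D s)) (at s)"
      using dln[OF DERIV_add[OF dS dD]] dln[OF DERIV_add[OF dB dD]] Ds BS by simp_all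
    from DERIV_diff[OF DERIV_add[OF DERIV_cmult[OF dln[OF dD Ds], of 2] DERIV_cmult[OF this(1), of "2 * real CARD('a) - 1"]] this(2)]
    show ?thesis by simp
  qed
  moreover have "ell e (hline e v s p) = 2 * ln (D s) + (2 * real CARD('a) - 1) * ln (S s + D s) - ln (B s + D s)" for s
    by (simp add: ell_def D) (simp add: hm formB_move formS_move B_def S_def)
  moreover have "ell' e v (hline e v s p)
      = 2 * D' / D s + (2 * real CARD('a) - 1) * (S' + D') / (S s + D s) - (B' + D') / (B s + D s)"
    unfolding ell'_def Let_def D
    by (simp add: hm formB_move formS_move bilB_move bilS_move omega_simps D'_def B'_def S'_def B_def[symmetric] S_def[symmetric])
  ultimately show ?thesis by simp
qed

lemma continuous_on_ell': "continuous_on (- {0}) (ell' e v)"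
proof -
  have "hgauge e p > 0" "formS e (fst p) + hgauge e p > 0" "formB e (fst p) + hgauge e p > 0" if "p \<noteq> 0" for p
    using hgauge_pos[OF that, of e] formS_nonneg[of e "fst p"] formB_nonneg[of e "fst p"] by linarith+
  then show ?thesis
    unfolding ell'_def Let_def by (intro continuous_intros) (auto simp: less_imp_neq[symmetric])
qed

abbreviation descends :: "'n::finite \<Rightarrow> real ^ ('n + 'n) \<Rightarrow> real \<Rightarrow> real \<Rightarrow> 'n heis \<Rightarrow> bool" where
  "descends e v s d p \<equiv> hline e v s p \<noteq> 0 \<and> ell e (hline e v s p) \<le> ell e p - d"

text \<open>
  For \<open>t \<noteq> 0\<close> the rotation \<open>J\<close>, oriented by the sign of \<open>t\<close>, leaves \<open>B\<close> and \<open>S\<close> stationary and decreases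
  \<open>|t|\<close>; \<open>ell\<close> is increasing in \<open>D\<close>. For \<open>t = 0\<close> moving towards the centre does not change \<open>t\<close> to first
  order, and \<open>ell\<close> decreases by homogeneity.
\<close>
lemma ell'_negative:
  fixes e :: "'n::finite"
  assumes "formB e (fst p) > 0"
  shows "\<exists>v. ell' e v p < 0"
proof -
  obtain x t where p: "p = (x, t)" by (cases p)
  define B S D where "B = formB e x" and "S = formS e x" and "D = hgauge e p"
  have B: "B > 0" using assms by (simp add: B_def p)
  have S: "S \<ge> 0" by (simp add: S_def formS_nonneg)
  have D: "D > 0" "D\<^sup>2 = B\<^sup>2 + t\<^sup>2"
    using formB_le_hgauge[of e p] hgauge_power2[of e p] B by (simp_all add: D_def B_def p)
  have n: "2 * real CARD('n) - 1 \<ge> 1"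
    using one_le_real_card[where 'a = 'n] by simp
  show ?thesis
  proof (cases "t = 0")
    case True
    have "D = B" using D B True by (simp add: power2_eq_iff)
    have b: "bilB e x (- x) = - 2 * B" "bilS e x (- x) = - 2 * S"
      by (simp_all add: bil_minus_right bilB_self bilS_self B_def S_def)
    have "ell' e (- x) p = 2 * (- 2 * B) / B + (2 * real CARD('n) - 1) * (- 2 * S + - 2 * B) / (S + B) - (- 2 * B + - 2 * B) / (B + B)"
      unfolding ell'_def Let_def using True \<open>D = B\<close>
      by (simp add: p[symmetric] D_def[symmetric]) (simp add: p b B_def[symmetric] S_def[symmetric] omega_simps)
    also have "\<dots> = - 4 + (2 * real CARD('n) - 1) * (- 2) + 2"
    proof -
      have "(2 * real CARD('n) - 1) * (- 2 * S + - 2 * B) / (S + B) = (2 * real CARD('n) - 1) * (- 2)"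
        using B S by (simp add: divide_simps) (simp add: algebra_simps)
      then show ?thesis using B by simp
    qed
    also have "\<dots> < 0"
    proof -
      have "- 4 + m * (- 2) + 2 < 0" if "m \<ge> 1" for m :: real using that by simp
      from this[OF n] show ?thesis .
    qed
    finally show ?thesis by blast
  next
    case False
    define J where "J = (\<chi> j. case j of Inl i \<Rightarrow> sgn t * x $ Inr i | Inr i \<Rightarrow> - (sgn t * x $ Inl i))"
    have J: "bilB e x J = 0" "bilS e x J = 0"
      unfolding bilB_def bilS_def by (auto intro!: sum.neutral simp: J_def algebra_simps)
    have \<omega>: "omega e x J = - 2 * sgn t * B"
    proof -
      have "omega e x J = (\<Sum>i\<in>UNIV. - sgn t * (coef e i * ((x $ Inl i)\<^sup>2 + (x $ Inr i)\<^sup>2)))"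
        unfolding omega_def J_def by (intro sum.cong) (auto simp: power2_eq_square algebra_simps)
      then show ?thesis by (simp only: sum_distrib_left[symmetric]) (simp add: B_def formB_eq)
    qed
    have "t * omega e x J = - 2 * \<bar>t\<bar> * B"
      using False by (cases "t > 0") (auto simp: \<omega> sgn_if)
    define D' where "D' = - 2 * \<bar>t\<bar> * B / D"
    have D': "D' < 0" using False B D by (simp add: D'_def field_simps)
    have "ell' e J p = 2 * D' / D + (2 * real CARD('n) - 1) * D' / (S + D) - D' / (B + D)"
      unfolding ell'_def Let_def using \<open>t * omega e x J = _\<close>
      by (simp add: p[symmetric] D_def[symmetric]) (simp add: p J B_def[symmetric] S_def[symmetric] D'_def)
    also have "\<dots> < 0"
    proof -
      have "2 * D' / D < D' / D" using D' D by (simp add: divide_simps)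
      moreover have "D' / D \<le> D' / (B + D)" using D' D B by (simp add: divide_simps mult_le_cancel_left)
      moreover have "(2 * real CARD('n) - 1) * D' / (S + D) \<le> 0"
      proof -
        have "0 \<le> 2 * real CARD('n) - 1" by (rule order_trans[OF _ n]) simp
        then show ?thesis using D' S D by (intro divide_nonpos_pos mult_nonneg_nonpos) auto
      qed
      ultimately show ?thesis by linarith
    qed
    finally show ?thesis by blast
  qed
qed

lemma local_descent:
  fixes e :: "'n::finite"
  assumes "formB e (fst p0) > 0"
  shows "\<exists>v U c s0. open U \<and> p0 \<in> U \<and> c > 0 \<and> s0 > 0 \<and>
    (\<forall>p\<in>U. \<forall>s\<in>{0..s0}. descends e v s (c * s) p)"
proof -
  obtain v where v: "ell' e v p0 < 0" using ell'_negative[OF assms] by blast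
  define c where "c = - ell' e v p0 / 2"
  have c: "c > 0" using v by (simp add: c_def)
  have "p0 \<noteq> 0" using assms by (auto simp: formB_eq)
  have "open (- {0} \<inter> ell' e v -` {..< - c})"
    by (intro continuous_open_preimage continuous_on_ell') auto
  moreover have "- {0} \<inter> ell' e v -` {..< - c} = {p. p \<noteq> 0 \<and> ell' e v p < - c}" by auto
  ultimately have op: "open {p. p \<noteq> 0 \<and> ell' e v p < - c}" by simp
  have "continuous_on UNIV (\<lambda>z::real \<times> 'n heis. hmove e (fst z *\<^sub>R v) (snd z))"
    by (intro continuous_intros)
  then have "open ((\<lambda>z::real \<times> 'n heis. hmove e (fst z *\<^sub>R v) (snd z)) -` {p. p \<noteq> 0 \<and> ell' e v p < - c})"
    using op by (intro open_vimage) auto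
  moreover have "(0, p0) \<in> (\<lambda>z::real \<times> 'n heis. hmove e (fst z *\<^sub>R v) (snd z)) -` {p. p \<noteq> 0 \<and> ell' e v p < - c}"
    using \<open>p0 \<noteq> 0\<close> v by (simp add: c_def)
  ultimately obtain A U where AU: "open A" "open U" "(0, p0) \<in> A \<times> U"
    "A \<times> U \<subseteq> (\<lambda>z::real \<times> 'n heis. hmove e (fst z *\<^sub>R v) (snd z)) -` {p. p \<noteq> 0 \<and> ell' e v p < - c}"
    by (rule open_prod_elim)
  then obtain r where r: "r > 0" "cball 0 r \<subseteq> A"
    using open_contains_cball[of A] by auto
  have "descends e v s (c * s) p"
    if p: "p \<in> U" and s: "s \<in> {0..r}" for p s
  proof -
    have good: "hmove e (u *\<^sub>R v) p \<noteq> 0 \<and> ell' e v (hmove e (u *\<^sub>R v) p) < - c" if "0 \<le> u" "u \<le> s" for u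
    proof -
      have "(u, p) \<in> A \<times> U" using r s p that by (auto simp: subset_iff)
      then show ?thesis using AU(4) by auto
    qed
    have "ell e (hline e v s p) + c * s \<le> ell e (hmove e (0 *\<^sub>R v) p) + c * 0"
    proof (rule DERIV_nonpos_imp_nonincreasing[of 0 s "\<lambda>u. ell e (hmove e (u *\<^sub>R v) p) + c * u"])
      fix u assume u: "0 \<le> u" "u \<le> s"
      have "((\<lambda>u. ell e (hmove e (u *\<^sub>R v) p) + c * u) has_real_derivative ell' e v (hmove e (u *\<^sub>R v) p) + c) (at u)"
        using good[OF u] by (auto intro!: derivative_eq_intros ell_has_derivative)
      moreover have "ell' e v (hmove e (u *\<^sub>R v) p) + c \<le> 0" using good[OF u] by simp
      ultimately show "\<exists>y. ((\<lambda>u. ell e (hmove e (u *\<^sub>R v) p) + c * u) has_real_derivative y) (at u) \<and> y \<le> 0"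
        by blast
    qed (use s in auto)
    then show ?thesis using good[of s] s by simp
  qed
  then show ?thesis using c r(1) AU(2,3) by blast
qed

definition dil :: "real \<Rightarrow> 'n::finite heis \<Rightarrow> 'n heis" where
  "dil r p = (r *\<^sub>R fst p, r\<^sup>2 * snd p)"

lemma hgauge_dil: "hgauge e (dil r p) = r\<^sup>2 * hgauge e p"
proof -
  have "(formB e (fst (dil r p)))\<^sup>2 + (snd (dil r p))\<^sup>2 = (r\<^sup>2 * hgauge e p)\<^sup>2"
    unfolding power_mult_distrib hgauge_power2
    by (simp add: dil_def formB_scaleR power_mult_distrib distrib_left)
  then have "hgauge e (dil r p) = \<bar>r\<^sup>2 * hgauge e p\<bar>"
    unfolding hgauge_def[of e "dil r p"] by (simp only: real_sqrt_abs)
  then show ?thesis by (simp add: hgauge_nonneg)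
qed

lemma ell_dil:
  fixes e :: "'n::finite"
  assumes "r > 0" "p \<noteq> 0"
  shows "ell e (dil r p) = ell e p + 4 * real CARD('n) * ln r"
proof -
  have D: "hgauge e p > 0" using hgauge_pos assms(2) .
  have S: "formS e (fst (dil r p)) + hgauge e (dil r p) = r\<^sup>2 * (formS e (fst p) + hgauge e p)"
    and B: "formB e (fst (dil r p)) + hgauge e (dil r p) = r\<^sup>2 * (formB e (fst p) + hgauge e p)"
    unfolding hgauge_dil by (simp_all add: dil_def formS_scaleR formB_scaleR algebra_simps)
  have ln: "ln (r\<^sup>2 * a) = 2 * ln r + ln a" if "a > 0" for a
    using assms(1) that by (simp add: ln_mult ln_realpow)
  have pos: "formS e (fst p) + hgauge e p > 0" "formB e (fst p) + hgauge e p > 0"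
    using D formS_nonneg[of e "fst p"] formB_nonneg[of e "fst p"] by linarith+
  show ?thesis
    unfolding ell_def S B unfolding hgauge_dil ln[OF D] ln[OF pos(1)] ln[OF pos(2)]
    by (simp add: algebra_simps)
qed

lemma dil_hmove: "dil r (hmove e v p) = hmove e (r *\<^sub>R v) (dil r p)"
  by (cases p) (simp add: dil_def hmove_Pair omega_simps power2_eq_square algebra_simps)

lemma dil_eq_0_iff: "r \<noteq> 0 \<Longrightarrow> dil r p = 0 \<longleftrightarrow> p = 0"
  by (cases p) (simp add: dil_def zero_prod_def)

lemma compact_hgauge_sphere: "compact {p::'n::finite heis. hgauge e p = 1 \<and> b \<le> formB e (fst p)}"
proof -
  have "closed {p::'n heis. hgauge e p = 1 \<and> b \<le> formB e (fst p)}"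
    by (intro closed_Collect_conj closed_Collect_eq closed_Collect_le continuous_intros)
  moreover have "bounded {p::'n heis. hgauge e p = 1 \<and> b \<le> formB e (fst p)}"
  proof (rule boundedI)
    fix p :: "'n heis" assume "p \<in> {p. hgauge e p = 1 \<and> b \<le> formB e (fst p)}"
    then have "(norm p)\<^sup>2 \<le> 3\<^sup>2" using norm_le_hgauge[of p e] by simp
    then show "norm p \<le> 3" by (rule power2_le_imp_le) simp
  qed
  ultimately show ?thesis by (simp add: compact_eq_bounded_closed)
qed

text \<open>
  Dilations reduce the claim to \<open>D = 1\<close>, where \<open>B \<ge> b\<close> describes a compact set; finitely many of the local
  directions suffice. A unit move from a point with \<open>D = 1 / r\<^sup>2\<close> becomes a move of length \<open>r\<close>, which is
  admissible once \<open>r\<close> is below the smallest of the local times.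
\<close>
lemma inner_descent:
  fixes e :: "'n::finite"
  assumes b: "b > 0"
  shows "\<exists>V c R. finite V \<and> c > 0 \<and> R \<ge> 1 \<and> (\<forall>p. hgauge e p \<ge> R \<longrightarrow> b * hgauge e p \<le> formB e (fst p) \<longrightarrow>
    (\<exists>v\<in>V. \<forall>s\<in>{0..1}. descends e v s (c * s / hgauge e p) p))"
proof -
  define K where "K = {p::'n heis. hgauge e p = 1 \<and> b \<le> formB e (fst p)}"
  have "\<exists>v U c s0. open U \<and> p0 \<in> U \<and> c > 0 \<and> s0 > 0 \<and>
    (\<forall>p\<in>U. \<forall>s\<in>{0..s0}. descends e v s (c * s) p)" if "p0 \<in> K" for p0
    using local_descent[of e p0] b that by (auto simp: K_def)
  then obtain v U c s0 where *: "\<And>p0. p0 \<in> K \<Longrightarrow> open (U p0) \<and> p0 \<in> U p0 \<and> c p0 > (0::real) \<and> s0 p0 > (0::real) \<and>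
    (\<forall>p\<in>U p0. \<forall>s\<in>{0..s0 p0}. descends e (v p0) s (c p0 * s) p)"
    by metis
  have "compact K" unfolding K_def by (rule compact_hgauge_sphere)
  then obtain F where F: "F \<subseteq> K" "finite F" "K \<subseteq> (\<Union>p0\<in>F. U p0)"
    by (rule compactE_image[of K K U]) (use * in auto)
  define C where "C = Min (insert 1 (c ` F))"
  define s1 where "s1 = Min (insert 1 (s0 ` F))"
  have C: "C > 0" "\<And>p0. p0 \<in> F \<Longrightarrow> C \<le> c p0" and s1: "s1 > 0" "s1 \<le> 1" "\<And>p0. p0 \<in> F \<Longrightarrow> s1 \<le> s0 p0"
    using F * by (auto simp: C_def s1_def)
  define R where "R = 1 / s1\<^sup>2"
  have R: "R \<ge> 1" using s1 by (simp add: R_def power_le_one)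
  have "\<exists>w\<in>v ` F. \<forall>s\<in>{0..1}. descends e w s (C * s / hgauge e p) p"
    if p: "hgauge e p \<ge> R" "b * hgauge e p \<le> formB e (fst p)" for p
  proof -
    define D where "D = hgauge e p"
    have D: "D \<ge> 1" "D \<ge> R" using p R by (simp_all add: D_def)
    then have p0: "p \<noteq> 0" by (auto simp: D_def)
    define r where "r = 1 / sqrt D"
    have r: "r > 0" "r\<^sup>2 = 1 / D" "r \<le> s1"
    proof -
      show "r > 0" "r\<^sup>2 = 1 / D" using D by (simp_all add: r_def power_divide)
      have "r\<^sup>2 \<le> s1\<^sup>2"
        using D(2) D(1) s1(1) by (simp add: \<open>r\<^sup>2 = 1 / D\<close> R_def field_simps)
      then show "r \<le> s1" by (rule power2_le_imp_le) (use s1(1) in simp)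
    qed
    have "dil r p \<in> K"
    proof -
      have "r\<^sup>2 * D = 1" using r(2) D(1) by simp
      moreover have "r\<^sup>2 * (b * D) \<le> r\<^sup>2 * formB e (fst p)"
        using p(2) by (intro mult_left_mono) (auto simp: D_def)
      ultimately have "b \<le> r\<^sup>2 * formB e (fst p)" by (simp add: mult.left_commute[of _ b])
      with \<open>r\<^sup>2 * D = 1\<close> show ?thesis
        unfolding K_def mem_Collect_eq hgauge_dil D_def[symmetric] by (simp add: dil_def formB_scaleR)
    qed
    then obtain q where q: "q \<in> F" "dil r p \<in> U q" using F(3) by auto
    have "descends e (v q) s (C * s / D) p"
      if s: "s \<in> {0..1}" for s
    proof -
      have "r * s \<le> r * 1" using s r(1) by (intro mult_left_mono) auto
      then have "r * s \<le> s0 q" using r(3) s1(3)[OF q(1)] by linarith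
      then have rs: "r * s \<in> {0..s0 q}" using s r(1) by auto
      have "dil r (hmove e (s *\<^sub>R v q) p) = hmove e ((r * s) *\<^sub>R v q) (dil r p)"
        by (simp add: dil_hmove)
      then have d: "dil r (hmove e (s *\<^sub>R v q) p) \<noteq> 0"
        "ell e (dil r (hmove e (s *\<^sub>R v q) p)) \<le> ell e (dil r p) - c q * (r * s)"
        using *[of q] F(1) q rs by auto
      then have nz: "hmove e (s *\<^sub>R v q) p \<noteq> 0"
        using r(1) by (simp add: dil_eq_0_iff)
      with d(2) have "ell e (hmove e (s *\<^sub>R v q) p) \<le> ell e p - c q * (r * s)"
        using p0 r(1) by (simp add: ell_dil)
      also have "\<dots> \<le> ell e p - C * (1 / D * s)"
      proof -
        have "1 / D \<le> r" unfolding r_def using D(1) by (simp add: field_simps real_le_lsqrt power2_eq_square)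
        then have "C * (1 / D * s) \<le> c q * (r * s)"
          using C(1) C(2)[OF q(1)] s D(1) r(1) by (intro mult_mono) auto
        then show ?thesis by simp
      qed
      finally show ?thesis using nz by simp
    qed
    then show ?thesis using q(1) by (intro bexI[of _ "v q"]) (auto simp: D_def)
  qed
  then show ?thesis using F(2) C(1) R by (intro exI[of _ "v ` F"] exI[of _ C] exI[of _ R]) auto
qed

section \<open>Descent of the norm and growth of the weight\<close>

text \<open>
  The two regions are joined with the weaker rate \<open>s\<^sup>2 / D\<close>: quadratic in \<open>s\<close> near the centre, and of
  order \<open>1 / D\<close> instead of \<open>1 / \<surd>D\<close> away from it. The rate for \<open>s < 1\<close> only shows that \<open>N\<close> does not increase on
  the way.
\<close>
lemma descent:
  fixes e :: "'n::finite"
  assumes "CARD('n) \<ge> 2"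
  shows "\<exists>V c R. finite V \<and> c > 0 \<and> R > 0 \<and> (\<forall>p. hgauge e p \<ge> R \<longrightarrow>
    (\<exists>v\<in>V. \<forall>s\<in>{0..1}. hnorm e (hline e v s p) \<le> hnorm e p * exp (- (c * s\<^sup>2 / hgauge e p))))"
proof -
  let ?n = "real CARD('n)"
  have n: "?n \<ge> 1" by (rule one_le_real_card)
  obtain i :: 'n where i: "i \<noteq> e"
  proof -
    have "\<not> (UNIV :: 'n set) \<subseteq> {e}"
      using assms card_mono[of "{e}" "UNIV :: 'n set"] by auto
    then show ?thesis using that by auto
  qed
  \<comment> \<open>the two regions meet along \<open>B = D / \<kappa>\<close>\<close>
  define \<kappa> where "\<kappa> = 8 * (2 * ?n + 1)"
  have \<kappa>: "\<kappa> > 0" using n by (simp add: \<kappa>_def add_pos_nonneg)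
  have "1 / \<kappa> > 0" using \<kappa> by simp
  from inner_descent[OF this, of e] obtain V c R where V: "finite V" "c > 0" "R \<ge> 1"
    "\<And>p. hgauge e p \<ge> R \<Longrightarrow> 1 / \<kappa> * hgauge e p \<le> formB e (fst p) \<Longrightarrow>
      \<exists>v\<in>V. \<forall>s\<in>{0..1}. descends e v s (c * s / hgauge e p) p"
    by blast
  define W where "W = {pair_vec i 1 0, pair_vec i (-1) 0, pair_vec i 0 1, pair_vec i 0 (-1)}"
  define d where "d = min c (1 / 8)"
  have d: "d > 0" "d \<le> c" "d \<le> 1 / 8" using V(2) by (auto simp: d_def)
  have ex: "\<exists>v\<in>V \<union> W. \<forall>s\<in>{0..1}. ell e (hline e v s p) \<le> ell e p - d * s\<^sup>2 / hgauge e p"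
    if p: "hgauge e p \<ge> max R \<kappa>" for p
  proof (cases "1 / \<kappa> * hgauge e p \<le> formB e (fst p)")
    case True
    then obtain v where v: "v \<in> V" "\<forall>s\<in>{0..1}. descends e v s (c * s / hgauge e p) p"
      using V(4)[of p] p by auto
    have "c * s / hgauge e p \<ge> d * s\<^sup>2 / hgauge e p" if "s \<in> {0..1}" for s
    proof (intro divide_right_mono mult_mono)
      show "s\<^sup>2 \<le> s" using that mult_left_le[of s s] by (simp add: power2_eq_square)
    qed (use d that V(2) hgauge_nonneg[of e p] in auto)
    then show ?thesis using v by (intro bexI[of _ v]) (auto intro: order_trans)
  next
    case False
    then have "\<kappa> * formB e (fst p) \<le> hgauge e p" using \<kappa> by (simp add: field_simps)
    then obtain v where v: "v \<in> W" "\<forall>s\<in>{0..1}. ell e (hline e v s p) \<le> ell e p - s\<^sup>2 / (8 * hgauge e p)"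
      using outward_move[OF i, of p] p unfolding \<kappa>_def W_def by auto
    have "d * s\<^sup>2 / hgauge e p \<le> s\<^sup>2 / (8 * hgauge e p)" for s
    proof -
      have "d * s\<^sup>2 / hgauge e p \<le> 1 / 8 * s\<^sup>2 / hgauge e p"
        using d hgauge_nonneg[of e p] by (intro divide_right_mono mult_right_mono) auto
      then show ?thesis by simp
    qed
    then show ?thesis using v by (intro bexI[of _ v]) (auto intro: order_trans diff_left_mono)
  qed
  have "\<exists>v\<in>V \<union> W. \<forall>s\<in>{0..1}. hnorm e (hline e v s p) \<le> hnorm e p * exp (- (d / (4 * ?n) * s\<^sup>2 / hgauge e p))"
    if p: "hgauge e p \<ge> max R \<kappa>" for p
  proof -
    obtain v where v: "v \<in> V \<union> W" "\<forall>s\<in>{0..1}. ell e (hline e v s p) \<le> ell e p - d * s\<^sup>2 / hgauge e p"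
      using ex[OF p] by blast
    have "p \<noteq> 0" using p \<kappa> by auto
    have "hnorm e (hline e v s p) \<le> hnorm e p * exp (- (d / (4 * ?n) * s\<^sup>2 / hgauge e p))"
      if s: "s \<in> {0..1}" for s
    proof (cases "hline e v s p = 0")
      case False
      have "ell e (hline e v s p) / (4 * ?n) \<le> (ell e p - d * s\<^sup>2 / hgauge e p) / (4 * ?n)"
        using v(2) s by (intro divide_right_mono) auto
      also have "\<dots> = ell e p / (4 * ?n) + - (d / (4 * ?n) * s\<^sup>2 / hgauge e p)"
        by (simp add: diff_divide_distrib)
      finally show ?thesis
        unfolding hnorm_eq_exp_ell[OF False] hnorm_eq_exp_ell[OF \<open>p \<noteq> 0\<close>] exp_add[symmetric] by simp
    qed (simp add: hnorm_nonneg)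
    then show ?thesis using v(1) by blast
  qed
  moreover have "finite (V \<union> W)" using V(1) by (simp add: W_def)
  moreover have "d / (4 * ?n) > 0" using d n by simp
  moreover have "max R \<kappa> > 0" using \<kappa> by simp
  ultimately show ?thesis by blast
qed

text \<open>
  Lowering \<open>a\<close> by the factor \<open>exp (- \<epsilon> / a\<^sup>2)\<close> lowers \<open>a powr k\<close> by the fraction \<open>\<epsilon> / (2 a\<^sup>2)\<close> or more, and
  \<open>a powr k / a\<^sup>2 \<ge> 1\<close>.
\<close>
lemma potential_drop:
  fixes a b \<epsilon> k :: real
  assumes k: "k \<ge> 2" and a: "a \<ge> 1" and \<epsilon>: "0 < \<epsilon>" "\<epsilon> \<le> a\<^sup>2" and b: "0 \<le> b" "b \<le> a * exp (- (\<epsilon> / a\<^sup>2))"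
  shows "b powr k * ln (b + 1) + \<epsilon> / 2 * ln (a + 1) \<le> a powr k * ln (a + 1)"
proof -
  define z where "z = \<epsilon> / a\<^sup>2"
  have z: "0 < z" "z \<le> 1" using \<epsilon> a by (simp_all add: z_def)
  have "b \<le> a * exp (- z)" using b by (simp add: z_def)
  also have "\<dots> \<le> a" using a z by simp
  finally have ba: "b \<le> a" .
  have ln: "0 \<le> ln (b + 1)" "ln (b + 1) \<le> ln (a + 1)" using b ba by simp_all
  have "exp (- z) \<le> 1 - z / 2"
  proof -
    have "1 + z \<le> exp z" by simp
    then have "exp (- z) \<le> 1 / (1 + z)" using z by (simp add: exp_minus field_simps)
    also have "\<dots> \<le> 1 - z / 2"
    proof -
      have "1 \<le> (1 - z / 2) * (1 + z)"
        using mult_left_mono[of z 1 z] z by (simp add: algebra_simps)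
      then show ?thesis using z by (simp add: divide_le_eq)
    qed
    finally show ?thesis .
  qed
  have "b powr k \<le> (a * exp (- z)) powr k"
    using b k by (intro powr_mono2) (auto simp: z_def)
  also have "\<dots> = a powr k * exp (- z) powr k"
    using a by (simp add: powr_mult)
  also have "exp (- z) powr k \<le> exp (- z) powr 1"
    using k z by (intro powr_mono') auto
  also have "exp (- z) powr 1 \<le> 1 - z / 2"
    using \<open>exp (- z) \<le> 1 - z / 2\<close> by simp
  finally have "b powr k \<le> a powr k * (1 - z / 2)"
    using a by (simp add: mult_left_mono)
  then have "b powr k * ln (b + 1) \<le> a powr k * (1 - z / 2) * ln (a + 1)"
    using ln z by (intro mult_mono) auto
  moreover have "\<epsilon> / 2 * ln (a + 1) \<le> a powr k * (z / 2) * ln (a + 1)"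
  proof (rule mult_right_mono)
    have "a\<^sup>2 = a powr 2" using a by simp
    also have "\<dots> \<le> a powr k" using a k by (intro powr_mono) auto
    finally have "a\<^sup>2 * (z / 2) \<le> a powr k * (z / 2)" using z by (intro mult_right_mono) auto
    then show "\<epsilon> / 2 \<le> a powr k * (z / 2)" using a by (simp add: z_def)
    show "0 \<le> ln (a + 1)" using a by simp
  qed
  ultimately show ?thesis by (simp add: algebra_simps)
qed

lemma weight_pos: "0 < weight e k p"
  by (simp add: weight_def)

lemma weight_antimono:
  assumes "hnorm e p \<le> hnorm e p'" "k \<ge> 0"
  shows "weight e k p' \<le> weight e k p"
proof -
  have "hnorm e p powr k * ln (hnorm e p + 1) \<le> hnorm e p' powr k * ln (hnorm e p' + 1)"
    using assms hnorm_nonneg[of e p] by (intro mult_mono powr_mono2) auto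
  then show ?thesis by (simp add: weight_def)
qed

lemma continuous_on_weight:
  assumes "k > 0"
  shows "continuous_on UNIV (weight e k)"
proof -
  have "continuous_on UNIV (\<lambda>p. hnorm e p powr k)"
    using assms by (intro continuous_on_powr' continuous_on_hnorm continuous_on_const) (auto simp: hnorm_nonneg)
  moreover have "continuous_on UNIV (\<lambda>p. ln (hnorm e p + 1))"
  proof (intro continuous_intros continuous_on_hnorm ballI)
    show "hnorm e p + 1 \<noteq> 0" for p using hnorm_nonneg[of e p] by linarith
  qed
  ultimately show ?thesis
    unfolding weight_def[abs_def] by (intro continuous_on_exp continuous_on_minus continuous_on_mult)
qed

text \<open>
  The directions do not depend on the factor \<open>\<delta>\<close>; only the radius does. This order of choices is what the
  absorption argument needs, since its \<open>\<delta>\<close> depends on the number of directions.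
\<close>
lemma weight_descent:
  fixes e :: "'n::finite"
  assumes "CARD('n) \<ge> 2" and k: "k \<ge> 2"
  obtains V where "finite V" "\<And>\<delta>. \<delta> > 0 \<Longrightarrow> \<exists>R. \<forall>p. norm p > R \<longrightarrow>
    escapes e V \<delta> (weight e k) p"
proof -
  obtain V c R where V: "finite V" "c > 0" "R > 0"
    "\<And>p. hgauge e p \<ge> R \<Longrightarrow> \<exists>v\<in>V. \<forall>s\<in>{0..1}. hnorm e (hline e v s p) \<le> hnorm e p * exp (- (c * s\<^sup>2 / hgauge e p))"
    using descent[OF assms(1), of e] by blast
  have "\<exists>R. \<forall>p. norm p > R \<longrightarrow>
    escapes e V \<delta> (weight e k) p" if \<delta>: "\<delta> > 0" for \<delta>
  proof -
    define \<epsilon> where "\<epsilon> = c / 2"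
    have \<epsilon>: "\<epsilon> > 0" using V(2) by (simp add: \<epsilon>_def)
    \<comment> \<open>beyond \<open>N = M\<close> the drop \<open>\<epsilon> / 2 * ln (N + 1)\<close> of the exponent exceeds \<open>ln (1 / \<delta>)\<close>\<close>
    define M where "M = max (max 1 \<epsilon>) (exp (2 / \<epsilon> * ln (1 / \<delta>)))"
    define G where "G = max R (2 * M\<^sup>2)"
    have G: "G > 0" "G \<ge> R" "G \<ge> 2 * M\<^sup>2" using V(3) by (auto simp: G_def)
    have "escapes e V \<delta> (weight e k) p" if p: "norm p > 4 + G" for p
    proof -
      have gG: "hgauge e p \<ge> G"
      proof (rule ccontr)
        assume "\<not> hgauge e p \<ge> G"
        then have "4 * hgauge e p + (hgauge e p)\<^sup>2 \<le> 4 * G + G\<^sup>2"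
          using hgauge_nonneg[of e p] by (intro add_mono power_mono) auto
        also have "\<dots> \<le> (4 + G)\<^sup>2" using G(1) by (simp add: power2_eq_square algebra_simps)
        finally have "(norm p)\<^sup>2 \<le> (4 + G)\<^sup>2" using norm_le_hgauge[of p e] by linarith
        then have "norm p \<le> 4 + G" using G(1) by (intro power2_le_imp_le[of "norm p" "4 + G"]) auto
        then show False using p by simp
      qed
      then obtain v where v: "v \<in> V"
        "\<And>s. s \<in> {0..1} \<Longrightarrow> hnorm e (hline e v s p) \<le> hnorm e p * exp (- (c * s\<^sup>2 / hgauge e p))"
        using V(4)[of p] G by force
      define a where "a = hnorm e p"
      have gp: "hgauge e p > 0" using gG G by linarith
      have mono: "hnorm e (hline e v s p) \<le> hnorm e p" if "s \<in> {0..1}" for s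
      proof -
        have "0 \<le> c * s\<^sup>2 / hgauge e p" using V(2) gp by simp
        then have "hnorm e p * exp (- (c * s\<^sup>2 / hgauge e p)) \<le> hnorm e p * 1"
          by (intro mult_left_mono) (auto simp: hnorm_nonneg)
        then show ?thesis using v(2)[OF that] by simp
      qed
      have "M\<^sup>2 \<le> a\<^sup>2"
        using hnorm_power2_bounds(1)[of e p] hnorm_power2_bounds(2)[of e p] gG G by (simp add: a_def)
      then have aM: "M \<le> a" by (rule power2_le_imp_le) (simp add: a_def hnorm_nonneg)
      have M: "M \<ge> 1" "M \<ge> \<epsilon>" "M \<ge> exp (2 / \<epsilon> * ln (1 / \<delta>))" by (auto simp: M_def)
      have a1: "a \<ge> 1" using aM M by linarith
      have ea: "\<epsilon> \<le> a\<^sup>2"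
      proof -
        have "\<epsilon> \<le> a" using aM M by linarith
        also have "a * 1 \<le> a * a" using a1 by (intro mult_left_mono) auto
        finally show ?thesis by (simp add: power2_eq_square)
      qed
      define b where "b = hnorm e (hmove e v p)"
      have b: "0 \<le> b" "b \<le> a * exp (- (\<epsilon> / a\<^sup>2))"
      proof -
        have "b \<le> a * exp (- (c / hgauge e p))"
          using v(2)[of 1] by (simp add: a_def b_def)
        also have "c / hgauge e p \<ge> \<epsilon> / a\<^sup>2"
        proof -
          have "c / (2 * a\<^sup>2) \<le> c / hgauge e p"
            using hnorm_power2_bounds(1)[of e p] V(2) gp a1 by (intro divide_left_mono) (auto simp: a_def)
          then show ?thesis by (simp add: \<epsilon>_def)
        qed
        then have "a * exp (- (c / hgauge e p)) \<le> a * exp (- (\<epsilon> / a\<^sup>2))"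
          using a1 by (intro mult_left_mono) auto
        finally show "b \<le> a * exp (- (\<epsilon> / a\<^sup>2))" .
      qed (simp add: b_def hnorm_nonneg)
      have drop: "b powr k * ln (b + 1) + \<epsilon> / 2 * ln (a + 1) \<le> a powr k * ln (a + 1)"
        by (rule potential_drop[OF k a1 \<epsilon> ea b])
      have "2 / \<epsilon> * ln (1 / \<delta>) \<le> ln (a + 1)"
      proof -
        have "exp (2 / \<epsilon> * ln (1 / \<delta>)) \<le> a + 1" using M aM by linarith
        then have "ln (exp (2 / \<epsilon> * ln (1 / \<delta>))) \<le> ln (a + 1)"
          using a1 by (subst ln_le_cancel_iff) auto
        then show ?thesis by simp
      qed
      then have "\<epsilon> / 2 * (2 / \<epsilon> * ln (1 / \<delta>)) \<le> \<epsilon> / 2 * ln (a + 1)"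
        using \<epsilon> by (intro mult_left_mono) auto
      then have "ln (1 / \<delta>) \<le> \<epsilon> / 2 * ln (a + 1)" using \<epsilon> by simp
      then have "- (a powr k * ln (a + 1)) \<le> ln \<delta> + - (b powr k * ln (b + 1))"
        using drop \<delta> by (simp add: ln_div)
      then have "exp (- (a powr k * ln (a + 1))) \<le> exp (ln \<delta> + - (b powr k * ln (b + 1)))"
        by simp
      then have "weight e k p \<le> \<delta> * weight e k (hmove e v p)"
        using \<delta> by (simp only: exp_add exp_ln weight_def a_def b_def)
      then show ?thesis
        using v(1) mono k by (auto intro!: weight_antimono bexI[of _ v])
    qed
    then show ?thesis by blast
  qed
  with V(1) show ?thesis by (rule that)
qed

section \<open>The Poincare inequality\<close>

lemma locally_integrable_measurable:
  fixes f :: "'a::euclidean_space \<Rightarrow> real"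
  assumes "locally_integrable f"
  shows "f \<in> borel_measurable lebesgue"
proof (rule borel_measurable_LIMSEQ_real)
  show "(\<lambda>p. indicator (cball 0 (real m)) p *\<^sub>R f p) \<in> borel_measurable lebesgue" for m
    using assms compact_cball[of "0::'a" "real m"]
    unfolding locally_integrable_def set_integrable_def by (blast intro: borel_measurable_integrable)
  fix p :: 'a
  have "eventually (\<lambda>m. indicator (cball 0 (real m)) p *\<^sub>R f p = f p) sequentially"
    using eventually_ge_at_top[of "nat \<lceil>norm p\<rceil>"]
    by eventually_elim (simp add: nat_ceiling_le_eq)
  then show "(\<lambda>m. indicator (cball 0 (real m)) p *\<^sub>R f p) \<longlonglongrightarrow> f p"
    by (rule tendsto_eventually)
qed

lemma integrable_lborel_cutoff_cong:
  fixes f f' :: "'a::euclidean_space \<Rightarrow> real"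
  assumes f: "locally_integrable f" and [measurable]: "f' \<in> borel_measurable borel"
    and ae: "AE p in lebesgue. f p = f' p"
  shows "set_integrable lborel (cball 0 r) f'"
proof -
  have [measurable]: "cball 0 r \<in> sets (borel :: 'a measure)" by simp
  have "integrable lebesgue (\<lambda>p. indicator (cball 0 r) p *\<^sub>R f p)"
    using f compact_cball[of "0::'a" r] by (simp add: locally_integrable_def set_integrable_def)
  then have "integrable lebesgue (\<lambda>p. indicator (cball 0 r) p *\<^sub>R f' p)"
    by (rule integrable_cong_AE_imp)
      (use ae in \<open>auto intro!: measurable_completion elim!: eventually_mono\<close>)
  then show ?thesis
    unfolding set_integrable_def by (subst (asm) integrable_completion) simp_all
qed

lemma integral_lebesgue_cong_lborel:
  fixes F F' :: "'a::euclidean_space \<Rightarrow> real"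
  assumes "F \<in> borel_measurable lebesgue" "F' \<in> borel_measurable borel" "AE p in lebesgue. F p = F' p"
  shows "(\<integral>p. F p \<partial>lebesgue) = (\<integral>p. F' p \<partial>lborel)"
proof -
  have "(\<integral>p. F p \<partial>lebesgue) = (\<integral>p. F' p \<partial>lebesgue)"
    using assms by (intro integral_cong_AE) (auto intro: measurable_completion)
  then show ?thesis
    using assms(2) by (simp add: integral_completion)
qed

text \<open>
  Changing \<open>f\<close> and \<open>g\<close> on a null set affects neither the weak formulation nor the integrals.
\<close>
lemma borel_representative:
  fixes e :: "'n::finite"
  assumes fg: "weak_subgradient e f g"
  obtains f' g' where "borel_weak_gradient e f' g'"
    "AE p in lebesgue. f p = f' p" "AE p in lebesgue. g p = g' p"
proof -
  have f: "locally_integrable f" and g: "\<And>j. locally_integrable (\<lambda>p. g p $ j)"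
    and wk: "\<And>j \<phi>. test_function \<phi> \<Longrightarrow>
      (\<integral>p. f p * frechet_derivative \<phi> (at p) (horiz e j p) \<partial>lebesgue) = - (\<integral>p. g p $ j * \<phi> p \<partial>lebesgue)"
    using fg by (auto simp: weak_subgradient_def)
  note [measurable] = locally_integrable_measurable[OF f] locally_integrable_measurable[OF g]
  obtain f' where f': "f' \<in> borel_measurable borel" "AE p in lebesgue. f p = f' p"
    using completion_ex_borel_measurable_real[of f lborel] locally_integrable_measurable[OF f]
    by (auto intro: AE_completion)
  have "\<exists>h. h \<in> borel_measurable borel \<and> (AE p in lebesgue. g p $ j = h p)" for j
    using completion_ex_borel_measurable_real[of "\<lambda>p. g p $ j" lborel] locally_integrable_measurable[OF g]
    by (auto intro: AE_completion)
  then have "\<forall>j. \<exists>h. h \<in> borel_measurable borel \<and> (AE p in lebesgue. g p $ j = h p)" ..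
  from choice[OF this] obtain h where "\<forall>j. h j \<in> borel_measurable borel \<and> (AE p in lebesgue. g p $ j = h j p)" ..
  then have h: "\<And>j. h j \<in> borel_measurable borel" "\<And>j. AE p in lebesgue. g p $ j = h j p" by simp_all
  define g' where "g' p = (\<chi> j. h j p)" for p
  have g'_ae: "AE p in lebesgue. g p = g' p"
  proof -
    have "AE p in lebesgue. \<forall>j\<in>UNIV. g p $ j = h j p"
      using h(2) by (intro AE_finite_allI) auto
    then show ?thesis by eventually_elim (simp add: g'_def vec_eq_iff)
  qed
  have g'_borel: "g' \<in> borel_measurable borel"
  proof -
    have "g' = (\<lambda>p. \<Sum>j\<in>UNIV. h j p *\<^sub>R axis j 1)"
      by (simp add: g'_def fun_eq_iff vec_eq_iff axis_def if_distrib cong: if_cong)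
    then show ?thesis using h(1) by simp
  qed
  have "borel_weak_gradient e f' g'"
  proof
    show "set_integrable lborel (cball 0 r) f'" for r
      using f f' by (rule integrable_lborel_cutoff_cong)
    show "set_integrable lborel (cball 0 r) (\<lambda>p. g' p $ j)" for r j
      using integrable_lborel_cutoff_cong[OF g h(1,2)] by (simp add: g'_def)
    fix \<phi> :: "'n heis \<Rightarrow> real" and j :: "'n + 'n"
    assume \<phi>: "test_function \<phi>"
    have b1: "\<phi> \<in> borel_measurable borel"
      by (rule borel_measurable_continuous_onI[OF test_function_continuous[OF \<phi>]])
    have "continuous_on UNIV (horiz e j)"
      unfolding horiz_eq_hfield[abs_def] by (intro continuous_intros)
    then have b2: "(\<lambda>p. frechet_derivative \<phi> (at p) (horiz e j p)) \<in> borel_measurable borel"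
      by (intro borel_measurable_continuous_onI test_function_continuous_derivative[OF \<phi>])
    have "(\<integral>p. f' p * frechet_derivative \<phi> (at p) (horiz e j p) \<partial>lborel)
        = (\<integral>p. f p * frechet_derivative \<phi> (at p) (horiz e j p) \<partial>lebesgue)"
    proof (rule integral_lebesgue_cong_lborel[symmetric])
      show "(\<lambda>p. f p * frechet_derivative \<phi> (at p) (horiz e j p)) \<in> borel_measurable lebesgue"
        using b2 by (intro borel_measurable_times locally_integrable_measurable[OF f]) (auto intro: measurable_completion)
      show "(\<lambda>p. f' p * frechet_derivative \<phi> (at p) (horiz e j p)) \<in> borel_measurable borel"
        using b2 f'(1) by (rule borel_measurable_times[rotated])
    qed (use f'(2) in \<open>auto elim!: eventually_mono\<close>)
    also have "\<dots> = - (\<integral>p. g p $ j * \<phi> p \<partial>lebesgue)" by (rule wk[OF \<phi>])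
    also have "(\<integral>p. g p $ j * \<phi> p \<partial>lebesgue) = (\<integral>p. g' p $ j * \<phi> p \<partial>lborel)"
    proof (rule integral_lebesgue_cong_lborel)
      show "(\<lambda>p. g p $ j * \<phi> p) \<in> borel_measurable lebesgue"
        using b1 by (intro borel_measurable_times locally_integrable_measurable[OF g]) (auto intro: measurable_completion)
      show "(\<lambda>p. g' p $ j * \<phi> p) \<in> borel_measurable borel"
        unfolding g'_def using b1 h(1)[of j] by simp
    qed (use g'_ae in \<open>auto elim!: eventually_mono\<close>)
    finally show "(\<integral>p. f' p * frechet_derivative \<phi> (at p) (horiz e j p) \<partial>lborel) = - (\<integral>p. g' p $ j * \<phi> p \<partial>lborel)" .
  qed (fact f'(1) g'_borel)+
  then show ?thesis using f'(2) g'_ae by (rule that)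
qed

text \<open>
  The tail estimate bounds \<open>\<integral> w |f - c|\<^sup>q\<close> by \<open>\<integral> |f - c|\<^sup>q\<close> over a fixed ball. Taking \<open>c = f p\<^sub>0\<close> and averaging over
  \<open>p\<^sub>0\<close> in that ball produces the double integral of the local inequality, so no mean value of \<open>f\<close> over
  the ball has to be considered. \<open>L\<close> is any lower bound of all these deviations.
\<close>
lemma sub_const_bound:
  fixes e :: "'n::finite"
  assumes card: "CARD('n) \<ge> 2" and k: "k \<ge> 2" and q: "q > 1"
    and fin: "(\<integral>\<^sup>+p. ennreal (weight e k p) \<partial>lborel) < \<infinity>"
  shows "\<exists>C>0. \<forall>f g L. borel_weak_gradient e f g \<longrightarrow>
    (\<forall>c. L \<le> deviation q (weight e k) f c) \<longrightarrow>
    L \<le> ennreal C * energy q (weight e k) g"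
proof -
  let ?w = "weight e k"
  have w: "continuous_on UNIV ?w" "\<And>p. ?w p > 0" "\<And>p. ?w p \<ge> 0"
    using continuous_on_weight[of k e] k weight_pos[of e k] by (simp_all add: less_imp_le)
  obtain V where V: "finite V" "\<And>\<delta>. \<delta> > 0 \<Longrightarrow> \<exists>R. \<forall>p. norm p > R \<longrightarrow>
    escapes e V \<delta> ?w p"
    by (rule weight_descent[OF card k, of e]) (rule that)
  \<comment> \<open>small enough for the end point terms of all directions to add up to at most one half\<close>
  define \<delta> where "\<delta> = 1 / (2 * 2 powr q * (real (card V) + 1))"
  have \<delta>: "\<delta> > 0" by (simp add: \<delta>_def add_nonneg_pos)
  have \<delta>': "2 powr q * card V * \<delta> \<le> 1 / 2"
    unfolding \<delta>_def by (simp add: divide_simps)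
  obtain R0 where R0: "\<And>p. norm p > R0 \<Longrightarrow>
    escapes e V \<delta> ?w p"
    using V(2)[OF \<delta>] by blast
  define R where "R = max R0 1"
  define K where "K = cball (0::'n heis) R"
  have K [measurable]: "K \<in> sets borel" by (simp add: K_def)
  obtain C2 where C2: "C2 \<ge> 0" "\<And>f g. borel_weak_gradient e f g \<Longrightarrow>
    oscillation q K f
      \<le> ennreal C2 * energy q ?w g"
    using local_poincare[OF q w(1,2), where R = R] unfolding K_def by blast
  define C1 where "C1 = 2 * 2 powr q * (\<Sum>v\<in>V. norm v powr q)"
  have C1: "C1 \<ge> 0" unfolding C1_def by (simp add: sum_nonneg)
  define \<kappa> where "\<kappa> = measure lborel K"
  have \<kappa>: "emeasure lborel K = ennreal \<kappa>" "\<kappa> > 0"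
  proof -
    have "emeasure lborel K < \<infinity>" unfolding K_def by (rule emeasure_lborel_cball_finite)
    then show e: "emeasure lborel K = ennreal \<kappa>"
      unfolding \<kappa>_def by (intro emeasure_eq_ennreal_measure) auto
    have "ball (0::'n heis) 1 \<subseteq> K" by (auto simp: K_def R_def)
    then have "emeasure lborel (ball (0::'n heis) 1) \<le> emeasure lborel K"
      by (intro emeasure_mono) auto
    moreover have "emeasure lborel (ball (0::'n heis) 1) \<noteq> 0"
      using open_not_negligible[of "ball (0::'n heis) 1"]
      by (auto simp: negligible_iff_null_sets null_sets_def)
    ultimately have "ennreal \<kappa> \<noteq> 0" using e by auto
    then show "\<kappa> > 0" by (rule contrapos_np) (simp add: ennreal_neg)
  qed
  define C where "C = (2 * C2 + C1 * \<kappa>) / \<kappa> + 1"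
  have C: "C > 0" using C1 C2(1) \<kappa>(2) by (simp add: C_def add_nonneg_pos)
  show ?thesis
  proof (intro exI[of _ C] conjI allI impI C)
    fix f :: "'n heis \<Rightarrow> real" and g :: "'n heis \<Rightarrow> real ^ ('n + 'n)" and L
    assume "borel_weak_gradient e f g"
      and L: "\<forall>c. L \<le> deviation q ?w f c"
    then interpret borel_weak_gradient e f g by simp
    have [measurable]: "?w \<in> borel_measurable borel"
      using w(1) by (rule borel_measurable_continuous_onI)
    let ?G = "energy q ?w g"
    define I where "I c = (\<integral>\<^sup>+p. indicator K p * ennreal (\<bar>f p - c\<bar> powr q) \<partial>lborel)" for c
    have IL: "L \<le> 2 * I c + ennreal C1 * ?G" for c
    proof -
      have "L \<le> deviation q ?w f c" using L by blast
      also have "\<dots> \<le> 2 * (\<integral>\<^sup>+p. indicator (- (- K)) p * (ennreal (?w p) * ennreal (\<bar>f p - c\<bar> powr q)) \<partial>lborel)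
          + ennreal C1 * ?G"
        unfolding C1_def
      proof (rule nn_integral_tail_sub_const_le[OF q w(1,3) fin V(1) _ _ less_imp_le[OF \<delta>] \<delta>'])
        show "- K \<in> sets borel" by simp
        fix p assume "p \<in> - K"
        then have "norm p > R0" by (simp add: K_def R_def)
        then show "escapes e V \<delta> ?w p"
          by (rule R0)
      qed
      also have "\<dots> \<le> 2 * I c + ennreal C1 * ?G"
        unfolding I_def
      proof (intro add_right_mono mult_left_mono nn_integral_mono)
        fix p
        have "?w p \<le> 1" by (simp add: weight_def hnorm_nonneg)
        then have "ennreal (?w p) * ennreal (\<bar>f p - c\<bar> powr q) \<le> 1 * ennreal (\<bar>f p - c\<bar> powr q)"
          by (intro mult_right_mono) auto
        then show "indicator (- (- K)) p * (ennreal (?w p) * ennreal (\<bar>f p - c\<bar> powr q))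
            \<le> indicator K p * ennreal (\<bar>f p - c\<bar> powr q)"
          by (simp add: mult_left_mono)
      qed simp
      finally show ?thesis .
    qed
    have [measurable]: "(\<lambda>p0. I (f p0)) \<in> borel_measurable borel"
      unfolding I_def by measurable
    \<comment> \<open>average the bounds for \<open>c = f p0\<close> over \<open>p0 \<in> K\<close>\<close>
    have "ennreal \<kappa> * L = (\<integral>\<^sup>+p0. L * indicator K p0 \<partial>lborel)"
      by (subst nn_integral_cmult_indicator) (simp_all add: \<kappa> mult.commute)
    also have "\<dots> \<le> (\<integral>\<^sup>+p0. 2 * (indicator K p0 * I (f p0)) + ennreal C1 * ?G * indicator K p0 \<partial>lborel)"
    proof (intro nn_integral_mono)
      fix p0
      show "L * indicator K p0 \<le> 2 * (indicator K p0 * I (f p0)) + ennreal C1 * ?G * indicator K p0"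
        using IL[of "f p0"] by (auto simp: indicator_def)
    qed
    also have "\<dots> = 2 * (\<integral>\<^sup>+p0. indicator K p0 * I (f p0) \<partial>lborel) + ennreal C1 * ?G * ennreal \<kappa>"
      by (simp add: nn_integral_add nn_integral_cmult nn_integral_cmult_indicator \<kappa>(1))
    also have "(\<integral>\<^sup>+p0. indicator K p0 * I (f p0) \<partial>lborel) \<le> ennreal C2 * ?G"
      unfolding I_def by (rule C2(2)) (rule borel_weak_gradient_axioms)
    also have "2 * (ennreal C2 * ?G) + ennreal C1 * ?G * ennreal \<kappa> = ennreal (2 * C2 + C1 * \<kappa>) * ?G"
      using C1 C2(1) \<kappa>(2) by (simp add: ennreal_plus ennreal_mult distrib_right mult_ac)
    finally have "ennreal \<kappa> * L \<le> ennreal (2 * C2 + C1 * \<kappa>) * ?G"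
      by (simp add: add_right_mono mult_left_mono)
    then have "ennreal (1 / \<kappa>) * (ennreal \<kappa> * L) \<le> ennreal (1 / \<kappa>) * (ennreal (2 * C2 + C1 * \<kappa>) * ?G)"
      by (rule mult_left_mono) simp
    moreover have "ennreal (1 / \<kappa>) * (ennreal \<kappa> * L) = L"
      using \<kappa>(2) by (simp add: mult.assoc[symmetric] flip: ennreal_mult)
    moreover have "ennreal (1 / \<kappa>) * (ennreal (2 * C2 + C1 * \<kappa>) * ?G) = ennreal ((2 * C2 + C1 * \<kappa>) / \<kappa>) * ?G"
    proof -
      have "ennreal (1 / \<kappa>) * (ennreal X * ?G) = ennreal (X / \<kappa>) * ?G" if "X \<ge> 0" for X
        using \<kappa>(2) that by (simp add: mult.assoc[symmetric] flip: ennreal_mult)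
      moreover have "2 * C2 + C1 * \<kappa> \<ge> 0"
        using C1 C2(1) \<kappa>(2) by simp
      ultimately show ?thesis .
    qed
    moreover have "ennreal ((2 * C2 + C1 * \<kappa>) / \<kappa>) * ?G \<le> ennreal C * ?G"
      by (intro mult_right_mono ennreal_leI) (auto simp: C_def)
    ultimately show "L \<le> ennreal C * ?G" by simp
  qed
qed

theorem corollary7:
  fixes e :: "'n::finite" and k :: real
  assumes "CARD('n) > 5" and "k \<ge> 3"
  shows "\<forall>q\<ge>2. q_poincare e q (heis_measure e k)"
proof (intro allI impI)
  fix q :: real assume q2: "q \<ge> 2"
  then have q: "q > 1" by simp
  let ?w = "weight e k" and ?M = "heis_measure e k"
  define Z where "Z = norm_const e k"
  have w: "continuous_on UNIV ?w" "\<And>p. ?w p > 0"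
    using continuous_on_weight[of k e] assms(2) weight_pos by auto
  have w_borel: "?w \<in> borel_measurable borel"
    using w(1) by (rule borel_measurable_continuous_onI)
  then have w_leb: "?w \<in> borel_measurable lebesgue" by (simp add: measurable_completion)
  have Z0: "Z \<ge> 0"
    unfolding Z_def norm_const_def by (intro Bochner_Integration.integral_nonneg) (simp add: less_imp_le w)
  have sets_M: "sets ?M = sets lebesgue" by (simp add: heis_measure_def)
  have nn_M: "(\<integral>\<^sup>+p. F p \<partial>?M) = (\<integral>\<^sup>+p. ennreal (?w p / Z) * F p \<partial>lebesgue)"
    if "F \<in> borel_measurable lebesgue" for F
    using that w_leb unfolding heis_measure_def Z_def by (intro nn_integral_density) auto
  have f_leb: "f \<in> borel_measurable lebesgue" if "integrable ?M f" for f :: "'n heis \<Rightarrow> real"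
    using borel_measurable_integrable[OF that] measurable_cong_sets[OF sets_M refl] by blast
  show "q_poincare e q ?M"
  proof (cases "Z = 0")
    \<comment> \<open>a weight that is not integrable has \<open>norm_const = 0\<close>, and then \<open>heis_measure\<close> is the null measure\<close>
    case True
    then show ?thesis
      unfolding q_poincare_def
      by (intro exI[of _ 1]) (auto simp: nn_M dest!: f_leb)
  next
    case False
    then have Z: "Z > 0" using Z0 by simp
    have int: "integrable lebesgue ?w"
      using False unfolding Z_def norm_const_def using not_integrable_integral_eq by blast
    have nn_w: "(\<integral>\<^sup>+p. ennreal (?w p) \<partial>lebesgue) = ennreal Z"
      unfolding Z_def norm_const_def using int w(2)
      by (intro nn_integral_eq_integral) (auto simp: less_imp_le)
    then have fin: "(\<integral>\<^sup>+p. ennreal (?w p) \<partial>lborel) < \<infinity>"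
      by (simp add: nn_integral_completion)
    have mass: "emeasure ?M (space ?M) = 1"
    proof -
      have "emeasure ?M (space ?M) = (\<integral>\<^sup>+p. 1 \<partial>?M)" by simp
      also have "\<dots> = (\<integral>\<^sup>+p. ennreal (?w p / Z) * 1 \<partial>lebesgue)"
        by (rule nn_M) simp
      also have "\<dots> = (\<integral>\<^sup>+p. ennreal (1 / Z) * ennreal (?w p) \<partial>lebesgue)"
        using Z w(2) by (intro nn_integral_cong) (simp add: less_imp_le flip: ennreal_mult)
      also have "\<dots> = ennreal (1 / Z) * ennreal Z"
        using w_leb by (subst nn_integral_cmult) (auto simp: nn_w)
      also have "\<dots> = 1" using Z by (simp flip: ennreal_mult)
      finally show ?thesis .
    qed
    interpret finite_measure ?M by (intro finite_measureI) (simp add: mass)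
    have Mw: "(\<integral>\<^sup>+p. F p \<partial>?M) = ennreal (1 / Z) * (\<integral>\<^sup>+p. ennreal (?w p) * F' p \<partial>lborel)"
      if "F \<in> borel_measurable lebesgue" "F' \<in> borel_measurable borel" "AE p in lebesgue. F p = F' p" for F F'
    proof -
      have "(\<integral>\<^sup>+p. F p \<partial>?M) = (\<integral>\<^sup>+p. ennreal (1 / Z) * (ennreal (?w p) * F' p) \<partial>lebesgue)"
        unfolding nn_M[OF that(1)] using that(3) Z w(2)
        by (intro nn_integral_cong_AE)
          (auto elim!: eventually_mono simp: less_imp_le mult.assoc[symmetric] simp flip: ennreal_mult)
      also have "\<dots> = (\<integral>\<^sup>+p. ennreal (1 / Z) * (ennreal (?w p) * F' p) \<partial>lborel)"
        by (rule nn_integral_completion)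
      also have "\<dots> = ennreal (1 / Z) * (\<integral>\<^sup>+p. ennreal (?w p) * F' p \<partial>lborel)"
        using that(2) w_borel by (intro nn_integral_cmult) auto
      finally show ?thesis .
    qed
    obtain C where C: "C > 0" "\<And>f g L. borel_weak_gradient e f g \<Longrightarrow>
      (\<forall>c. L \<le> deviation q ?w f c) \<Longrightarrow>
      L \<le> ennreal C * energy q ?w g"
      using sub_const_bound[OF _ _ q fin] assms by force
    define A where "A = 2 * 2 powr q / Z"
    have A: "A > 0" using Z by (simp add: A_def)
    have "(\<integral>\<^sup>+p. ennreal (\<bar>f p - (\<integral>p'. f p' \<partial>?M)\<bar> powr q) \<partial>?M)
        \<le> ennreal (A * C * Z) * (\<integral>\<^sup>+p. ennreal (norm (g p) powr q) \<partial>?M)"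
      if fM: "integrable ?M f" and wg: "weak_subgradient e f g" for f g
    proof -
      obtain f' g' where fg': "borel_weak_gradient e f' g'"
        and f': "AE p in lebesgue. f p = f' p" and g': "AE p in lebesgue. g p = g' p"
        by (rule borel_representative[OF wg]) (rule that)
      interpret fg: borel_weak_gradient e f' g' by (rule fg')
      have fl: "f \<in> borel_measurable lebesgue" by (rule f_leb[OF fM])
      have gl: "g \<in> borel_measurable lebesgue"
      proof -
        have "(\<lambda>p. g p $ j) \<in> borel_measurable lebesgue" for j
          using wg by (intro locally_integrable_measurable) (auto simp: weak_subgradient_def)
        then have "(\<lambda>p. \<Sum>j\<in>UNIV. g p $ j *\<^sub>R (axis j 1 :: real ^ ('n + 'n))) \<in> borel_measurable lebesgue"
          by (intro borel_measurable_sum borel_measurable_scaleR) auto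
        also have "(\<lambda>p. \<Sum>j\<in>UNIV. g p $ j *\<^sub>R axis j 1) = g"
          by (simp add: fun_eq_iff vec_eq_iff axis_def if_distrib cong: if_cong)
        finally show ?thesis .
      qed
      define m where "m = (\<integral>p'. f p' \<partial>?M)"
      let ?L = "\<integral>\<^sup>+p. ennreal (\<bar>f p - m\<bar> powr q) \<partial>?M"
      have L: "?L \<le> ennreal A * deviation q ?w f' c" for c
      proof -
        let ?J = "\<integral>\<^sup>+p. ennreal (\<bar>f p - c\<bar> powr q) \<partial>?M"
        have [measurable]: "f \<in> borel_measurable ?M" using fM by simp
        have "(\<integral>p. f p - c \<partial>?M) = m - c"
          using fM mass by (simp add: m_def measure_def)
        then have jen: "ennreal (\<bar>m - c\<bar> powr q) \<le> ?J"
          using jensen_powr[OF q mass, of "\<lambda>p. f p - c"] by simp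
        have "?L \<le> (\<integral>\<^sup>+p. ennreal (2 powr q) * (ennreal (\<bar>f p - c\<bar> powr q) + ennreal (\<bar>m - c\<bar> powr q)) \<partial>?M)"
        proof (intro nn_integral_mono)
          fix p
          show "ennreal (\<bar>f p - m\<bar> powr q) \<le> ennreal (2 powr q) * (ennreal (\<bar>f p - c\<bar> powr q) + ennreal (\<bar>m - c\<bar> powr q))"
            using powr_add_le[of q "f p - c" "c - m"] q
            by (simp add: abs_minus_commute ennreal_leI flip: ennreal_plus ennreal_mult)
        qed
        also have "\<dots> = ennreal (2 powr q) * (?J + ennreal (\<bar>m - c\<bar> powr q))"
          by (simp add: nn_integral_cmult nn_integral_add mass)
        also have "\<dots> \<le> ennreal (2 powr q) * (?J + ?J)"
          by (intro mult_left_mono add_left_mono jen) simp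
        also have "?J = ennreal (1 / Z) * deviation q ?w f' c"
          using fl f' by (intro Mw) (auto elim!: eventually_mono)
        also have "ennreal (2 powr q) * (ennreal (1 / Z) * X + ennreal (1 / Z) * X) = ennreal A * X" for X
        proof -
          have "ennreal A = ennreal (2 powr q) * (ennreal (1 / Z) + ennreal (1 / Z))"
            using Z by (simp add: A_def flip: ennreal_plus ennreal_mult)
          then show ?thesis by (simp add: distrib_right mult.assoc)
        qed
        finally show ?thesis .
      qed
      have "ennreal (1 / A) * ?L \<le> deviation q ?w f' c" for c
      proof -
        have "ennreal (1 / A) * ?L \<le> ennreal (1 / A) * (ennreal A * deviation q ?w f' c)"
          by (intro mult_left_mono L) simp
        also have "\<dots> = deviation q ?w f' c"
          using A by (simp add: mult.assoc[symmetric] flip: ennreal_mult)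
        finally show ?thesis .
      qed
      then have "ennreal (1 / A) * ?L \<le> ennreal C * energy q ?w g'"
        by (intro C(2)[OF fg']) blast
      then have "ennreal A * (ennreal (1 / A) * ?L)
          \<le> ennreal A * (ennreal C * energy q ?w g')"
        by (rule mult_left_mono) simp
      moreover have "ennreal A * (ennreal (1 / A) * ?L) = ?L"
        using A by (simp add: mult.assoc[symmetric] flip: ennreal_mult)
      moreover have "energy q ?w g'
          = ennreal Z * (\<integral>\<^sup>+p. ennreal (norm (g p) powr q) \<partial>?M)"
      proof -
        have "(\<integral>\<^sup>+p. ennreal (norm (g p) powr q) \<partial>?M)
            = ennreal (1 / Z) * energy q ?w g'"
          using gl g' by (intro Mw) (auto elim!: eventually_mono)
        then show ?thesis
          using Z by (simp add: mult.assoc[symmetric] flip: ennreal_mult)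
      qed
      ultimately show ?thesis
        using A C(1) Z by (simp add: m_def ennreal_mult mult.assoc)
    qed
    moreover have "A * C * Z > 0" using A C(1) Z by simp
    ultimately show ?thesis
      unfolding q_poincare_def by blast
  qed
qed

end
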